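(* Let $a<b$, let $n_0,n_1,n_2\ge0$ be integers, $n=n_0+n_1+n_2$, let $B\in\mathbb{R}^{(n_1+2n_2)\times(2n_1+4n_2)}$ be such that $BT$ is invertible, and let $A_0:[a,b]\to\mathbb{R}^{n\times n}$, $A_1:[a,b]\to\mathbb{R}^{n\times(n_1+n_2)}$, $A_2:[a,b]\to\mathbb{R}^{n\times n_2}$ be bounded measurable. Let $X$, $\mathcal{T}$, $\mathcal{A}$ and the sets $\Omega_d$ be as defined in the context. For any $d\in\mathbb{N}$, suppose there exist $\epsilon,\delta>0$ and polynomial matrices $N_0:[a,b]\to\mathbb{R}^{n\times n}$, $N_1,N_2:[a,b]^2\to\mathbb{R}^{n\times n}$ such that, with $\mathcal{P}:=\mathcal{P}_{\{N_0,N_1,N_2\}}$, $$\mathcal{P}_{\{N_0-\epsilon I,N_1,N_2\}}\in\Omega_d\qquad\text{and}\qquad-\delta\,\mathcal{T}^*\mathcal{T}-\mathcal{A}^*\mathcal{P}\mathcal{T}-\mathcal{T}^*\mathcal{P}\mathcal{A}\in\Omega_d.$$ Then the PDE defined by $\{A_i,X\}$ is exponentially stable in $L_2$, i.e. there exist constants $K,\gamma>0$ such that for any $\mathbf{x}_0\in X$, any solution $\mathbf{x}$ of the PDE with initial condition $\mathbf{x}_0$ satisfies $\|\mathbf{x}(t)\|_{L_2}\le K\|\mathbf{x}_0\|_{L_2}e^{-\gamma t}$ for all $t\ge0$.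
   Context: $L_2^m=L_2([a,b];\mathbb{R}^m)$ with its standard inner product; $H_k^m$ is the Sobolev space of $\mathbb{R}^m$-valued functions on $[a,b]$ whose weak derivatives up to order $k$ are in $L_2$. A subscript $s$ denotes $\partial_s$. Adjoints are with respect to the $L_2^n$ inner product, with all operators regarded as bounded operators $L_2^n\to L_2^n$. 3-PI operators: for bounded measurable matrix-valued (possibly rectangular) functions $N_0$ on $[a,b]$ and $N_1,N_2$ on $[a,b]^2$, $$(\mathcal{P}_{\{N_0,N_1,N_2\}}\mathbf{x})(s)=N_0(s)\mathbf{x}(s)+\int_a^s N_1(s,\theta)\mathbf{x}(\theta)\,d\theta+\int_s^b N_2(s,\theta)\mathbf{x}(\theta)\,d\theta .$$ The set $\Omega_d$: let $Z_d(s)$ (resp. $Z_d(s,\theta)$) be the matrix with $n$ columns whose rows form a monomial basis of the $\mathbb{R}^n$-valued polynomials of degree at most $d$ in $s$ (resp. in $(s,\theta)$). For a scalar function $g\ge 0$ on $[a,b]$ and a symmetric positive semidefinite block matrix $P=(P_{ij})_{i,j=1}^3$ of compatible dimensions, put $$M_0(s)=g(s)Z_d(s)^TP_{11}Z_d(s),$$ $$M_1(s,\theta)=g(s)Z_d(s)^TP_{12}Z_d(s,\theta)+g(\theta)Z_d(\theta,s)^TP_{31}Z_d(\theta)+\int_a^\theta g(\nu)Z_d(\nu,s)^TP_{33}Z_d(\nu,\theta)d\nu+\int_\theta^sg(\nu)Z_d(\nu,s)^TP_{32}Z_d(\nu,\theta)d\nu+\int_s^bg(\nu)Z_d(\nu,s)^TP_{22}Z_d(\nu,\theta)d\nu,$$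 $$M_2(s,\theta)=g(s)Z_d(s)^TP_{13}Z_d(s,\theta)+g(\theta)Z_d(\theta,s)^TP_{21}Z_d(\theta)+\int_a^sg(\nu)Z_d(\nu,s)^TP_{33}Z_d(\nu,\theta)d\nu+\int_s^\theta g(\nu)Z_d(\nu,s)^TP_{23}Z_d(\nu,\theta)d\nu+\int_\theta^bg(\nu)Z_d(\nu,s)^TP_{22}Z_d(\nu,\theta)d\nu.$$ $\Omega_d$ is the set of operators on $L_2^n$ that are a sum of one operator $\mathcal{P}_{\{M_0,M_1,M_2\}}$ of this form with $g(s)=1$ and one operator of this form with $g(s)=(s-a)(b-s)$ (each with its own $P\ge0$). The matrix $T\in\mathbb{R}^{(2n_1+4n_2)\times(n_1+2n_2)}$ is $$T=\begin{bmatrix} I_{n_1}&0&0\\ I_{n_1}&0&0\\ 0&I_{n_2}&0\\ 0&I_{n_2}&(b-a)I_{n_2}\\ 0&0&I_{n_2}\\ 0&0&I_{n_2}\end{bmatrix}.$$ The space $X$ is the set of $\mathbf{x}=(x_0,x_1,x_2)\in L_2^{n_0}\times H_1^{n_1}\times H_2^{n_2}$ such that $$B\begin{bmatrix} x_1(a)\\ x_1(b)\\ x_2(a)\\ x_2(b)\\ x_{2s}(a)\\ x_{2s}(b)\end{bmatrix}=0,$$ equipped with $\langle\mathbf{x},\mathbf{y}\rangle_X=\langle x_0,y_0\rangle_{L_2}+\langle\partial_s x_1,\partial_s y_1\rangle_{L_2}+\langle\partial_s^2x_2,\partial_s^2y_2\rangle_{L_2}$ (an inner product on $X$ when $BT$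 is invertible) and the norm $\|\cdot\|_X$ it induces. Define (columns of $Q$ and rows of $K(s)$ partitioned as $n_0,n_1,n_2$; columns of $K(s)$ and of $V$ partitioned as $n_1,n_2,n_2$; rows of $V,G_3,G_4,G_5$ partitioned as $n_1,n_2$; columns of $G_0,\dots,G_5$ partitioned as $n_0,n_1,n_2$; the matrix function $K(s)$ is unrelated to the constant $K$) $$Q(s,\theta)=\begin{bmatrix} 0&0&0\\ 0&I_{n_1}&0\\ 0&0&0\\ 0&0&(b-\theta)I_{n_2}\\ 0&0&0\\ 0&0&I_{n_2}\end{bmatrix},\quad K(s)=\begin{bmatrix} 0&0&0\\ I_{n_1}&0&0\\ 0&I_{n_2}&(s-a)I_{n_2}\end{bmatrix},\quad V=\begin{bmatrix} 0&0&0\\ 0&0&I_{n_2}\end{bmatrix},$$ $$G_0(s)=\begin{bmatrix} I_{n_0}&0&0\\ 0&0&0\\ 0&0&0\end{bmatrix},\quad G_2(s,\theta)=-K(s)(BT)^{-1}BQ(s,\theta),\quad G_1(s,\theta)=\begin{bmatrix} 0&0&0\\ 0&I_{n_1}&0\\ 0&0&(s-\theta)I_{n_2}\end{bmatrix}+G_2(s,\theta),$$ $$G_3(s)=\begin{bmatrix} 0&I_{n_1}&0\\ 0&0&0\end{bmatrix},\quad G_5(s,\theta)=-V(BT)^{-1}BQ(s,\theta),\quad G_4(s,\theta)=\begin{bmatrix} 0&0&0\\ 0&0&I_{n_2}\end{bmatrix}+G_5(s,\theta).$$ Then $\mathcal{T}:=\mathcal{P}_{\{G_0,G_1,G_2\}}$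 and $\mathcal{A}:=\mathcal{P}_{\{H_0,H_1,H_2\}}$ with $H_0=A_0G_0+A_1G_3+A_{20}$, $A_{20}(s)=\begin{bmatrix} 0&0&A_2(s)\end{bmatrix}$, $H_1(s,\theta)=A_0(s)G_1(s,\theta)+A_1(s)G_4(s,\theta)$, $H_2(s,\theta)=A_0(s)G_2(s,\theta)+A_1(s)G_5(s,\theta)$. PDE solution: $\mathbf{x}$ is a solution of the PDE defined by $\{A_i,X\}$ with initial condition $\mathbf{x}_0\in X$ if $\mathbf{x}(0)=\mathbf{x}_0$, $\mathbf{x}(t)=(x_0(t),x_1(t),x_2(t))\in X$ for all $t\ge0$, $\mathbf{x}:[0,\infty)\to X$ is Fréchet differentiable (with respect to $\|\cdot\|_X$) for all $t\ge 0$, and for all $t\ge0$ (as an identity in $L_2^n$) $$\dot{\mathbf{x}}(t,s)=A_0(s)\mathbf{x}(t,s)+A_1(s)\begin{bmatrix} \partial_sx_1(t,s)\\ \partial_sx_2(t,s)\end{bmatrix}+A_2(s)\,\partial_s^2x_2(t,s).$$ *)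

theory Defs
  imports
    "HOL-Analysis.Analysis"
    "Jordan_Normal_Form.Gauss_Jordan_Elimination"
begin

text \<open>The block dimensions are natural numbers that may be zero, so vectors and matrices are those
  of Jordan_Normal_Form, which carry their dimensions at run time. The corresponding notation for
  type-indexed vectors is switched off.\<close>

unbundle no vec_syntax and no inner_syntax

text \<open>Elements of \<open>L\<^sub>2\<close> are represented by functions on the whole line, of which only the
  values on \<open>[a,b]\<close> matter; equality in \<open>L\<^sub>2\<close> is \<open>ae_eq\<close>.\<close>

definition L2 :: "real \<Rightarrow> real \<Rightarrow> nat \<Rightarrow> (real \<Rightarrow> real vec) set" where
  "L2 a b m = {u. (\<forall>s\<in>{a..b}. u s \<in> carrier_vec m) \<and>
     (\<forall>i<m. (\<lambda>s. u s $ i) \<in> borel_measurable (lebesgue_on {a..b}) \<and>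
            integrable (lebesgue_on {a..b}) (\<lambda>s. (u s $ i)^2))}"

definition ae_eq :: "real \<Rightarrow> real \<Rightarrow> (real \<Rightarrow> 'v) \<Rightarrow> (real \<Rightarrow> 'v) \<Rightarrow> bool" where
  "ae_eq a b u v \<longleftrightarrow> (AE s in lebesgue_on {a..b}. u s = v s)"

definition l2_inner :: "real \<Rightarrow> real \<Rightarrow> (real \<Rightarrow> real vec) \<Rightarrow> (real \<Rightarrow> real vec) \<Rightarrow> real" where
  "l2_inner a b u v = (LINT s:{a..b}|lebesgue. u s \<bullet> v s)"

definition l2_norm :: "real \<Rightarrow> real \<Rightarrow> (real \<Rightarrow> real vec) \<Rightarrow> real" where
  "l2_norm a b u = sqrt (l2_inner a b u u)"

text \<open>The adjoint of a bounded operator \<open>F\<close> on \<open>L\<^sub>2\<^sup>n\<close>; its value at \<open>y\<close> is determined up to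
  equality almost everywhere.\<close>

definition l2_adjoint ::
  "real \<Rightarrow> real \<Rightarrow> nat \<Rightarrow> ((real \<Rightarrow> real vec) \<Rightarrow> real \<Rightarrow> real vec) \<Rightarrow> (real \<Rightarrow> real vec) \<Rightarrow> real \<Rightarrow> real vec" where
  "l2_adjoint a b n F y =
     (SOME z. z \<in> L2 a b n \<and> (\<forall>x\<in>L2 a b n. l2_inner a b (F x) y = l2_inner a b x z))"

definition smooth_fun :: "(real \<Rightarrow> real) \<Rightarrow> bool" where
  "smooth_fun \<phi> \<longleftrightarrow> (\<exists>D :: nat \<Rightarrow> real \<Rightarrow> real. D 0 = \<phi> \<and>
     (\<forall>k t. (D k has_real_derivative D (Suc k) t) (at t)))"

definition test_fun :: "real \<Rightarrow> real \<Rightarrow> (real \<Rightarrow> real) \<Rightarrow> bool" where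
  "test_fun a b \<phi> \<longleftrightarrow> smooth_fun \<phi> \<and> (\<exists>c d. a < c \<and> d < b \<and> (\<forall>s. s \<notin> {c..d} \<longrightarrow> \<phi> s = 0))"

definition has_weak_deriv ::
  "real \<Rightarrow> real \<Rightarrow> nat \<Rightarrow> (real \<Rightarrow> real vec) \<Rightarrow> (real \<Rightarrow> real vec) \<Rightarrow> bool" where
  "has_weak_deriv a b m u v \<longleftrightarrow> (\<forall>\<phi>. test_fun a b \<phi> \<longrightarrow> (\<forall>i<m.
     (LINT s:{a..b}|lebesgue. u s $ i * deriv \<phi> s) = - (LINT s:{a..b}|lebesgue. v s $ i * \<phi> s)))"

definition weak_deriv ::
  "real \<Rightarrow> real \<Rightarrow> nat \<Rightarrow> (real \<Rightarrow> real vec) \<Rightarrow> real \<Rightarrow> real vec" where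
  "weak_deriv a b m u = (SOME v. v \<in> L2 a b m \<and> has_weak_deriv a b m u v)"

primrec sobolev :: "nat \<Rightarrow> real \<Rightarrow> real \<Rightarrow> nat \<Rightarrow> (real \<Rightarrow> real vec) set" where
  "sobolev 0 a b m = L2 a b m"
| "sobolev (Suc k) a b m = {u \<in> L2 a b m. \<exists>v\<in>sobolev k a b m. has_weak_deriv a b m u v}"

text \<open>Point values of a Sobolev function are those of its continuous representative.\<close>

definition cont_rep :: "real \<Rightarrow> real \<Rightarrow> (real \<Rightarrow> real) \<Rightarrow> real \<Rightarrow> real" where
  "cont_rep a b f = (SOME g. continuous_on {a..b} g \<and> ae_eq a b f g)"

definition point_value :: "real \<Rightarrow> real \<Rightarrow> nat \<Rightarrow> (real \<Rightarrow> real vec) \<Rightarrow> real \<Rightarrow> real vec" where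
  "point_value a b m u s = vec m (\<lambda>i. cont_rep a b (\<lambda>\<theta>. u \<theta> $ i) s)"

definition bounded_measurable_mat :: "real \<Rightarrow> real \<Rightarrow> nat \<Rightarrow> nat \<Rightarrow> (real \<Rightarrow> real mat) \<Rightarrow> bool" where
  "bounded_measurable_mat a b r c M \<longleftrightarrow>
     (\<forall>s\<in>{a..b}. M s \<in> carrier_mat r c) \<and>
     (\<forall>i<r. \<forall>j<c. (\<lambda>s. M s $$ (i,j)) \<in> borel_measurable (lebesgue_on {a..b}) \<and>
        (\<exists>C. \<forall>s\<in>{a..b}. \<bar>M s $$ (i,j)\<bar> \<le> C))"

definition poly_mat1 :: "real \<Rightarrow> real \<Rightarrow> nat \<Rightarrow> nat \<Rightarrow> (real \<Rightarrow> real mat) \<Rightarrow> bool" where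
  "poly_mat1 a b r c M \<longleftrightarrow>
     (\<forall>s\<in>{a..b}. M s \<in> carrier_mat r c) \<and>
     (\<forall>i<r. \<forall>j<c. \<exists>p :: real poly. \<forall>s\<in>{a..b}. M s $$ (i,j) = poly p s)"

definition poly_mat2 :: "real \<Rightarrow> real \<Rightarrow> nat \<Rightarrow> nat \<Rightarrow> (real \<Rightarrow> real \<Rightarrow> real mat) \<Rightarrow> bool" where
  "poly_mat2 a b r c M \<longleftrightarrow>
     (\<forall>s\<in>{a..b}. \<forall>\<theta>\<in>{a..b}. M s \<theta> \<in> carrier_mat r c) \<and>
     (\<forall>i<r. \<forall>j<c. \<exists>(m::nat) (\<alpha> :: nat \<Rightarrow> nat \<Rightarrow> real). \<forall>s\<in>{a..b}. \<forall>\<theta>\<in>{a..b}.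
        M s \<theta> $$ (i,j) = (\<Sum>k\<le>m. \<Sum>l\<le>m. \<alpha> k l * s^k * \<theta>^l))"

definition vec_integral :: "nat \<Rightarrow> real set \<Rightarrow> (real \<Rightarrow> real vec) \<Rightarrow> real vec" where
  "vec_integral m S f = vec m (\<lambda>i. LINT \<theta>:S|lebesgue. f \<theta> $ i)"

definition mat_integral :: "nat \<Rightarrow> nat \<Rightarrow> real set \<Rightarrow> (real \<Rightarrow> real mat) \<Rightarrow> real mat" where
  "mat_integral r c S f = mat r c (\<lambda>(i,j). LINT \<theta>:S|lebesgue. f \<theta> $$ (i,j))"

definition append_cols :: "real mat \<Rightarrow> real mat \<Rightarrow> real mat" (infixr \<open>@\<^sub>c\<close> 66) where
  "A @\<^sub>c C = four_block_mat A C (0\<^sub>m 0 (dim_col A)) (0\<^sub>m 0 (dim_col C))"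

definition mat_inv :: "real mat \<Rightarrow> real mat" where
  "mat_inv A = the (mat_inverse A)"

definition sub_block :: "real mat \<Rightarrow> nat \<Rightarrow> nat \<Rightarrow> nat \<Rightarrow> nat \<Rightarrow> real mat" where
  "sub_block A r0 nr c0 nc = mat nr nc (\<lambda>(i,j). A $$ (r0 + i, c0 + j))"

definition psd_mat :: "nat \<Rightarrow> real mat \<Rightarrow> bool" where
  "psd_mat q P \<longleftrightarrow> P \<in> carrier_mat q q \<and> transpose_mat P = P \<and>
     (\<forall>v\<in>carrier_vec q. 0 \<le> v \<bullet> (P *\<^sub>v v))"

text \<open>The number \<open>r\<close> is the number of rows of the three kernels.\<close>

definition PI_op ::
  "real \<Rightarrow> real \<Rightarrow> nat \<Rightarrow> (real \<Rightarrow> real mat) \<Rightarrow> (real \<Rightarrow> real \<Rightarrow> real mat) \<Rightarrow> (real \<Rightarrow> real \<Rightarrow> real mat) \<Rightarrow>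
   (real \<Rightarrow> real vec) \<Rightarrow> real \<Rightarrow> real vec" where
  "PI_op a b r N0 N1 N2 x s =
     N0 s *\<^sub>v x s
     + vec_integral r {a..s} (\<lambda>\<theta>. N1 s \<theta> *\<^sub>v x \<theta>)
     + vec_integral r {s..b} (\<lambda>\<theta>. N2 s \<theta> *\<^sub>v x \<theta>)"

text \<open>\<open>Z1\<close> and \<open>Z2\<close> list the basis of the vector-valued polynomials as rows: row \<open>k * n + j\<close> is the
  \<open>k\<close>-th scalar monomial times the \<open>j\<close>-th unit vector. Degree in two variables is total degree.\<close>

definition monoms :: "nat \<Rightarrow> (nat \<times> nat) list" where
  "monoms d = [(p, q). p \<leftarrow> [0..<Suc d], q \<leftarrow> [0..<Suc (d - p)]]"

definition Z1 :: "nat \<Rightarrow> nat \<Rightarrow> real \<Rightarrow> real mat" where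
  "Z1 d n s = mat (Suc d * n) n (\<lambda>(r,c). if r mod n = c then s ^ (r div n) else 0)"

definition Z2 :: "nat \<Rightarrow> nat \<Rightarrow> real \<Rightarrow> real \<Rightarrow> real mat" where
  "Z2 d n s \<theta> = mat (length (monoms d) * n) n (\<lambda>(r,c).
     if r mod n = c then s ^ fst (monoms d ! (r div n)) * \<theta> ^ snd (monoms d ! (r div n)) else 0)"

definition P_size :: "nat \<Rightarrow> nat \<Rightarrow> nat \<Rightarrow> nat" where
  "P_size d n i = (if i = 1 then Suc d * n else length (monoms d) * n)"

definition P_block :: "nat \<Rightarrow> nat \<Rightarrow> real mat \<Rightarrow> nat \<Rightarrow> nat \<Rightarrow> real mat" where
  "P_block d n P i j =
     sub_block P (\<Sum>k=1..<i. P_size d n k) (P_size d n i) (\<Sum>k=1..<j. P_size d n k) (P_size d n j)"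

definition M0 :: "nat \<Rightarrow> nat \<Rightarrow> (real \<Rightarrow> real) \<Rightarrow> real mat \<Rightarrow> real \<Rightarrow> real mat" where
  "M0 d n g P s = g s \<cdot>\<^sub>m ((Z1 d n s)\<^sup>T * P_block d n P 1 1 * Z1 d n s)"

definition M1 :: "real \<Rightarrow> real \<Rightarrow> nat \<Rightarrow> nat \<Rightarrow> (real \<Rightarrow> real) \<Rightarrow> real mat \<Rightarrow> real \<Rightarrow> real \<Rightarrow> real mat" where
  "M1 a b d n g P s \<theta> =
     g s \<cdot>\<^sub>m ((Z1 d n s)\<^sup>T * P_block d n P 1 2 * Z2 d n s \<theta>)
     + g \<theta> \<cdot>\<^sub>m ((Z2 d n \<theta> s)\<^sup>T * P_block d n P 3 1 * Z1 d n \<theta>)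
     + mat_integral n n {a..\<theta>} (\<lambda>\<nu>. g \<nu> \<cdot>\<^sub>m ((Z2 d n \<nu> s)\<^sup>T * P_block d n P 3 3 * Z2 d n \<nu> \<theta>))
     + mat_integral n n {\<theta>..s} (\<lambda>\<nu>. g \<nu> \<cdot>\<^sub>m ((Z2 d n \<nu> s)\<^sup>T * P_block d n P 3 2 * Z2 d n \<nu> \<theta>))
     + mat_integral n n {s..b} (\<lambda>\<nu>. g \<nu> \<cdot>\<^sub>m ((Z2 d n \<nu> s)\<^sup>T * P_block d n P 2 2 * Z2 d n \<nu> \<theta>))"

definition M2 :: "real \<Rightarrow> real \<Rightarrow> nat \<Rightarrow> nat \<Rightarrow> (real \<Rightarrow> real) \<Rightarrow> real mat \<Rightarrow> real \<Rightarrow> real \<Rightarrow> real mat" where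
  "M2 a b d n g P s \<theta> =
     g s \<cdot>\<^sub>m ((Z1 d n s)\<^sup>T * P_block d n P 1 3 * Z2 d n s \<theta>)
     + g \<theta> \<cdot>\<^sub>m ((Z2 d n \<theta> s)\<^sup>T * P_block d n P 2 1 * Z1 d n \<theta>)
     + mat_integral n n {a..s} (\<lambda>\<nu>. g \<nu> \<cdot>\<^sub>m ((Z2 d n \<nu> s)\<^sup>T * P_block d n P 3 3 * Z2 d n \<nu> \<theta>))
     + mat_integral n n {s..\<theta>} (\<lambda>\<nu>. g \<nu> \<cdot>\<^sub>m ((Z2 d n \<nu> s)\<^sup>T * P_block d n P 2 3 * Z2 d n \<nu> \<theta>))
     + mat_integral n n {\<theta>..b} (\<lambda>\<nu>. g \<nu> \<cdot>\<^sub>m ((Z2 d n \<nu> s)\<^sup>T * P_block d n P 2 2 * Z2 d n \<nu> \<theta>))"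

definition PI_of_psd ::
  "real \<Rightarrow> real \<Rightarrow> nat \<Rightarrow> nat \<Rightarrow> (real \<Rightarrow> real) \<Rightarrow> real mat \<Rightarrow> (real \<Rightarrow> real vec) \<Rightarrow> real \<Rightarrow> real vec" where
  "PI_of_psd a b d n g P = PI_op a b n (M0 d n g P) (M1 a b d n g P) (M2 a b d n g P)"

text \<open>Operators are compared on \<open>L\<^sub>2\<^sup>n\<close>, up to equality almost everywhere.\<close>

definition Omega :: "real \<Rightarrow> real \<Rightarrow> nat \<Rightarrow> nat \<Rightarrow> ((real \<Rightarrow> real vec) \<Rightarrow> real \<Rightarrow> real vec) set" where
  "Omega a b n d = {R. \<exists>P P'.
     psd_mat (\<Sum>k=1..3. P_size d n k) P \<and> psd_mat (\<Sum>k=1..3. P_size d n k) P' \<and>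
     (\<forall>x\<in>L2 a b n. ae_eq a b (R x)
        (\<lambda>s. PI_of_psd a b d n (\<lambda>s. 1) P x s
           + PI_of_psd a b d n (\<lambda>s. (s - a) * (b - s)) P' x s))}"

definition T_mat :: "real \<Rightarrow> real \<Rightarrow> nat \<Rightarrow> nat \<Rightarrow> real mat" where
  "T_mat a b n1 n2 =
     (1\<^sub>m n1    @\<^sub>c 0\<^sub>m n1 n2 @\<^sub>c 0\<^sub>m n1 n2) @\<^sub>r
     (1\<^sub>m n1    @\<^sub>c 0\<^sub>m n1 n2 @\<^sub>c 0\<^sub>m n1 n2) @\<^sub>r
     (0\<^sub>m n2 n1 @\<^sub>c 1\<^sub>m n2    @\<^sub>c 0\<^sub>m n2 n2) @\<^sub>r
     (0\<^sub>m n2 n1 @\<^sub>c 1\<^sub>m n2    @\<^sub>c (b - a) \<cdot>\<^sub>m 1\<^sub>m n2) @\<^sub>r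
     (0\<^sub>m n2 n1 @\<^sub>c 0\<^sub>m n2 n2 @\<^sub>c 1\<^sub>m n2) @\<^sub>r
     (0\<^sub>m n2 n1 @\<^sub>c 0\<^sub>m n2 n2 @\<^sub>c 1\<^sub>m n2)"

definition Q_mat :: "real \<Rightarrow> nat \<Rightarrow> nat \<Rightarrow> nat \<Rightarrow> real \<Rightarrow> real mat" where
  "Q_mat b n0 n1 n2 \<theta> =
     (0\<^sub>m n1 n0 @\<^sub>c 0\<^sub>m n1 n1 @\<^sub>c 0\<^sub>m n1 n2) @\<^sub>r
     (0\<^sub>m n1 n0 @\<^sub>c 1\<^sub>m n1    @\<^sub>c 0\<^sub>m n1 n2) @\<^sub>r
     (0\<^sub>m n2 n0 @\<^sub>c 0\<^sub>m n2 n1 @\<^sub>c 0\<^sub>m n2 n2) @\<^sub>r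
     (0\<^sub>m n2 n0 @\<^sub>c 0\<^sub>m n2 n1 @\<^sub>c (b - \<theta>) \<cdot>\<^sub>m 1\<^sub>m n2) @\<^sub>r
     (0\<^sub>m n2 n0 @\<^sub>c 0\<^sub>m n2 n1 @\<^sub>c 0\<^sub>m n2 n2) @\<^sub>r
     (0\<^sub>m n2 n0 @\<^sub>c 0\<^sub>m n2 n1 @\<^sub>c 1\<^sub>m n2)"

definition K_mat :: "real \<Rightarrow> nat \<Rightarrow> nat \<Rightarrow> nat \<Rightarrow> real \<Rightarrow> real mat" where
  "K_mat a n0 n1 n2 s =
     (0\<^sub>m n0 n1 @\<^sub>c 0\<^sub>m n0 n2 @\<^sub>c 0\<^sub>m n0 n2) @\<^sub>r
     (1\<^sub>m n1    @\<^sub>c 0\<^sub>m n1 n2 @\<^sub>c 0\<^sub>m n1 n2) @\<^sub>r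
     (0\<^sub>m n2 n1 @\<^sub>c 1\<^sub>m n2    @\<^sub>c (s - a) \<cdot>\<^sub>m 1\<^sub>m n2)"

definition V_mat :: "nat \<Rightarrow> nat \<Rightarrow> real mat" where
  "V_mat n1 n2 =
     (0\<^sub>m n1 n1 @\<^sub>c 0\<^sub>m n1 n2 @\<^sub>c 0\<^sub>m n1 n2) @\<^sub>r
     (0\<^sub>m n2 n1 @\<^sub>c 0\<^sub>m n2 n2 @\<^sub>c 1\<^sub>m n2)"

definition G0 :: "nat \<Rightarrow> nat \<Rightarrow> nat \<Rightarrow> real \<Rightarrow> real mat" where
  "G0 n0 n1 n2 s =
     (1\<^sub>m n0    @\<^sub>c 0\<^sub>m n0 n1 @\<^sub>c 0\<^sub>m n0 n2) @\<^sub>r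
     (0\<^sub>m n1 n0 @\<^sub>c 0\<^sub>m n1 n1 @\<^sub>c 0\<^sub>m n1 n2) @\<^sub>r
     (0\<^sub>m n2 n0 @\<^sub>c 0\<^sub>m n2 n1 @\<^sub>c 0\<^sub>m n2 n2)"

definition G2 :: "real \<Rightarrow> real \<Rightarrow> nat \<Rightarrow> nat \<Rightarrow> nat \<Rightarrow> real mat \<Rightarrow> real \<Rightarrow> real \<Rightarrow> real mat" where
  "G2 a b n0 n1 n2 B s \<theta> =
     - (K_mat a n0 n1 n2 s * mat_inv (B * T_mat a b n1 n2) * B * Q_mat b n0 n1 n2 \<theta>)"

definition G1 :: "real \<Rightarrow> real \<Rightarrow> nat \<Rightarrow> nat \<Rightarrow> nat \<Rightarrow> real mat \<Rightarrow> real \<Rightarrow> real \<Rightarrow> real mat" where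
  "G1 a b n0 n1 n2 B s \<theta> =
     ((0\<^sub>m n0 n0 @\<^sub>c 0\<^sub>m n0 n1 @\<^sub>c 0\<^sub>m n0 n2) @\<^sub>r
      (0\<^sub>m n1 n0 @\<^sub>c 1\<^sub>m n1    @\<^sub>c 0\<^sub>m n1 n2) @\<^sub>r
      (0\<^sub>m n2 n0 @\<^sub>c 0\<^sub>m n2 n1 @\<^sub>c (s - \<theta>) \<cdot>\<^sub>m 1\<^sub>m n2))
     + G2 a b n0 n1 n2 B s \<theta>"

definition G3 :: "nat \<Rightarrow> nat \<Rightarrow> nat \<Rightarrow> real \<Rightarrow> real mat" where
  "G3 n0 n1 n2 s =
     (0\<^sub>m n1 n0 @\<^sub>c 1\<^sub>m n1    @\<^sub>c 0\<^sub>m n1 n2) @\<^sub>r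
     (0\<^sub>m n2 n0 @\<^sub>c 0\<^sub>m n2 n1 @\<^sub>c 0\<^sub>m n2 n2)"

definition G5 :: "real \<Rightarrow> real \<Rightarrow> nat \<Rightarrow> nat \<Rightarrow> nat \<Rightarrow> real mat \<Rightarrow> real \<Rightarrow> real \<Rightarrow> real mat" where
  "G5 a b n0 n1 n2 B s \<theta> =
     - (V_mat n1 n2 * mat_inv (B * T_mat a b n1 n2) * B * Q_mat b n0 n1 n2 \<theta>)"

definition G4 :: "real \<Rightarrow> real \<Rightarrow> nat \<Rightarrow> nat \<Rightarrow> nat \<Rightarrow> real mat \<Rightarrow> real \<Rightarrow> real \<Rightarrow> real mat" where
  "G4 a b n0 n1 n2 B s \<theta> =
     ((0\<^sub>m n1 n0 @\<^sub>c 0\<^sub>m n1 n1 @\<^sub>c 0\<^sub>m n1 n2) @\<^sub>r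
      (0\<^sub>m n2 n0 @\<^sub>c 0\<^sub>m n2 n1 @\<^sub>c 1\<^sub>m n2))
     + G5 a b n0 n1 n2 B s \<theta>"

definition T_op ::
  "real \<Rightarrow> real \<Rightarrow> nat \<Rightarrow> nat \<Rightarrow> nat \<Rightarrow> real mat \<Rightarrow> (real \<Rightarrow> real vec) \<Rightarrow> real \<Rightarrow> real vec" where
  "T_op a b n0 n1 n2 B =
     PI_op a b (n0 + n1 + n2) (G0 n0 n1 n2) (G1 a b n0 n1 n2 B) (G2 a b n0 n1 n2 B)"

definition A_op ::
  "real \<Rightarrow> real \<Rightarrow> nat \<Rightarrow> nat \<Rightarrow> nat \<Rightarrow> real mat \<Rightarrow>
   (real \<Rightarrow> real mat) \<Rightarrow> (real \<Rightarrow> real mat) \<Rightarrow> (real \<Rightarrow> real mat) \<Rightarrow>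
   (real \<Rightarrow> real vec) \<Rightarrow> real \<Rightarrow> real vec" where
  "A_op a b n0 n1 n2 B A0 A1 A2 =
     PI_op a b (n0 + n1 + n2)
       (\<lambda>s. A0 s * G0 n0 n1 n2 s + A1 s * G3 n0 n1 n2 s
            + (0\<^sub>m (n0 + n1 + n2) n0 @\<^sub>c 0\<^sub>m (n0 + n1 + n2) n1 @\<^sub>c A2 s))
       (\<lambda>s \<theta>. A0 s * G1 a b n0 n1 n2 B s \<theta> + A1 s * G4 a b n0 n1 n2 B s \<theta>)
       (\<lambda>s \<theta>. A0 s * G2 a b n0 n1 n2 B s \<theta> + A1 s * G5 a b n0 n1 n2 B s \<theta>)"

text \<open>A state is a function into dimension \<open>n0 + n1 + n2\<close>; \<open>part k m x\<close> is its component made of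
  the \<open>m\<close> coordinates from position \<open>k\<close> on.\<close>

definition part :: "nat \<Rightarrow> nat \<Rightarrow> (real \<Rightarrow> real vec) \<Rightarrow> real \<Rightarrow> real vec" where
  "part k m x s = vec m (\<lambda>i. x s $ (k + i))"

definition bdry_vec :: "real \<Rightarrow> real \<Rightarrow> nat \<Rightarrow> nat \<Rightarrow> nat \<Rightarrow> (real \<Rightarrow> real vec) \<Rightarrow> real vec" where
  "bdry_vec a b n0 n1 n2 x =
     (let x1 = part n0 n1 x; x2 = part (n0 + n1) n2 x; x2s = weak_deriv a b n2 x2 in
        point_value a b n1 x1 a @\<^sub>v point_value a b n1 x1 b @\<^sub>v
        point_value a b n2 x2 a @\<^sub>v point_value a b n2 x2 b @\<^sub>v
        point_value a b n2 x2s a @\<^sub>v point_value a b n2 x2s b)"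

definition X_space :: "real \<Rightarrow> real \<Rightarrow> nat \<Rightarrow> nat \<Rightarrow> nat \<Rightarrow> real mat \<Rightarrow> (real \<Rightarrow> real vec) set" where
  "X_space a b n0 n1 n2 B =
     {x. (\<forall>s\<in>{a..b}. x s \<in> carrier_vec (n0 + n1 + n2)) \<and>
         part 0 n0 x \<in> L2 a b n0 \<and>
         part n0 n1 x \<in> sobolev 1 a b n1 \<and>
         part (n0 + n1) n2 x \<in> sobolev 2 a b n2 \<and>
         B *\<^sub>v bdry_vec a b n0 n1 n2 x = 0\<^sub>v (n1 + 2 * n2)}"

definition X_inner ::
  "real \<Rightarrow> real \<Rightarrow> nat \<Rightarrow> nat \<Rightarrow> nat \<Rightarrow> (real \<Rightarrow> real vec) \<Rightarrow> (real \<Rightarrow> real vec) \<Rightarrow> real" where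
  "X_inner a b n0 n1 n2 x y =
     l2_inner a b (part 0 n0 x) (part 0 n0 y)
     + l2_inner a b (weak_deriv a b n1 (part n0 n1 x)) (weak_deriv a b n1 (part n0 n1 y))
     + l2_inner a b (weak_deriv a b n2 (weak_deriv a b n2 (part (n0 + n1) n2 x)))
                    (weak_deriv a b n2 (weak_deriv a b n2 (part (n0 + n1) n2 y)))"

definition X_norm :: "real \<Rightarrow> real \<Rightarrow> nat \<Rightarrow> nat \<Rightarrow> nat \<Rightarrow> (real \<Rightarrow> real vec) \<Rightarrow> real" where
  "X_norm a b n0 n1 n2 x = sqrt (X_inner a b n0 n1 n2 x x)"

text \<open>Frechet derivative at time \<open>t\<close> of a curve in \<open>X\<close> (one-sided at \<open>t = 0\<close>): the bounded linear
  map from the reals to \<open>X\<close> is identified with its value \<open>v\<close> at \<open>1\<close>.\<close>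

definition has_X_derivative ::
  "real \<Rightarrow> real \<Rightarrow> nat \<Rightarrow> nat \<Rightarrow> nat \<Rightarrow> real mat \<Rightarrow>
   (real \<Rightarrow> real \<Rightarrow> real vec) \<Rightarrow> (real \<Rightarrow> real vec) \<Rightarrow> real \<Rightarrow> bool" where
  "has_X_derivative a b n0 n1 n2 B x v t \<longleftrightarrow>
     v \<in> X_space a b n0 n1 n2 B \<and>
     ((\<lambda>r. X_norm a b n0 n1 n2 (\<lambda>s. x r s - x t s - (r - t) \<cdot>\<^sub>v v s) / \<bar>r - t\<bar>) \<longlongrightarrow> 0)
       (at t within {0..})"

definition pde_solution ::
  "real \<Rightarrow> real \<Rightarrow> nat \<Rightarrow> nat \<Rightarrow> nat \<Rightarrow> real mat \<Rightarrow>
   (real \<Rightarrow> real mat) \<Rightarrow> (real \<Rightarrow> real mat) \<Rightarrow> (real \<Rightarrow> real mat) \<Rightarrow>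
   (real \<Rightarrow> real vec) \<Rightarrow> (real \<Rightarrow> real \<Rightarrow> real vec) \<Rightarrow> bool" where
  "pde_solution a b n0 n1 n2 B A0 A1 A2 x0 x \<longleftrightarrow>
     ae_eq a b (x 0) x0 \<and>
     (\<forall>t\<ge>0. x t \<in> X_space a b n0 n1 n2 B) \<and>
     (\<exists>xdot. \<forall>t\<ge>0. has_X_derivative a b n0 n1 n2 B x (xdot t) t \<and>
        ae_eq a b (xdot t) (\<lambda>s.
          A0 s *\<^sub>v x t s
          + A1 s *\<^sub>v (weak_deriv a b n1 (part n0 n1 (x t)) s
                     @\<^sub>v weak_deriv a b n2 (part (n0 + n1) n2 (x t)) s)
          + A2 s *\<^sub>v weak_deriv a b n2 (weak_deriv a b n2 (part (n0 + n1) n2 (x t))) s))"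

end

theory Submission
  imports Defs
begin

text \<open>The boundary conditions make an element \<open>x\<close> of \<open>X\<close> recoverable from its fundamental state
  \<open>u = (x\<^sub>0, \<partial>x\<^sub>1, \<partial>\<^sup>2x\<^sub>2)\<close>: one has \<open>x = T u\<close>, and the right-hand side of the PDE is \<open>A u\<close>. Along a solution the
  function \<open>V = \<langle>x, P x\<rangle>\<close> therefore has the derivative \<open>\<langle>A u, P T u\<rangle> + \<langle>T u, P A u\<rangle>\<close>, which the second inequality
  bounds by \<open>-\<delta> \<parallel>T u\<parallel>\<^sup>2 = -\<delta> \<parallel>x\<parallel>\<^sup>2\<close>. Since \<open>\<epsilon> \<parallel>x\<parallel>\<^sup>2 \<le> V \<le> C \<parallel>x\<parallel>\<^sup>2\<close>, the decay follows from Gronwall's inequality.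
  The operators in \<open>\<Omega>\<^sub>d\<close> are nonnegative because each summand factors as \<open>F\<^sup>* (g P) F\<close> with
  \<open>F x = (Z\<^sub>d x, \<integral>\<^sub>a\<^sup>s Z\<^sub>d x, \<integral>\<^sub>s\<^sup>b Z\<^sub>d x)\<close>. Adjoints exist because the transposed kernels give one explicitly.\<close>

text \<open>Three points shape the proof. A solution is differentiable in the norm of X, which sees
  only the fundamental state, while V is a form on \<open>L2\<close>; what connects the two is again
  x = T u, which with T bounded is a Poincare inequality. Next, weak derivatives and point values
  are selected by \<open>SOME\<close>, so x = T u needs uniqueness of weak derivatives and of
  continuous representatives. Both rest on test functions, and the entries s - \<theta> and b -
  \<theta> of the kernels are the weights of the integral remainder in the second order Taylor
  formula. Finally, all operators are put into one form, a matrix of scalar operators with a bounded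
  multiplier and a single bounded kernel on the square; compositions have an explicit kernel in this
  form, so the factorization behind positivity is a comparison of coefficients. P is not assumed
  symmetric: the second inequality has the terms with A on the left and on the right of P
  separately, and these are the two terms of the product rule for V. Since V is quadratic in the
  norm, the constants become sqrt(C/\<epsilon>) and \<delta>/(2C).\<close>

lemmas LINT_cong = Bochner_Integration.integral_cong
lemmas LINT_add = Bochner_Integration.integral_add
lemmas LINT_sum = Bochner_Integration.integral_sum

text \<open>A nonnegative quadratic is evaluated at its minimiser -B/C. The conclusion avoids
  division so that it also covers C = 0, which occurs for functions that vanish almost
  everywhere.\<close>

lemma discriminant_le:
  fixes A B C :: real
  assumes nonneg: "\<And>t. 0 \<le> A + 2 * t * B + t^2 * C" and "0 \<le> C"
  shows "B^2 \<le> A * C"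
proof (cases "C = 0")
  case True
  have "B = 0"
  proof (rule ccontr)
    assume "B \<noteq> 0"
    \<comment> \<open>With C = 0 the expression is affine in t, and this t is the point where it
      takes the value -1.\<close>
    then have "A + 2 * (- (A + 1) / (2 * B)) * B = -1" by (simp add: field_simps)
    then show False using nonneg[of "- (A + 1) / (2 * B)"] True by simp
  qed
  then show ?thesis using True by simp
next
  case False
  have "0 \<le> A + 2 * (- B / C) * B + (- B / C)^2 * C" by (rule nonneg)
  also have "\<dots> = A - B^2 / C" using False by (simp add: field_simps power2_eq_square)
  finally show ?thesis using False \<open>0 \<le> C\<close> by (simp add: field_simps)
qed

text \<open>The bound holds everywhere on the space rather than almost everywhere, so that the
  section of a kernel is bounded for every value of the fixed variable.\<close>

definition bdd :: "'a measure \<Rightarrow> ('a \<Rightarrow> real) \<Rightarrow> bool" where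
  "bdd N f \<longleftrightarrow> f \<in> borel_measurable N \<and> (\<exists>C. \<forall>x\<in>space N. \<bar>f x\<bar> \<le> C)"

lemma bdd_bound:
  assumes "bdd N f" obtains C where "C \<ge> 0" "\<forall>x\<in>space N. \<bar>f x\<bar> \<le> C"
proof -
  obtain C where "\<forall>x\<in>space N. \<bar>f x\<bar> \<le> C" using assms unfolding bdd_def by blast
  then have "\<forall>x\<in>space N. \<bar>f x\<bar> \<le> \<bar>C\<bar>" by (auto intro: order_trans)
  then show ?thesis by (rule that[rotated]) simp
qed

lemma bdd_cong: "(\<And>x. x \<in> space N \<Longrightarrow> f x = g x) \<Longrightarrow> bdd N f \<longleftrightarrow> bdd N g"
  unfolding bdd_def using measurable_cong[of N f g borel] by auto

lemma bdd_const [intro, simp]: "bdd N (\<lambda>_. c)" unfolding bdd_def by auto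

lemma bdd_add: assumes "bdd N f" "bdd N g" shows "bdd N (\<lambda>x. f x + g x)"
proof -
  obtain C D where C: "\<forall>x\<in>space N. \<bar>f x\<bar> \<le> C" and D: "\<forall>x\<in>space N. \<bar>g x\<bar> \<le> D"
    using assms unfolding bdd_def by blast
  have "\<bar>f x + g x\<bar> \<le> C + D" if "x \<in> space N" for x
    using C[rule_format, OF that] D[rule_format, OF that] by linarith
  then show ?thesis using assms unfolding bdd_def by (auto intro: borel_measurable_add)
qed

lemma bdd_mult [intro]: assumes "bdd N f" "bdd N g" shows "bdd N (\<lambda>x. f x * g x)"
proof -
  obtain C where C: "C \<ge> 0" "\<forall>x\<in>space N. \<bar>f x\<bar> \<le> C" by (rule bdd_bound[OF assms(1)])
  obtain D where D: "D \<ge> 0" "\<forall>x\<in>space N. \<bar>g x\<bar> \<le> D" by (rule bdd_bound[OF assms(2)])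
  have "\<bar>f x * g x\<bar> \<le> C * D" if "x \<in> space N" for x
    using C D that by (auto simp: abs_mult intro!: mult_mono)
  then show ?thesis using assms unfolding bdd_def by (auto intro: borel_measurable_times)
qed

lemma bdd_sum: "(\<And>i. i \<in> I \<Longrightarrow> bdd N (f i)) \<Longrightarrow> bdd N (\<lambda>x. \<Sum>i\<in>I. f i x)"
  by (induction I rule: infinite_finite_induct) (auto intro: bdd_add)

text \<open>Swapping, fixing or adding a variable is composition with a measurable map, so this one
  rule serves all of these operations on kernels.\<close>

lemma bdd_compose:
  assumes "bdd N f" "g \<in> measurable K N" shows "bdd K (\<lambda>x. f (g x))"
  using assms(1) measurable_space[OF assms(2)] measurable_compose[OF assms(2), of f borel] unfolding bdd_def by auto

section \<open>Scalar square-integrable functions on a compact interval\<close>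

locale interval =
  fixes a b :: real
  assumes ab: "a < b"
begin

abbreviation M :: "real measure" where "M \<equiv> lebesgue_on {a..b}"

definition sq_int :: "(real \<Rightarrow> real) set" where
  "sq_int = {f. f \<in> borel_measurable M \<and> integrable M (\<lambda>s. (f s)^2)}"

abbreviation bdd1 :: "(real \<Rightarrow> real) \<Rightarrow> bool" where "bdd1 \<equiv> bdd M"

definition bdd2 :: "(real \<Rightarrow> real \<Rightarrow> real) \<Rightarrow> bool" where
  "bdd2 k \<longleftrightarrow> bdd (M \<Otimes>\<^sub>M M) (\<lambda>x. k (fst x) (snd x))"

text \<open>Multiplication operator plus one integral operator over all of [a,b]. Volterra limits
  are moved into the kernel as weights, which keeps the class stable under transposition and
  composition.\<close>

definition kop :: "(real \<Rightarrow> real) \<Rightarrow> (real \<Rightarrow> real \<Rightarrow> real) \<Rightarrow> (real \<Rightarrow> real) \<Rightarrow> real \<Rightarrow> real" where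
  "kop c k f s = c s * f s + (LINT t|M. k s t * f t)"

lemma space_M [simp]: "space M = {a..b}" by simp

sublocale M: finite_measure M
  by (rule finite_measure_lebesgue_on) auto

sublocale MM: pair_sigma_finite M M ..

lemma measurable_ident_M [measurable]:
  "(\<lambda>s. s) \<in> borel_measurable M"
  by (rule continuous_imp_measurable_on_sets_lebesgue) (auto intro: continuous_intros)

lemma bdd1D [measurable_dest]: "bdd1 f \<Longrightarrow> f \<in> borel_measurable M"
  unfolding bdd_def by auto

lemma bdd2_bound:
  assumes "bdd2 k" obtains C where "C \<ge> 0" "\<And>s t. s \<in> {a..b} \<Longrightarrow> t \<in> {a..b} \<Longrightarrow> \<bar>k s t\<bar> \<le> C"
proof -
  obtain C where C: "C \<ge> 0" "\<forall>x\<in>space (M \<Otimes>\<^sub>M M). \<bar>k (fst x) (snd x)\<bar> \<le> C"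
    by (rule bdd_bound[OF assms[unfolded bdd2_def]])
  show ?thesis by (rule that[OF C(1)]) (use C(2) in \<open>auto simp: space_pair_measure\<close>)
qed

lemma bdd2D: "bdd2 k \<Longrightarrow> (\<lambda>x. k (fst x) (snd x)) \<in> borel_measurable (M \<Otimes>\<^sub>M M)"
  unfolding bdd2_def bdd_def by auto

lemma sq_intD [measurable_dest]: "f \<in> sq_int \<Longrightarrow> f \<in> borel_measurable M"
  unfolding sq_int_def by auto

lemma sq_int_square: "f \<in> sq_int \<Longrightarrow> integrable M (\<lambda>s. (f s)^2)"
  unfolding sq_int_def by auto

lemma sq_int_mult_integrable:
  assumes "f \<in> sq_int" "g \<in> sq_int"
  shows "integrable M (\<lambda>s. f s * g s)"
proof (rule Bochner_Integration.integrable_bound)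
  show "integrable M (\<lambda>s. (f s)^2 + (g s)^2)"
    using assms by (intro Bochner_Integration.integrable_add sq_int_square)
  show "(\<lambda>s. f s * g s) \<in> borel_measurable M" using assms by measurable
  have "\<bar>x * y\<bar> \<le> x^2 + y^2" for x y :: real
  proof -
    have "2 * (\<bar>x\<bar> * \<bar>y\<bar>) \<le> x^2 + y^2" using sum_squares_bound[of "\<bar>x\<bar>" "\<bar>y\<bar>"] by simp
    moreover have "0 \<le> \<bar>x\<bar> * \<bar>y\<bar>" by simp
    ultimately show ?thesis unfolding abs_mult by linarith
  qed
  then show "AE s in M. norm (f s * g s) \<le> norm ((f s)^2 + (g s)^2)" by auto
qed

lemma sq_int_const [intro, simp]: "(\<lambda>_. c) \<in> sq_int"
  unfolding sq_int_def by auto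

lemma sq_int_integrable: "f \<in> sq_int \<Longrightarrow> integrable M f"
  using sq_int_mult_integrable[of f "\<lambda>_. 1"] by simp

lemma sq_int_add [intro]:
  assumes "f \<in> sq_int" "g \<in> sq_int" shows "(\<lambda>s. f s + g s) \<in> sq_int"
proof -
  have "integrable M (\<lambda>s. (f s)^2 + (g s)^2 + 2 * (f s * g s))"
    using assms by (intro Bochner_Integration.integrable_add sq_int_square integrable_mult_right sq_int_mult_integrable)
  then have "integrable M (\<lambda>s. (f s + g s)^2)" by (simp add: power2_sum algebra_simps)
  moreover have "(\<lambda>s. f s + g s) \<in> borel_measurable M" using assms by measurable
  ultimately show ?thesis unfolding sq_int_def by simp
qed

lemma sq_int_bounded_mult:
  assumes "bdd1 c" "f \<in> sq_int" shows "(\<lambda>s. c s * f s) \<in> sq_int"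
proof -
  obtain C where C: "C \<ge> 0" "\<forall>s\<in>space M. \<bar>c s\<bar> \<le> C" by (rule bdd_bound[OF assms(1)])
  have "integrable M (\<lambda>s. (c s * f s)^2)"
  proof (rule Bochner_Integration.integrable_bound)
    show "integrable M (\<lambda>s. C^2 * (f s)^2)" using assms by (intro integrable_mult_right sq_int_square)
    show "(\<lambda>s. (c s * f s)\<^sup>2) \<in> borel_measurable M" using assms by measurable
    show "AE s in M. norm ((c s * f s)\<^sup>2) \<le> norm (C\<^sup>2 * (f s)\<^sup>2)"
    proof (rule AE_I2)
      fix s assume "s \<in> space M"
      then have "\<bar>c s\<bar> \<le> C" using C by simp
      then have "(c s)^2 \<le> C^2" using C(1) by (simp add: abs_le_square_iff[symmetric])
      then show "norm ((c s * f s)\<^sup>2) \<le> norm (C\<^sup>2 * (f s)\<^sup>2)" by (simp add: power_mult_distrib mult_right_mono)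
    qed
  qed
  moreover have "(\<lambda>s. c s * f s) \<in> borel_measurable M" using assms by measurable
  ultimately show ?thesis unfolding sq_int_def by simp
qed

lemma bdd1_sq_int: "bdd1 c \<Longrightarrow> c \<in> sq_int"
  using sq_int_bounded_mult[of c "\<lambda>_. 1"] by simp

lemma sq_int_cmult [intro]: "f \<in> sq_int \<Longrightarrow> (\<lambda>s. c * f s) \<in> sq_int"
  using sq_int_bounded_mult[of "\<lambda>_. c"] by simp

lemma sq_int_sum [intro]: "(\<And>i. i \<in> I \<Longrightarrow> f i \<in> sq_int) \<Longrightarrow> (\<lambda>s. \<Sum>i\<in>I. f i s) \<in> sq_int"
  by (induction I rule: infinite_finite_induct) auto

lemma sq_int_cong:
  assumes "\<And>s. s \<in> {a..b} \<Longrightarrow> f s = g s" shows "f \<in> sq_int \<longleftrightarrow> g \<in> sq_int"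
  unfolding sq_int_def using assms
  by (auto intro!: arg_cong2[where f=conj] measurable_cong Bochner_Integration.integrable_cong simp: measurable_cong[of M f g] Bochner_Integration.integrable_cong[of M M "\<lambda>s. (f s)^2" "\<lambda>s. (g s)^2"])

lemma Cauchy_Schwarz_integral:
  assumes "f \<in> sq_int" "g \<in> sq_int"
  shows "(LINT s|M. f s * g s)^2 \<le> (LINT s|M. (f s)^2) * (LINT s|M. (g s)^2)"
proof (rule discriminant_le)
  fix t :: real
  note I = sq_int_square[OF assms(1)] sq_int_square[OF assms(2)] sq_int_mult_integrable[OF assms]
  have "0 \<le> (LINT s|M. (f s + t * g s)^2)" by simp
  also have "\<dots> = (LINT s|M. (f s)^2 + 2 * t * (f s * g s) + t^2 * (g s)^2)"
    by (rule LINT_cong) (auto simp: power2_sum algebra_simps power_mult_distrib)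
  also have "\<dots> = (LINT s|M. (f s)^2) + 2 * t * (LINT s|M. f s * g s) + t^2 * (LINT s|M. (g s)^2)"
    using I by simp
  finally show "0 \<le> (LINT s|M. (f s)^2) + 2 * t * (LINT s|M. f s * g s) + t^2 * (LINT s|M. (g s)^2)" .
qed simp

subsection \<open>Bounded kernels\<close>

lemma bdd2_cong:
  assumes "\<And>s t. s \<in> {a..b} \<Longrightarrow> t \<in> {a..b} \<Longrightarrow> k s t = k' s t"
  shows "bdd2 k \<longleftrightarrow> bdd2 k'"
  unfolding bdd2_def by (rule bdd_cong) (auto simp: space_pair_measure assms)

lemma bdd2_const [intro, simp]: "bdd2 (\<lambda>_ _. c)" unfolding bdd2_def by (rule bdd_const)

lemma bdd2_add: "bdd2 k \<Longrightarrow> bdd2 l \<Longrightarrow> bdd2 (\<lambda>s t. k s t + l s t)"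
  unfolding bdd2_def by (rule bdd_add)

lemma bdd2_mult [intro]: "bdd2 k \<Longrightarrow> bdd2 l \<Longrightarrow> bdd2 (\<lambda>s t. k s t * l s t)"
  unfolding bdd2_def by (rule bdd_mult)

lemma bdd2_sum: "(\<And>i. i \<in> I \<Longrightarrow> bdd2 (k i)) \<Longrightarrow> bdd2 (\<lambda>s t. \<Sum>i\<in>I. k i s t)"
  unfolding bdd2_def by (rule bdd_sum)

lemma bdd2_power: "bdd2 k \<Longrightarrow> bdd2 (\<lambda>s t. k s t ^ p)"
  by (induction p) auto

lemma bdd2_uminus: "bdd2 k \<Longrightarrow> bdd2 (\<lambda>s t. - k s t)"
  using bdd2_mult[of "\<lambda>_ _. -1" k] by simp

lemma bdd2_diff: "bdd2 k \<Longrightarrow> bdd2 l \<Longrightarrow> bdd2 (\<lambda>s t. k s t - l s t)"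
  using bdd2_add[OF _ bdd2_uminus, of k l] by simp

lemma bdd2_swap: "bdd2 k \<Longrightarrow> bdd2 (\<lambda>s t. k t s)"
  unfolding bdd2_def by (drule bdd_compose[OF _ measurable_pair_swap']) (simp add: case_prod_unfold)

lemma bdd2_fst: "bdd1 f \<Longrightarrow> bdd2 (\<lambda>s t. f s)"
  unfolding bdd2_def by (rule bdd_compose[OF _ measurable_fst])

lemma bdd2_snd: "bdd1 f \<Longrightarrow> bdd2 (\<lambda>s t. f t)"
  using bdd2_swap[OF bdd2_fst] by simp

lemma bdd1_section: assumes "bdd2 k" "s \<in> {a..b}" shows "bdd1 (k s)"
  using bdd_compose[OF assms(1)[unfolded bdd2_def] measurable_Pair1'[of s M M]] assms(2) by simp

lemma bdd1_section2: "bdd2 k \<Longrightarrow> t \<in> {a..b} \<Longrightarrow> bdd1 (\<lambda>s. k s t)"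
  using bdd1_section[OF bdd2_swap] by simp

text \<open>Lets functions of one variable be treated by the rules for kernels; for the converse the
  dummy argument is fixed at \<open>a\<close>.\<close>

lemma bdd1_iff_bdd2: "bdd1 f \<longleftrightarrow> bdd2 (\<lambda>s t. f s)"
  using bdd2_fst bdd1_section2[of "\<lambda>s t. f s" a] ab by auto

lemma continuous_bdd1: assumes "continuous_on {a..b} f" shows "bdd1 f"
proof -
  have "f \<in> borel_measurable M"
    by (rule continuous_imp_measurable_on_sets_lebesgue[OF assms]) auto
  moreover have "bounded (f ` {a..b})"
    using assms compact_continuous_image compact_imp_bounded by blast
  ultimately show ?thesis unfolding bdd_def bounded_iff by auto
qed

text \<open>The Heaviside kernel: as a weight it turns an integral from a to s into one over [a,b],
  with joint measurability in both variables.\<close>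

lemma bdd2_less: "bdd2 (\<lambda>s t. if t < s then 1 else 0)"
proof -
  have "(\<lambda>x. fst x) \<in> borel_measurable (M \<Otimes>\<^sub>M M)" "(\<lambda>x. snd x) \<in> borel_measurable (M \<Otimes>\<^sub>M M)"
    by (auto intro: measurable_compose[OF measurable_fst measurable_ident_M] measurable_compose[OF measurable_snd measurable_ident_M])
  then have "(\<lambda>x. if snd x < fst x then 1 else 0 :: real) \<in> borel_measurable (M \<Otimes>\<^sub>M M)"
    by measurable
  then show ?thesis unfolding bdd2_def bdd_def by (auto intro!: exI[of _ 1])
qed

lemma bdd2_greater: "bdd2 (\<lambda>s t. if s < t then 1 else 0)"
  using bdd2_swap[OF bdd2_less] by simp

subsection \<open>Scalar operators with a multiplier and a bounded kernel\<close>

text \<open>On a finite measure space square-integrable functions are integrable, so the product of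
  \<open>f\<close> and \<open>g\<close> in separate variables is integrable on the square by
  Tonelli; a bounded kernel only changes the dominating constant.\<close>

lemma kernel_product_integrable:
  assumes k: "bdd2 k" and f: "f \<in> sq_int" and g: "g \<in> sq_int"
  shows "integrable (M \<Otimes>\<^sub>M M) (\<lambda>(s, t). k s t * f t * g s)"
proof -
  obtain C where C: "C \<ge> 0" "\<And>s t. s \<in> {a..b} \<Longrightarrow> t \<in> {a..b} \<Longrightarrow> \<bar>k s t\<bar> \<le> C"
    by (rule bdd2_bound[OF k]) blast
  have km [measurable]: "(\<lambda>x. k (fst x) (snd x)) \<in> borel_measurable (M \<Otimes>\<^sub>M M)"
    using bdd2D[OF k] by (simp add: split_beta)
  have fm [measurable]: "(\<lambda>x. f (snd x)) \<in> borel_measurable (M \<Otimes>\<^sub>M M)"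
    by (rule measurable_compose[OF measurable_snd sq_intD[OF f]])
  have gm [measurable]: "(\<lambda>x. g (fst x)) \<in> borel_measurable (M \<Otimes>\<^sub>M M)"
    by (rule measurable_compose[OF measurable_fst sq_intD[OF g]])
  have 1: "integrable (M \<Otimes>\<^sub>M M) (\<lambda>x. f (snd x) * g (fst x))"
  proof (rule MM.Fubini_integrable)
    show "(\<lambda>x. f (snd x) * g (fst x)) \<in> borel_measurable (M \<Otimes>\<^sub>M M)" by measurable
    have "integrable M (\<lambda>s. (LINT t|M. \<bar>f t\<bar>) * \<bar>g s\<bar>)"
      using sq_int_integrable[OF g] by (intro integrable_mult_right integrable_abs)
    then show "integrable M (\<lambda>s. LINT t|M. norm (f (snd (s, t)) * g (fst (s, t))))"
      by (simp add: abs_mult)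
    show "AE s in M. integrable M (\<lambda>t. f (snd (s, t)) * g (fst (s, t)))"
      using sq_int_integrable[OF f] by auto
  qed
  have "integrable (M \<Otimes>\<^sub>M M) (\<lambda>x. k (fst x) (snd x) * f (snd x) * g (fst x))"
  proof (rule Bochner_Integration.integrable_bound)
    show "integrable (M \<Otimes>\<^sub>M M) (\<lambda>x. C * (f (snd x) * g (fst x)))" using 1 by simp
    show "(\<lambda>x. k (fst x) (snd x) * f (snd x) * g (fst x)) \<in> borel_measurable (M \<Otimes>\<^sub>M M)" by measurable
    show "AE x in M \<Otimes>\<^sub>M M. norm (k (fst x) (snd x) * f (snd x) * g (fst x)) \<le> norm (C * (f (snd x) * g (fst x)))"
    proof (rule AE_I2)
      fix x assume "x \<in> space (M \<Otimes>\<^sub>M M)"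
      then have "\<bar>k (fst x) (snd x)\<bar> \<le> C" using C(2) by (auto simp: space_pair_measure)
      then have "\<bar>k (fst x) (snd x)\<bar> * \<bar>f (snd x) * g (fst x)\<bar> \<le> C * \<bar>f (snd x) * g (fst x)\<bar>"
        by (rule mult_right_mono) simp
      then show "norm (k (fst x) (snd x) * f (snd x) * g (fst x)) \<le> norm (C * (f (snd x) * g (fst x)))"
        using C(1) by (simp add: abs_mult mult.assoc)
    qed
  qed
  also have "(\<lambda>x. k (fst x) (snd x) * f (snd x) * g (fst x)) = (\<lambda>(s, t). k s t * f t * g s)"
    by (auto simp: fun_eq_iff)
  finally show ?thesis .
qed

lemma kernel_section_integrable:
  assumes "bdd2 k" "f \<in> sq_int" "s \<in> {a..b}" shows "integrable M (\<lambda>t. k s t * f t)"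
  by (rule sq_int_integrable[OF sq_int_bounded_mult[OF bdd1_section[OF assms(1,3)] assms(2)]])

lemma kernel_Fubini:
  assumes k: "bdd2 k" and f: "f \<in> sq_int" and g: "g \<in> sq_int"
  shows "(LINT s|M. (LINT t|M. k s t * f t) * g s) = (LINT t|M. f t * (LINT s|M. k s t * g s))"
proof -
  have "(LINT s|M. (LINT t|M. k s t * f t) * g s) = (LINT s|M. (LINT t|M. k s t * f t * g s))"
    by simp
  also have "\<dots> = (LINT t|M. (LINT s|M. k s t * f t * g s))"
    by (rule MM.Fubini_integral[symmetric, OF kernel_product_integrable[OF assms]])
  also have "\<dots> = (LINT t|M. (LINT s|M. f t * (k s t * g s)))"
    by (simp add: mult_ac)
  finally show ?thesis by simp
qed

text \<open>Cauchy-Schwarz in \<open>t\<close> for each fixed \<open>s\<close>; the section of the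
  kernel contributes at most C^2 times the length of the interval.\<close>

lemma kernel_bound:
  assumes k: "\<And>s t. s \<in> {a..b} \<Longrightarrow> t \<in> {a..b} \<Longrightarrow> \<bar>k s t\<bar> \<le> C" "C \<ge> 0" and "bdd2 k"
    and f: "f \<in> sq_int" and s: "s \<in> {a..b}"
  shows "(LINT t|M. k s t * f t)^2 \<le> C^2 * (b - a) * (LINT t|M. (f t)^2)"
proof -
  have 1: "(LINT t|M. k s t * f t)^2 \<le> (LINT t|M. (k s t)^2) * (LINT t|M. (f t)^2)"
    by (rule Cauchy_Schwarz_integral[OF bdd1_sq_int[OF bdd1_section[OF assms(3) s]] f])
  have 2: "(LINT t|M. (k s t)^2) \<le> (LINT t|M. C^2)"
  proof (rule integral_mono)
    show "integrable M (\<lambda>t. (k s t)\<^sup>2)"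
      by (rule sq_int_square[OF bdd1_sq_int[OF bdd1_section[OF assms(3) s]]])
    fix t assume "t \<in> space M"
    then show "(k s t)\<^sup>2 \<le> C\<^sup>2" using k s by (simp add: abs_le_square_iff[symmetric])
  qed auto
  have 3: "(LINT t|M. C^2) = C^2 * (b - a)"
    using ab by (simp add: measure_restrict_space)
  have "0 \<le> (LINT t|M. (f t)^2)" by (rule integral_nonneg_AE) auto
  with 2[unfolded 3] have "(LINT t|M. (k s t)^2) * (LINT t|M. (f t)^2) \<le> C^2 * (b - a) * (LINT t|M. (f t)^2)"
    by (rule mult_right_mono)
  with 1 show ?thesis by (rule order_trans)
qed

text \<open>The estimate for a single \<open>s\<close> is uniform in \<open>s\<close>, so the image
  is even bounded, and measurable as a parametric integral.\<close>

lemma kernel_sq_int: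
  assumes k: "bdd2 k" and f: "f \<in> sq_int"
  shows "(\<lambda>s. LINT t|M. k s t * f t) \<in> sq_int"
proof -
  obtain C where C: "C \<ge> 0" "\<And>s t. s \<in> {a..b} \<Longrightarrow> t \<in> {a..b} \<Longrightarrow> \<bar>k s t\<bar> \<le> C"
    by (rule bdd2_bound[OF k]) blast
  let ?D = "C^2 * (b - a) * (LINT t|M. (f t)^2)"
  have fm [measurable]: "(\<lambda>x. f (snd x)) \<in> borel_measurable (M \<Otimes>\<^sub>M M)"
    by (rule measurable_compose[OF measurable_snd sq_intD[OF f]])
  have km [measurable]: "(\<lambda>x. k (fst x) (snd x)) \<in> borel_measurable (M \<Otimes>\<^sub>M M)"
    using bdd2D[OF k] by (simp add: split_beta)
  have "(\<lambda>s. LINT t|M. k s t * f t) \<in> borel_measurable M"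
    by (rule M.borel_measurable_lebesgue_integral) (simp add: split_beta)
  moreover have "\<bar>LINT t|M. k s t * f t\<bar> \<le> sqrt ?D" if "s \<in> {a..b}" for s
    by (rule real_le_rsqrt) (use kernel_bound[OF C(2,1) k f that] in simp)
  ultimately have "bdd1 (\<lambda>s. LINT t|M. k s t * f t)" unfolding bdd_def space_M by blast
  then show ?thesis by (rule bdd1_sq_int)
qed

lemma kop_sq_int: "bdd1 c \<Longrightarrow> bdd2 k \<Longrightarrow> f \<in> sq_int \<Longrightarrow> kop c k f \<in> sq_int"
  unfolding kop_def by (intro sq_int_add sq_int_bounded_mult kernel_sq_int)

text \<open>The multiplier is real and hence symmetric; Fubini transposes the kernel.\<close>

lemma kop_adjoint:
  assumes c: "bdd1 c" and k: "bdd2 k" and f: "f \<in> sq_int" and g: "g \<in> sq_int"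
  shows "(LINT s|M. kop c k f s * g s) = (LINT s|M. f s * kop c (\<lambda>s t. k t s) g s)"
proof -
  have i: "integrable M (\<lambda>s. c s * f s * g s)" "integrable M (\<lambda>s. (LINT t|M. k s t * f t) * g s)"
     "integrable M (\<lambda>s. f s * (c s * g s))" "integrable M (\<lambda>s. f s * (LINT t|M. k t s * g t))"
    by (intro sq_int_mult_integrable sq_int_bounded_mult kernel_sq_int bdd2_swap[OF k] assms)+
  have "(LINT s|M. kop c k f s * g s) = (LINT s|M. c s * f s * g s) + (LINT s|M. (LINT t|M. k s t * f t) * g s)"
    unfolding kop_def distrib_right by (rule LINT_add[OF i(1,2)])
  also have "\<dots> = (LINT s|M. f s * (c s * g s)) + (LINT s|M. f s * (LINT t|M. k t s * g t))"
    unfolding kernel_Fubini[OF k f g] by (simp only: mult.assoc mult.left_commute)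
  also have "\<dots> = (LINT s|M. f s * kop c (\<lambda>s t. k t s) g s)"
    unfolding kop_def distrib_left by (rule LINT_add[OF i(3,4), symmetric])
  finally show ?thesis .
qed

text \<open>Expanding the composition gives the product of the multipliers and three kernel terms:
  multiplier times kernel, kernel times multiplier, and the composed kernel. The identity holds at
  every point \<open>s\<close>, not just almost everywhere.\<close>

lemma kop_compose:
  assumes c: "bdd1 c" "bdd1 c'" and k: "bdd2 k" "bdd2 k'" and f: "f \<in> sq_int" and s: "s \<in> {a..b}"
  shows "kop c k (kop c' k' f) s =
    kop (\<lambda>s. c s * c' s) (\<lambda>s t. c s * k' s t + k s t * c' t + (LINT u|M. k s u * k' u t)) f s"
proof -
  let ?I = "\<lambda>u. LINT t|M. k' u t * f t"
  have ks: "k s \<in> sq_int" by (rule bdd1_sq_int[OF bdd1_section[OF k(1) s]])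
  have kks: "(\<lambda>t. LINT u|M. k s u * k' u t) \<in> sq_int"
    using kernel_sq_int[OF bdd2_swap[OF k(2)] ks] by (simp add: mult.commute)
  have i: "integrable M (\<lambda>u. k s u * (c' u * f u))" "integrable M (\<lambda>u. k s u * ?I u)"
    "integrable M (\<lambda>t. c s * k' s t * f t)" "integrable M (\<lambda>t. k s t * c' t * f t)"
    "integrable M (\<lambda>t. (LINT u|M. k s u * k' u t) * f t)"
    subgoal by (intro sq_int_mult_integrable ks sq_int_bounded_mult c f)
    subgoal by (intro sq_int_mult_integrable ks kernel_sq_int k f)
    subgoal by (intro sq_int_mult_integrable sq_int_cmult bdd1_sq_int bdd1_section k s f)
    subgoal by (intro sq_int_mult_integrable bdd1_sq_int bdd_mult bdd1_section k s f c)
    subgoal by (intro sq_int_mult_integrable kks f)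
    done
  have "(LINT u|M. k s u * kop c' k' f u) = (LINT u|M. k s u * (c' u * f u)) + (LINT u|M. k s u * ?I u)"
    unfolding kop_def distrib_left by (rule LINT_add[OF i(1,2)])
  \<comment> \<open>Fubini is applied with the section \<open>k s\<close> in the role of the second
    function, which is what produces the composed kernel.\<close>
  also have "(LINT u|M. k s u * ?I u) = (LINT t|M. (LINT u|M. k s u * k' u t) * f t)"
    using kernel_Fubini[OF k(2) f ks] by (simp add: mult_ac)
  finally have *: "(LINT u|M. k s u * kop c' k' f u) =
    (LINT t|M. k s t * c' t * f t) + (LINT t|M. (LINT u|M. k s u * k' u t) * f t)"
    by (simp add: mult.assoc)
  have "(LINT t|M. (c s * k' s t + k s t * c' t + (LINT u|M. k s u * k' u t)) * f t) =
     (LINT t|M. c s * k' s t * f t) + (LINT t|M. k s t * c' t * f t) + (LINT t|M. (LINT u|M. k s u * k' u t) * f t)"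
    unfolding distrib_right
      LINT_add[OF Bochner_Integration.integrable_add[OF i(3,4)] i(5)]
      LINT_add[OF i(3,4)] ..
  also have "(LINT t|M. c s * k' s t * f t) = c s * ?I s" by (simp add: mult.assoc)
  finally show ?thesis using * unfolding kop_def[of c k] kop_def[of "\<lambda>s. c s * c' s"] by (simp add: kop_def[of c' k' f s] algebra_simps)
qed

lemma kop_bounded:
  assumes c: "bdd1 c" and k: "bdd2 k"
  obtains D where "D \<ge> 0" "\<And>f. f \<in> sq_int \<Longrightarrow> (LINT s|M. (kop c k f s)^2) \<le> D * (LINT s|M. (f s)^2)"
proof -
  obtain C where C: "C \<ge> 0" "\<forall>s\<in>space M. \<bar>c s\<bar> \<le> C" by (rule bdd_bound[OF c])
  obtain E where E: "E \<ge> 0" "\<And>s t. s \<in> {a..b} \<Longrightarrow> t \<in> {a..b} \<Longrightarrow> \<bar>k s t\<bar> \<le> E"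
    by (rule bdd2_bound[OF k]) blast
  \<comment> \<open>The factors 2 come from (x + y)^2 \<le> 2 x^2 + 2 y^2; one factor b - a comes
    from the pointwise kernel estimate and the other from integrating it over
    \<open>s\<close>.\<close>
  let ?D = "2 * C^2 + 2 * E^2 * (b - a)^2"
  show ?thesis
  proof (rule that[of ?D])
    show "0 \<le> ?D" by simp
    fix f assume f: "f \<in> sq_int"
    let ?N = "LINT s|M. (f s)^2"
    have "(LINT s|M. (kop c k f s)^2) \<le> (LINT s|M. 2 * C^2 * (f s)^2 + 2 * E^2 * (b - a) * ?N)"
    proof (rule integral_mono)
      show "integrable M (\<lambda>s. (kop c k f s)\<^sup>2)" by (intro sq_int_square kop_sq_int assms f)
      show "integrable M (\<lambda>s. 2 * C^2 * (f s)^2 + 2 * E^2 * (b - a) * ?N)"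
        using sq_int_square[OF f] by (intro Bochner_Integration.integrable_add integrable_mult_right) auto
      fix s assume "s \<in> space M"
      then have s: "s \<in> {a..b}" by simp
      have "(c s * f s)^2 \<le> C^2 * (f s)^2"
        using C s by (simp add: power_mult_distrib mult_right_mono abs_le_square_iff[symmetric])
      moreover have "(LINT t|M. k s t * f t)^2 \<le> E^2 * (b - a) * ?N"
        by (rule kernel_bound[OF E(2,1) k f s])
      moreover have sq: "(x + y)^2 \<le> 2 * x^2 + 2 * y^2" for x y :: real
        using sum_squares_bound[of x y] by (simp add: power2_sum)
      ultimately have "2 * (c s * f s)^2 + 2 * (LINT t|M. k s t * f t)^2 \<le> 2 * (C^2 * (f s)^2) + 2 * (E^2 * (b - a) * ?N)"
        by linarith
      with sq[of "c s * f s" "LINT t|M. k s t * f t"]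
      show "(kop c k f s)\<^sup>2 \<le> 2 * C^2 * (f s)^2 + 2 * E^2 * (b - a) * ?N"
        unfolding kop_def mult.assoc by (rule order_trans)
    qed
    also have "\<dots> = 2 * C^2 * ?N + 2 * E^2 * (b - a) * ?N * (b - a)"
      using ab sq_int_square[OF f] by (subst LINT_add) (auto simp: measure_restrict_space)
    also have "\<dots> = ?D * ?N" by (simp add: algebra_simps power2_eq_square)
    finally show "(LINT s|M. (kop c k f s)^2) \<le> ?D * ?N" .
  qed
qed

lemma kop_linear:
  assumes "bdd2 k" "f \<in> sq_int" "g \<in> sq_int" "s \<in> {a..b}"
  shows "kop c k (\<lambda>s. f s + r * g s) s = kop c k f s + r * kop c k g s"
proof -
  have "(LINT t|M. k s t * (f t + r * g t)) = (LINT t|M. k s t * f t + r * (k s t * g t))"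
    by (simp add: algebra_simps)
  also have "\<dots> = (LINT t|M. k s t * f t) + r * (LINT t|M. k s t * g t)"
    using kernel_section_integrable assms by (subst LINT_add) auto
  finally show ?thesis unfolding kop_def by (simp add: algebra_simps)
qed

lemma kop_sum_arg:
  assumes "bdd2 k" "\<And>i. i \<in> I \<Longrightarrow> f i \<in> sq_int" "s \<in> {a..b}"
  shows "kop c k (\<lambda>s. \<Sum>i\<in>I. f i s) s = (\<Sum>i\<in>I. kop c k (f i) s)"
proof -
  have "(LINT t|M. (\<Sum>i\<in>I. k s t * f i t)) = (\<Sum>i\<in>I. LINT t|M. k s t * f i t)"
    using kernel_section_integrable assms by (intro LINT_sum) auto
  then show ?thesis unfolding kop_def by (simp add: sum_distrib_left sum.distrib)
qed

text \<open>The integral ignores null sets, but the multiplier sees the value at \<open>s\<close>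
  itself; hence the separate equation at that point.\<close>

lemma kop_cong_AE:
  assumes "AE s in M. f s = g s" "f s = g s" "f \<in> borel_measurable M" "g \<in> borel_measurable M" "bdd2 k" "s \<in> {a..b}"
  shows "kop c k f s = kop c k g s"
proof -
  have [measurable]: "k s \<in> borel_measurable M" by (intro bdd1D bdd1_section assms)
  have "(LINT t|M. k s t * f t) = (LINT t|M. k s t * g t)"
    using assms(1,3,4) by (intro integral_cong_AE) auto
  then show ?thesis unfolding kop_def using assms(2) by simp
qed

lemma set_integral_M: "set_lebesgue_integral lebesgue {a..b} f = (LINT s|M. f s)" for f :: "real \<Rightarrow> real"
  unfolding set_lebesgue_integral_def by (subst integral_restrict_space) auto

lemma AE_M_neq: "AE t in M. t \<noteq> s"
proof -
  have "AE t in lebesgue. t \<noteq> s"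
    by (rule AE_I[of _ _ "{s}"]) auto
  then show ?thesis by (subst AE_restrict_space_iff) auto
qed

text \<open>The weight may differ from the indicator at the two end points, which form a null set.
  This admits weights given by strict inequalities.\<close>

lemma set_integral_weight:
  fixes f :: "real \<Rightarrow> real"
  assumes f: "f \<in> borel_measurable M" and w: "w \<in> borel_measurable M" and pq: "{p..q} \<subseteq> {a..b}"
    and e: "\<And>u. u \<in> {a..b} \<Longrightarrow> u \<noteq> p \<Longrightarrow> u \<noteq> q \<Longrightarrow> w u = indicator {p..q} u"
  shows "(LINT u:{p..q}|lebesgue. f u) = (LINT u|M. w u * f u)"
proof -
  have "(LINT u:{p..q}|lebesgue. f u) = (LINT u:{a..b}|lebesgue. indicator {p..q} u * f u)"
    unfolding set_lebesgue_integral_def using pq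
    by (intro LINT_cong) (auto simp: indicator_def)
  also have "\<dots> = (LINT u|M. indicator {p..q} u * f u)" by (rule set_integral_M)
  also have "\<dots> = (LINT u|M. w u * f u)"
  proof (rule integral_cong_AE)
    have "{p..q} \<in> sets M" using pq by (subst sets_restrict_space_iff) auto
    then show "(\<lambda>u. indicator {p..q} u * f u) \<in> borel_measurable M"
      by (intro borel_measurable_times borel_measurable_indicator f)
    show "AE u in M. indicator {p..q} u * f u = w u * f u"
      using AE_M_neq[of p] AE_M_neq[of q] AE_space by eventually_elim (simp add: e)
  qed (intro borel_measurable_times f w)
  finally show ?thesis .
qed

text \<open>Valid for both orders of \<open>s\<close> and \<open>t\<close>: for s < t the interval
  is empty and the two weights exclude each other, so both sides are 0.\<close>

lemma set_integral_mid:
  fixes f :: "real \<Rightarrow> real"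
  assumes f: "f \<in> borel_measurable M" and s: "s \<in> {a..b}" and t: "t \<in> {a..b}"
  shows "(LINT u:{t..s}|lebesgue. f u) = (LINT u|M. (if t < u then 1 else 0) * ((if u < s then 1 else 0) * f u))"
  unfolding mult.assoc[symmetric]
  by (rule set_integral_weight[OF f bdd1D[OF bdd_mult[OF bdd1_section[OF bdd2_greater t] bdd1_section[OF bdd2_less s]]]])
    (use s t in \<open>auto simp: indicator_def\<close>)

lemma set_integral_left:
  fixes f :: "real \<Rightarrow> real"
  assumes f: "f \<in> borel_measurable M" and s: "s \<in> {a..b}"
  shows "(LINT t:{a..s}|lebesgue. f t) = (LINT t|M. (if t < s then 1 else 0) * f t)"
  by (rule set_integral_weight[OF f bdd1D[OF bdd1_section[OF bdd2_less s]]]) (use s in \<open>auto simp: indicator_def\<close>)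

lemma set_integral_right:
  fixes f :: "real \<Rightarrow> real"
  assumes f: "f \<in> borel_measurable M" and s: "s \<in> {a..b}"
  shows "(LINT t:{s..b}|lebesgue. f t) = (LINT t|M. (if s < t then 1 else 0) * f t)"
  by (rule set_integral_weight[OF f bdd1D[OF bdd1_section[OF bdd2_greater s]]]) (use s in \<open>auto simp: indicator_def\<close>)

subsection \<open>Vector-valued square-integrable functions\<close>

lemma L2_iff: "x \<in> L2 a b n \<longleftrightarrow> (\<forall>s\<in>{a..b}. x s \<in> carrier_vec n) \<and> (\<forall>i<n. (\<lambda>s. x s $ i) \<in> sq_int)"
  unfolding L2_def sq_int_def by auto

lemma L2_carrier: "x \<in> L2 a b n \<Longrightarrow> s \<in> {a..b} \<Longrightarrow> x s \<in> carrier_vec n"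
  unfolding L2_iff by auto

lemma L2_dim: "x \<in> L2 a b n \<Longrightarrow> s \<in> {a..b} \<Longrightarrow> dim_vec (x s) = n"
  using L2_carrier by auto

lemma L2_comp: "x \<in> L2 a b n \<Longrightarrow> i < n \<Longrightarrow> (\<lambda>s. x s $ i) \<in> sq_int"
  unfolding L2_iff by auto

lemma L2I:
  assumes "\<And>s. s \<in> {a..b} \<Longrightarrow> x s \<in> carrier_vec n"
    "\<And>i s. i < n \<Longrightarrow> s \<in> {a..b} \<Longrightarrow> x s $ i = f i s" "\<And>i. i < n \<Longrightarrow> f i \<in> sq_int"
  shows "x \<in> L2 a b n"
  unfolding L2_iff using assms sq_int_cong[of "\<lambda>s. x s $ _" "f _"] by auto

lemma L2_cong:
  assumes "\<And>s. s \<in> {a..b} \<Longrightarrow> x s = y s" shows "x \<in> L2 a b n \<longleftrightarrow> y \<in> L2 a b n"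
  unfolding L2_iff using assms sq_int_cong[of "\<lambda>s. x s $ _" "\<lambda>s. y s $ _"] by auto

lemma L2_add:
  assumes "x \<in> L2 a b n" "y \<in> L2 a b n" shows "(\<lambda>s. x s + y s) \<in> L2 a b n"
  by (rule L2I[where f="\<lambda>i s. x s $ i + y s $ i"])
     (use assms in \<open>auto simp: L2_dim[OF assms(2)] L2_iff\<close>)

lemma L2_smult:
  assumes "x \<in> L2 a b n" shows "(\<lambda>s. r \<cdot>\<^sub>v x s) \<in> L2 a b n"
  by (rule L2I[where f="\<lambda>i s. r * x s $ i"]) (use assms in \<open>auto simp: L2_dim[OF assms(1)] L2_iff\<close>)

lemma l2_inner_M: "l2_inner a b x y = (LINT s|M. x s \<bullet> y s)"
  unfolding l2_inner_def by (rule set_integral_M)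

lemma l2_inner_sum:
  assumes "x \<in> L2 a b n" "y \<in> L2 a b n"
  shows "l2_inner a b x y = (\<Sum>i<n. LINT s|M. x s $ i * y s $ i)"
proof -
  have "l2_inner a b x y = (LINT s|M. (\<Sum>i<n. x s $ i * y s $ i))"
    unfolding l2_inner_M
    by (rule LINT_cong) (use L2_dim[OF assms(2)] in \<open>auto simp: scalar_prod_def atLeast0LessThan\<close>)
  also have "\<dots> = (\<Sum>i<n. LINT s|M. x s $ i * y s $ i)"
    by (rule LINT_sum) (auto intro!: sq_int_mult_integrable L2_comp assms)
  finally show ?thesis .
qed

lemma l2_inner_cong:
  assumes "\<And>s. s \<in> {a..b} \<Longrightarrow> x s = x' s" "\<And>s. s \<in> {a..b} \<Longrightarrow> y s = y' s"
  shows "l2_inner a b x y = l2_inner a b x' y'"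
  unfolding l2_inner_M by (rule LINT_cong) (use assms in auto)

lemma l2_inner_commute:
  assumes "x \<in> L2 a b n" "y \<in> L2 a b n" shows "l2_inner a b x y = l2_inner a b y x"
  unfolding l2_inner_sum[OF assms] l2_inner_sum[OF assms(2,1)] by (simp add: mult.commute)

lemma l2_inner_add_left:
  assumes "x \<in> L2 a b n" "y \<in> L2 a b n" "z \<in> L2 a b n"
  shows "l2_inner a b (\<lambda>s. x s + y s) z = l2_inner a b x z + l2_inner a b y z"
proof -
  have "(LINT s|M. (x s + y s) $ i * z s $ i) = (LINT s|M. x s $ i * z s $ i) + (LINT s|M. y s $ i * z s $ i)" if "i < n" for i
  proof -
    have "(LINT s|M. (x s + y s) $ i * z s $ i) = (LINT s|M. x s $ i * z s $ i + y s $ i * z s $ i)"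
      by (rule LINT_cong) (use that L2_dim[OF assms(2)] in \<open>auto simp: algebra_simps\<close>)
    then show ?thesis using sq_int_mult_integrable L2_comp that assms by simp
  qed
  then show ?thesis
    unfolding l2_inner_sum[OF L2_add[OF assms(1,2)] assms(3)] l2_inner_sum[OF assms(1,3)] l2_inner_sum[OF assms(2,3)]
    by (simp add: sum.distrib)
qed

lemma l2_inner_smult_left:
  assumes "x \<in> L2 a b n" "z \<in> L2 a b n"
  shows "l2_inner a b (\<lambda>s. r \<cdot>\<^sub>v x s) z = r * l2_inner a b x z"
proof -
  have "(LINT s|M. (r \<cdot>\<^sub>v x s) $ i * z s $ i) = r * (LINT s|M. x s $ i * z s $ i)" if "i < n" for i
  proof -
    have "(LINT s|M. (r \<cdot>\<^sub>v x s) $ i * z s $ i) = (LINT s|M. r * (x s $ i * z s $ i))"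
      by (rule LINT_cong) (use that L2_dim[OF assms(1)] in \<open>auto simp: algebra_simps\<close>)
    then show ?thesis by simp
  qed
  then show ?thesis
    unfolding l2_inner_sum[OF L2_smult[OF assms(1)] assms(2)] l2_inner_sum[OF assms]
    by (simp add: sum_distrib_left)
qed

lemma l2_inner_add_right:
  assumes "x \<in> L2 a b n" "y \<in> L2 a b n" "z \<in> L2 a b n"
  shows "l2_inner a b z (\<lambda>s. x s + y s) = l2_inner a b z x + l2_inner a b z y"
  using l2_inner_add_left[OF assms] assms L2_add[OF assms(1,2)] by (simp add: l2_inner_commute)

lemma l2_inner_smult_right:
  assumes "x \<in> L2 a b n" "z \<in> L2 a b n"
  shows "l2_inner a b z (\<lambda>s. r \<cdot>\<^sub>v x s) = r * l2_inner a b z x"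
  using l2_inner_smult_left[OF assms] l2_inner_commute[OF L2_smult[OF assms(1)] assms(2)] l2_inner_commute[OF assms]
  by simp

lemma l2_inner_nonneg: "x \<in> L2 a b n \<Longrightarrow> 0 \<le> l2_inner a b x x"
  by (subst l2_inner_sum[of x n]) (auto intro!: sum_nonneg)

lemma l2_norm_sq: "x \<in> L2 a b n \<Longrightarrow> (l2_norm a b x)^2 = l2_inner a b x x"
  unfolding l2_norm_def using l2_inner_nonneg by simp

lemma l2_norm_nonneg: "x \<in> L2 a b n \<Longrightarrow> 0 \<le> l2_norm a b x"
  unfolding l2_norm_def using l2_inner_nonneg by simp

lemma l2_Cauchy_Schwarz:
  assumes x: "x \<in> L2 a b n" and y: "y \<in> L2 a b n"
  shows "\<bar>l2_inner a b x y\<bar> \<le> l2_norm a b x * l2_norm a b y"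
proof -
  have "(l2_inner a b x y)^2 \<le> l2_inner a b x x * l2_inner a b y y"
  proof (rule discriminant_le)
    fix t
    note ty = L2_smult[OF y, of t]
    have "0 \<le> l2_inner a b (\<lambda>s. x s + t \<cdot>\<^sub>v y s) (\<lambda>s. x s + t \<cdot>\<^sub>v y s)"
      by (rule l2_inner_nonneg[OF L2_add[OF x ty]])
    also have "\<dots> = l2_inner a b x x + 2 * t * l2_inner a b x y + t^2 * l2_inner a b y y"
      using l2_inner_commute[OF y x]
      by (simp add: l2_inner_add_left[OF x ty L2_add[OF x ty]] l2_inner_add_right[OF x ty x]
          l2_inner_add_right[OF x ty ty] l2_inner_smult_left[OF y x] l2_inner_smult_right[OF y x]
          l2_inner_smult_left[OF y ty] l2_inner_smult_right[OF y y] power2_eq_square algebra_simps)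
    finally show "0 \<le> l2_inner a b x x + 2 * t * l2_inner a b x y + t^2 * l2_inner a b y y" .
  qed (rule l2_inner_nonneg[OF y])
  then have "\<bar>l2_inner a b x y\<bar> \<le> sqrt (l2_inner a b x x * l2_inner a b y y)"
    by (intro real_le_rsqrt) simp
  then show ?thesis unfolding l2_norm_def by (simp add: real_sqrt_mult)
qed

lemma l2_norm_triangle:
  assumes x: "x \<in> L2 a b n" and y: "y \<in> L2 a b n"
  shows "l2_norm a b (\<lambda>s. x s + y s) \<le> l2_norm a b x + l2_norm a b y"
proof (rule power2_le_imp_le)
  note xy = L2_add[OF x y]
  have "(l2_norm a b (\<lambda>s. x s + y s))^2 = (l2_norm a b x)^2 + 2 * l2_inner a b x y + (l2_norm a b y)^2"
    using l2_inner_commute[OF y x]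
    by (simp add: l2_norm_sq[OF xy] l2_norm_sq[OF x] l2_norm_sq[OF y] l2_inner_add_left[OF x y xy]
        l2_inner_add_right[OF x y x] l2_inner_add_right[OF x y y])
  also have "\<dots> \<le> (l2_norm a b x + l2_norm a b y)^2"
    using l2_Cauchy_Schwarz[OF x y] by (simp add: power2_sum)
  finally show "(l2_norm a b (\<lambda>s. x s + y s))^2 \<le> (l2_norm a b x + l2_norm a b y)^2" .
qed (intro add_nonneg_nonneg l2_norm_nonneg[OF x] l2_norm_nonneg[OF y])

lemma l2_norm_smult: "x \<in> L2 a b n \<Longrightarrow> l2_norm a b (\<lambda>s. r \<cdot>\<^sub>v x s) = \<bar>r\<bar> * l2_norm a b x"
  unfolding l2_norm_def
  by (simp add: l2_inner_smult_left[OF _ L2_smult] l2_inner_smult_right mult.assoc[symmetric] real_sqrt_mult)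

lemma ae_eq_comp: "ae_eq a b x y \<Longrightarrow> AE s in M. x s $ i = y s $ i"
  unfolding ae_eq_def by (erule eventually_mono) simp

lemma l2_inner_ae_cong:
  assumes "ae_eq a b x x'" "ae_eq a b y y'" "x \<in> L2 a b n" "x' \<in> L2 a b n" "y \<in> L2 a b n" "y' \<in> L2 a b n"
  shows "l2_inner a b x y = l2_inner a b x' y'"
proof -
  have "(LINT s|M. x s $ i * y s $ i) = (LINT s|M. x' s $ i * y' s $ i)" if "i < n" for i
  proof (rule integral_cong_AE)
    show "AE s in M. x s $ i * y s $ i = x' s $ i * y' s $ i"
      using ae_eq_comp[OF assms(1), of i] ae_eq_comp[OF assms(2), of i] by eventually_elim simp
  qed (use assms that L2_comp in \<open>auto intro!: borel_measurable_times sq_intD\<close>)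
  then show ?thesis using l2_inner_sum assms by simp
qed

lemma ae_eq_sym: "ae_eq a b x y \<Longrightarrow> ae_eq a b y x"
  unfolding ae_eq_def by (erule eventually_mono) simp

lemma ae_eq_trans: "ae_eq a b x y \<Longrightarrow> ae_eq a b y z \<Longrightarrow> ae_eq a b x z"
  unfolding ae_eq_def by (erule (1) eventually_elim2) simp

subsection \<open>Matrices of scalar operators\<close>

text \<open>The multipliers and kernels are kept as explicit data, and the formula is required at
  every point of [a,b] for inputs in \<open>L2\<close>. Compositions and sums can then be compared
  entry by entry without tracking null sets.\<close>

definition is_kop :: "nat \<Rightarrow> nat \<Rightarrow> ((real \<Rightarrow> real vec) \<Rightarrow> real \<Rightarrow> real vec) \<Rightarrow>
    (nat \<Rightarrow> nat \<Rightarrow> real \<Rightarrow> real) \<Rightarrow> (nat \<Rightarrow> nat \<Rightarrow> real \<Rightarrow> real \<Rightarrow> real) \<Rightarrow> bool" where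
  "is_kop m n F c k \<longleftrightarrow> (\<forall>i<m. \<forall>j<n. bdd1 (c i j) \<and> bdd2 (k i j)) \<and>
     (\<forall>x\<in>L2 a b n. \<forall>s\<in>{a..b}. F x s \<in> carrier_vec m \<and>
        (\<forall>i<m. F x s $ i = (\<Sum>j<n. kop (c i j) (k i j) (\<lambda>s. x s $ j) s)))"

definition mat_kop :: "nat \<Rightarrow> nat \<Rightarrow> (nat \<Rightarrow> nat \<Rightarrow> real \<Rightarrow> real) \<Rightarrow> (nat \<Rightarrow> nat \<Rightarrow> real \<Rightarrow> real \<Rightarrow> real) \<Rightarrow>
    (real \<Rightarrow> real vec) \<Rightarrow> real \<Rightarrow> real vec" where
  "mat_kop m n c k x s = vec m (\<lambda>i. \<Sum>j<n. kop (c i j) (k i j) (\<lambda>s. x s $ j) s)"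

lemma is_kop_mat_kop:
  "(\<And>i j. i < m \<Longrightarrow> j < n \<Longrightarrow> bdd1 (c i j)) \<Longrightarrow> (\<And>i j. i < m \<Longrightarrow> j < n \<Longrightarrow> bdd2 (k i j)) \<Longrightarrow>
    is_kop m n (mat_kop m n c k) c k"
  unfolding is_kop_def mat_kop_def by auto

lemma is_kopD:
  assumes "is_kop m n F c k"
  shows "i < m \<Longrightarrow> j < n \<Longrightarrow> bdd1 (c i j)" "i < m \<Longrightarrow> j < n \<Longrightarrow> bdd2 (k i j)"
    "x \<in> L2 a b n \<Longrightarrow> s \<in> {a..b} \<Longrightarrow> F x s \<in> carrier_vec m"
    "x \<in> L2 a b n \<Longrightarrow> s \<in> {a..b} \<Longrightarrow> i < m \<Longrightarrow> F x s $ i = (\<Sum>j<n. kop (c i j) (k i j) (\<lambda>s. x s $ j) s)"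
  using assms unfolding is_kop_def by auto

lemma is_kop_L2:
  assumes F: "is_kop m n F c k" and x: "x \<in> L2 a b n" shows "F x \<in> L2 a b m"
  by (rule L2I[OF is_kopD(3)[OF F x] is_kopD(4)[OF F x]])
     (auto intro!: sq_int_sum kop_sq_int is_kopD(1,2)[OF F] L2_comp[OF x])

lemma is_kop_adjoint:
  assumes F: "is_kop m n F c k" and G: "is_kop n m G (\<lambda>i j. c j i) (\<lambda>i j s t. k j i t s)"
    and x: "x \<in> L2 a b n" and y: "y \<in> L2 a b m"
  shows "l2_inner a b (F x) y = l2_inner a b x (G y)"
proof -
  have kx: "kop (c i j) (k i j) (\<lambda>s. x s $ j) \<in> sq_int" if "i < m" "j < n" for i j
    using that by (intro kop_sq_int is_kopD(1,2)[OF F] L2_comp[OF x])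
  have ky: "kop (c i j) (\<lambda>s t. k i j t s) (\<lambda>s. y s $ i) \<in> sq_int" if "i < m" "j < n" for i j
    using that by (intro kop_sq_int is_kopD(1,2)[OF F] bdd2_swap L2_comp[OF y])
  have "l2_inner a b (F x) y = (\<Sum>i<m. \<Sum>j<n. LINT s|M. kop (c i j) (k i j) (\<lambda>s. x s $ j) s * y s $ i)"
    unfolding l2_inner_sum[OF is_kop_L2[OF F x] y]
  proof (rule sum.cong[OF refl])
    fix i assume i: "i \<in> {..<m}"
    have "(LINT s|M. F x s $ i * y s $ i) = (LINT s|M. (\<Sum>j<n. kop (c i j) (k i j) (\<lambda>s. x s $ j) s * y s $ i))"
      by (rule LINT_cong) (use i in \<open>auto simp: is_kopD(4)[OF F x] sum_distrib_right\<close>)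
    also have "\<dots> = (\<Sum>j<n. LINT s|M. kop (c i j) (k i j) (\<lambda>s. x s $ j) s * y s $ i)"
      by (rule LINT_sum) (use i in \<open>auto intro!: sq_int_mult_integrable kx L2_comp[OF y]\<close>)
    finally show "(LINT s|M. F x s $ i * y s $ i) = \<dots>" .
  qed
  also have "\<dots> = (\<Sum>i<m. \<Sum>j<n. LINT s|M. x s $ j * kop (c i j) (\<lambda>s t. k i j t s) (\<lambda>s. y s $ i) s)"
    by (intro sum.cong refl kop_adjoint is_kopD(1,2)[OF F] L2_comp[OF x] L2_comp[OF y]) auto
  also have "\<dots> = (\<Sum>j<n. \<Sum>i<m. LINT s|M. x s $ j * kop (c i j) (\<lambda>s t. k i j t s) (\<lambda>s. y s $ i) s)"
    by (rule sum.swap)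
  also have "\<dots> = l2_inner a b x (G y)"
    unfolding l2_inner_sum[OF x is_kop_L2[OF G y]]
  proof (rule sum.cong[OF refl])
    fix j assume j: "j \<in> {..<n}"
    have "(LINT s|M. x s $ j * G y s $ j) = (LINT s|M. (\<Sum>i<m. x s $ j * kop (c i j) (\<lambda>s t. k i j t s) (\<lambda>s. y s $ i) s))"
      by (rule LINT_cong) (use j in \<open>auto simp: is_kopD(4)[OF G y] sum_distrib_left\<close>)
    also have "\<dots> = (\<Sum>i<m. LINT s|M. x s $ j * kop (c i j) (\<lambda>s t. k i j t s) (\<lambda>s. y s $ i) s)"
      by (rule LINT_sum) (use j in \<open>auto intro!: sq_int_mult_integrable ky L2_comp[OF x]\<close>)
    finally show "(\<Sum>i<m. LINT s|M. x s $ j * kop (c i j) (\<lambda>s t. k i j t s) (\<lambda>s. y s $ i) s) = (LINT s|M. x s $ j * G y s $ j)" by simp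
  qed
  finally show ?thesis .
qed

text \<open>The transposed operator is a witness for the choice in the definition. Afterwards only
  membership in \<open>L2\<close> and the adjoint identity enter, so it does not matter which
  representative was chosen.\<close>

lemma l2_adjoint:
  assumes F: "is_kop n n F c k" and y: "y \<in> L2 a b n"
  shows "l2_adjoint a b n F y \<in> L2 a b n"
    and "x \<in> L2 a b n \<Longrightarrow> l2_inner a b x (l2_adjoint a b n F y) = l2_inner a b (F x) y"
proof -
  let ?G = "mat_kop n n (\<lambda>i j. c j i) (\<lambda>i j s t. k j i t s)"
  have G: "is_kop n n ?G (\<lambda>i j. c j i) (\<lambda>i j s t. k j i t s)"
    by (rule is_kop_mat_kop) (auto intro: is_kopD(1,2)[OF F] bdd2_swap)
  have "\<exists>z. z \<in> L2 a b n \<and> (\<forall>x\<in>L2 a b n. l2_inner a b (F x) y = l2_inner a b x z)"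
    using is_kop_L2[OF G y] is_kop_adjoint[OF F G _ y] by blast
  from someI_ex[OF this, folded l2_adjoint_def]
  show "l2_adjoint a b n F y \<in> L2 a b n"
    "x \<in> L2 a b n \<Longrightarrow> l2_inner a b x (l2_adjoint a b n F y) = l2_inner a b (F x) y" by auto
qed

text \<open>The form x + r y is the common shape of linear combinations in what follows: r = 1 gives
  sums, and negative r gives differences.\<close>

lemma is_kop_linear:
  assumes F: "is_kop m n F c k" and x: "x \<in> L2 a b n" and y: "y \<in> L2 a b n" and s: "s \<in> {a..b}"
  shows "F (\<lambda>s. x s + r \<cdot>\<^sub>v y s) s = F x s + r \<cdot>\<^sub>v F y s"
proof (rule eq_vecI)
  note xy = L2_add[OF x L2_smult[OF y, of r]]
  show "dim_vec (F (\<lambda>s. x s + r \<cdot>\<^sub>v y s) s) = dim_vec (F x s + r \<cdot>\<^sub>v F y s)"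
    using is_kopD(3)[OF F xy s] is_kopD(3)[OF F y s] by auto
  fix i assume "i < dim_vec (F x s + r \<cdot>\<^sub>v F y s)"
  then have i: "i < m" using is_kopD(3)[OF F y s] by auto
  have "kop (c i j) (k i j) (\<lambda>s. (x s + r \<cdot>\<^sub>v y s) $ j) s =
      kop (c i j) (k i j) (\<lambda>s. x s $ j) s + r * kop (c i j) (k i j) (\<lambda>s. y s $ j) s" if j: "j < n" for j
  proof -
    have *: "(x s + r \<cdot>\<^sub>v y s) $ j = x s $ j + r * y s $ j" if "s \<in> {a..b}" for s
      using j L2_dim[OF y that] by simp
    have "kop (c i j) (k i j) (\<lambda>s. (x s + r \<cdot>\<^sub>v y s) $ j) s = kop (c i j) (k i j) (\<lambda>s. x s $ j + r * y s $ j) s"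
      unfolding kop_def using *[OF s]
      by (auto intro!: arg_cong2[where f="(+)"] LINT_cong simp: *)
    then show ?thesis
      using kop_linear[OF is_kopD(2)[OF F i j] L2_comp[OF x j] L2_comp[OF y j] s] by simp
  qed
  then show "F (\<lambda>s. x s + r \<cdot>\<^sub>v y s) s $ i = (F x s + r \<cdot>\<^sub>v F y s) $ i"
    using i is_kopD(3)[OF F x s] is_kopD(3)[OF F y s]
    by (simp add: is_kopD(4)[OF F _ s i] x y xy sum.distrib sum_distrib_left)
qed

text \<open>Says that the operator descends to classes modulo null sets: kernels ignore the
  exceptional set, and multipliers reproduce it in the output.\<close>

lemma is_kop_ae_cong:
  assumes F: "is_kop m n F c k" and x: "x \<in> L2 a b n" and y: "y \<in> L2 a b n" and e: "ae_eq a b x y"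
  shows "ae_eq a b (F x) (F y)"
  unfolding ae_eq_def using e[unfolded ae_eq_def] AE_space
proof eventually_elim
  case (elim s)
  then have s: "s \<in> {a..b}" by simp
  show ?case
  proof (rule eq_vecI)
    show "dim_vec (F x s) = dim_vec (F y s)" using is_kopD(3)[OF F x s] is_kopD(3)[OF F y s] by auto
    fix i assume "i < dim_vec (F y s)"
    then have i: "i < m" using is_kopD(3)[OF F y s] by auto
    have "kop (c i j) (k i j) (\<lambda>s. x s $ j) s = kop (c i j) (k i j) (\<lambda>s. y s $ j) s" if "j < n" for j
      using elim that by (intro kop_cong_AE ae_eq_comp[OF e] sq_intD L2_comp[OF x] L2_comp[OF y] is_kopD(2)[OF F i] s) auto
    then show "F x s $ i = F y s $ i"
      by (simp add: is_kopD(4)[OF F x s i] is_kopD(4)[OF F y s i])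
  qed
qed

lemma is_kop_bounded:
  assumes F: "is_kop m n F c k"
  obtains C where "C > 0" "\<And>x. x \<in> L2 a b n \<Longrightarrow> l2_norm a b (F x) \<le> C * l2_norm a b x"
proof -
  have "\<exists>D. \<forall>i<m. \<forall>j<n. D i j \<ge> 0 \<and>
      (\<forall>f\<in>sq_int. (LINT s|M. (kop (c i j) (k i j) f s)^2) \<le> D i j * (LINT s|M. (f s)^2))"
  proof -
    have "\<forall>i j. \<exists>D. i < m \<longrightarrow> j < n \<longrightarrow> D \<ge> 0 \<and>
      (\<forall>f\<in>sq_int. (LINT s|M. (kop (c i j) (k i j) f s)^2) \<le> D * (LINT s|M. (f s)^2))"
      using kop_bounded[OF is_kopD(1)[OF F] is_kopD(2)[OF F]] by metis
    then show ?thesis by metis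
  qed
  then obtain D where D0: "\<And>i j. i < m \<Longrightarrow> j < n \<Longrightarrow> D i j \<ge> 0"
    and D: "\<And>i j f. i < m \<Longrightarrow> j < n \<Longrightarrow> f \<in> sq_int \<Longrightarrow>
       (LINT s|M. (kop (c i j) (k i j) f s)^2) \<le> D i j * (LINT s|M. (f s)^2)"
    by blast
  \<comment> \<open>The factor \<open>n\<close> is the loss in bounding the square of a sum of n
    terms by the sum of the squares.\<close>
  define E where "E = n * (\<Sum>i<m. \<Sum>j<n. D i j)"
  have E0: "E \<ge> 0" unfolding E_def by (intro mult_nonneg_nonneg sum_nonneg D0) auto
  show ?thesis
  \<comment> \<open>Adding 1 keeps the constant positive when \<open>E\<close> is 0, for instance in
    dimension zero.\<close>
  proof (rule that[of "sqrt (E + 1)"])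
    show "sqrt (E + 1) > 0" using E0 by simp
    fix x assume x: "x \<in> L2 a b n"
    let ?N = "\<lambda>j. LINT s|M. (x s $ j)^2"
    have N: "?N j \<ge> 0" for j by (rule integral_nonneg_AE) auto
    have kx: "kop (c i j) (k i j) (\<lambda>s. x s $ j) \<in> sq_int" if "i < m" "j < n" for i j
      using that by (intro kop_sq_int is_kopD(1,2)[OF F] L2_comp[OF x])
    have xx: "l2_inner a b x x = (\<Sum>j<n. ?N j)"
      unfolding l2_inner_sum[OF x x] by (simp add: power2_eq_square)
    have "l2_inner a b (F x) (F x) = (\<Sum>i<m. LINT s|M. (F x s $ i)^2)"
      unfolding l2_inner_sum[OF is_kop_L2[OF F x] is_kop_L2[OF F x]] by (simp add: power2_eq_square)
    also have "\<dots> \<le> (\<Sum>i<m. \<Sum>j<n. n * (D i j * l2_inner a b x x))"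
    proof (rule sum_mono)
      fix i assume "i \<in> {..<m}"
      then have i: "i < m" by simp
      have "(LINT s|M. (F x s $ i)^2) \<le> (LINT s|M. (\<Sum>j<n. n * (kop (c i j) (k i j) (\<lambda>s. x s $ j) s)^2))"
      proof (rule integral_mono)
        show "integrable M (\<lambda>s. (F x s $ i)\<^sup>2)"
          by (rule sq_int_square[OF L2_comp[OF is_kop_L2[OF F x] i]])
        show "integrable M (\<lambda>s. (\<Sum>j<n. n * (kop (c i j) (k i j) (\<lambda>s. x s $ j) s)^2))"
          using i by (intro Bochner_Integration.integrable_sum integrable_mult_right sq_int_square kx) auto
        fix s assume "s \<in> space M"
        then have s: "s \<in> {a..b}" by simp
        show "(F x s $ i)\<^sup>2 \<le> (\<Sum>j<n. n * (kop (c i j) (k i j) (\<lambda>s. x s $ j) s)^2)"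
          unfolding is_kopD(4)[OF F x s i]
          using sum_squared_le_sum_of_squares[of "\<lambda>j. kop (c i j) (k i j) (\<lambda>s. x s $ j) s" "{..<n}"]
          by (simp add: sum_distrib_left mult.commute)
      qed
      also have "\<dots> = (\<Sum>j<n. LINT s|M. n * (kop (c i j) (k i j) (\<lambda>s. x s $ j) s)^2)"
        using i by (intro LINT_sum integrable_mult_right sq_int_square kx) auto
      also have "\<dots> \<le> (\<Sum>j<n. n * (D i j * l2_inner a b x x))"
      proof (rule sum_mono)
        fix j assume "j \<in> {..<n}"
        then have j: "j < n" by simp
        have "(LINT s|M. (kop (c i j) (k i j) (\<lambda>s. x s $ j) s)^2) \<le> D i j * ?N j"
          by (rule D[OF i j L2_comp[OF x j]])
        also have "\<dots> \<le> D i j * l2_inner a b x x"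
          unfolding xx using j by (intro mult_left_mono D0 i member_le_sum N) auto
        finally show "(LINT s|M. n * (kop (c i j) (k i j) (\<lambda>s. x s $ j) s)^2) \<le> n * (D i j * l2_inner a b x x)"
          by (simp add: mult_left_mono)
      qed
      finally show "(LINT s|M. (F x s $ i)^2) \<le> (\<Sum>j<n. n * (D i j * l2_inner a b x x))" .
    qed
    also have "\<dots> = E * l2_inner a b x x"
      unfolding E_def by (simp only: sum_distrib_left[symmetric] sum_distrib_right[symmetric] mult.assoc)
    also have "\<dots> \<le> (E + 1) * l2_inner a b x x" using l2_inner_nonneg[OF x] by (simp add: algebra_simps)
    finally show "l2_norm a b (F x) \<le> sqrt (E + 1) * l2_norm a b x"
      unfolding l2_norm_def real_sqrt_mult[symmetric] by (rule real_sqrt_le_mono)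
  qed
qed

subsection \<open>3-PI operators\<close>

text \<open>Matrix functions of one variable are included as kernels constant in the other argument,
  so one set of closure rules covers multipliers and kernels.\<close>

definition matb :: "nat \<Rightarrow> nat \<Rightarrow> (real \<Rightarrow> real \<Rightarrow> real mat) \<Rightarrow> bool" where
  "matb r c N \<longleftrightarrow> (\<forall>s\<in>{a..b}. \<forall>t\<in>{a..b}. N s t \<in> carrier_mat r c) \<and>
     (\<forall>i<r. \<forall>j<c. bdd2 (\<lambda>s t. N s t $$ (i, j)))"

lemma matbD:
  assumes "matb r c N"
  shows "s \<in> {a..b} \<Longrightarrow> t \<in> {a..b} \<Longrightarrow> N s t \<in> carrier_mat r c"
    "i < r \<Longrightarrow> j < c \<Longrightarrow> bdd2 (\<lambda>s t. N s t $$ (i, j))"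
  using assms unfolding matb_def by auto

lemma mult_mat_vec_index:
  assumes "A \<in> carrier_mat r c" "v \<in> carrier_vec c" "i < r"
  shows "(A *\<^sub>v v) $ i = (\<Sum>j<c. A $$ (i, j) * v $ j)"
  using assms by (simp add: scalar_prod_def atLeast0LessThan row_def)

text \<open>The kernel vanishes on the diagonal, so that the two integrals of a 3-PI operator become one integral
  over \<open>[a,b]\<close> for every \<open>s\<close>, not only for almost every \<open>s\<close>.\<close>

definition PI_kernel :: "(real \<Rightarrow> real \<Rightarrow> real mat) \<Rightarrow> (real \<Rightarrow> real \<Rightarrow> real mat) \<Rightarrow> nat \<Rightarrow> nat \<Rightarrow> real \<Rightarrow> real \<Rightarrow> real" where
  "PI_kernel N1 N2 i j s t = (if t < s then 1 else 0) * N1 s t $$ (i, j) + (if s < t then 1 else 0) * N2 s t $$ (i, j)"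

lemma is_kop_PI_op:
  assumes N: "matb r c (\<lambda>s _. N0 s)" "matb r c N1" "matb r c N2"
  shows "is_kop r c (PI_op a b r N0 N1 N2) (\<lambda>i j s. N0 s $$ (i, j)) (PI_kernel N1 N2)"
  unfolding is_kop_def
proof (intro conjI allI impI ballI)
  fix i j assume "i < r" "j < c"
  then show "bdd1 (\<lambda>s. N0 s $$ (i, j))" "bdd2 (PI_kernel N1 N2 i j)"
    using matbD(2)[OF N(1)] unfolding PI_kernel_def
    by (auto simp: bdd1_iff_bdd2 intro!: bdd2_add bdd2_mult bdd2_less bdd2_greater matbD(2)[OF N(2)] matbD(2)[OF N(3)])
next
  fix x s assume x: "x \<in> L2 a b c" and s: "s \<in> {a..b}"
  note N0 = matbD(1)[OF N(1) s s]
  show carr: "PI_op a b r N0 N1 N2 x s \<in> carrier_vec r"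
    unfolding PI_op_def vec_integral_def by (rule carrier_vecI) simp
  fix i assume i: "i < r"
  have sec: "bdd1 (\<lambda>t. N s t $$ (i, j))" if "matb r c N" "j < c" for N j
    using bdd1_section[OF matbD(2)[OF that(1) i that(2)] s] .
  have sq: "(\<lambda>t. N s t $$ (i, j) * x t $ j) \<in> sq_int" if "matb r c N" "j < c" for N j
    by (intro sq_int_bounded_mult sec that L2_comp[OF x])
  have less: "bdd1 (\<lambda>t. if t < s then 1 else 0)" by (rule bdd1_section[OF bdd2_less s])
  have greater: "bdd1 (\<lambda>t. if s < t then 1 else 0)" by (rule bdd1_section[OF bdd2_greater s])
  have mv: "(N s t *\<^sub>v x t) $ i = (\<Sum>j<c. N s t $$ (i, j) * x t $ j)" if "matb r c N" "t \<in> {a..b}" for N t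
    by (rule mult_mat_vec_index[OF matbD(1)[OF that(1) s that(2)] L2_carrier[OF x that(2)] i])
  have meas: "(\<lambda>t. (N s t *\<^sub>v x t) $ i) \<in> borel_measurable M" if "matb r c N" for N
  proof -
    have "(\<lambda>t. \<Sum>j<c. N s t $$ (i, j) * x t $ j) \<in> sq_int" using sq[OF that] by auto
    then show ?thesis by (subst measurable_cong[OF mv[OF that]]) (auto dest: sq_intD)
  qed
  have w: "(LINT t|M. w t * (N s t *\<^sub>v x t) $ i) = (\<Sum>j<c. LINT t|M. w t * (N s t $$ (i, j) * x t $ j))"
    if "matb r c N" "bdd1 w" for N w
  proof -
    have "(LINT t|M. w t * (N s t *\<^sub>v x t) $ i) = (LINT t|M. (\<Sum>j<c. w t * (N s t $$ (i, j) * x t $ j)))"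
      by (rule LINT_cong) (auto simp: mv[OF that(1)] sum_distrib_left)
    also have "\<dots> = (\<Sum>j<c. LINT t|M. w t * (N s t $$ (i, j) * x t $ j))"
      by (rule LINT_sum) (auto intro!: sq_int_integrable sq_int_bounded_mult that sq)
    finally show ?thesis .
  qed
  have split: "(LINT t|M. PI_kernel N1 N2 i j s t * x t $ j) =
     (LINT t|M. (if t < s then 1 else 0) * (N1 s t $$ (i, j) * x t $ j)) +
     (LINT t|M. (if s < t then 1 else 0) * (N2 s t $$ (i, j) * x t $ j))" if j: "j < c" for j
  proof -
    have "(LINT t|M. PI_kernel N1 N2 i j s t * x t $ j) =
      (LINT t|M. (if t < s then 1 else 0) * (N1 s t $$ (i, j) * x t $ j)
        + (if s < t then 1 else 0) * (N2 s t $$ (i, j) * x t $ j))"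
      unfolding PI_kernel_def by (simp only: distrib_right mult.assoc)
    also have "\<dots> = (LINT t|M. (if t < s then 1 else 0) * (N1 s t $$ (i, j) * x t $ j)) +
     (LINT t|M. (if s < t then 1 else 0) * (N2 s t $$ (i, j) * x t $ j))"
      by (intro LINT_add sq_int_integrable sq_int_bounded_mult less greater sec[OF N(2) j] sec[OF N(3) j] L2_comp[OF x j])
    finally show ?thesis .
  qed
  have "PI_op a b r N0 N1 N2 x s $ i = (N0 s *\<^sub>v x s) $ i
      + (LINT t:{a..s}|lebesgue. (N1 s t *\<^sub>v x t) $ i) + (LINT t:{s..b}|lebesgue. (N2 s t *\<^sub>v x t) $ i)"
    unfolding PI_op_def vec_integral_def using N0 i by simp
  also have "\<dots> = (\<Sum>j<c. N0 s $$ (i, j) * x s $ j + (LINT t|M. PI_kernel N1 N2 i j s t * x t $ j))"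
    unfolding set_integral_left[OF meas[OF N(2)] s] set_integral_right[OF meas[OF N(3)] s]
      w[OF N(2) less] w[OF N(3) greater] mv[OF N(1) s]
    by (simp add: split sum.distrib)
  finally show "PI_op a b r N0 N1 N2 x s $ i = (\<Sum>j<c. kop (\<lambda>s. N0 s $$ (i, j)) (PI_kernel N1 N2 i j) (\<lambda>s. x s $ j) s)"
    unfolding kop_def .
qed

end

lemma sum_lessThan_add: "(\<Sum>r<m + n. f r) = (\<Sum>r<m. f r) + (\<Sum>r<n. f (m + r))" for f :: "nat \<Rightarrow> 'a::comm_monoid_add"
  by (induction n) (auto simp: add.assoc)

lemma bilinear_index:
  fixes A B C :: "real mat"
  assumes "A \<in> carrier_mat p c" "B \<in> carrier_mat p q" "C \<in> carrier_mat q l" "i < c" "j < l"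
  shows "(A\<^sup>T * B * C) $$ (i, j) = (\<Sum>r<p. \<Sum>r'<q. A $$ (r, i) * B $$ (r, r') * C $$ (r', j))"
proof -
  have "(A\<^sup>T * B * C) $$ (i, j) = (\<Sum>r<p. A $$ (r, i) * (\<Sum>r'<q. B $$ (r, r') * C $$ (r', j)))"
    using assms by (simp add: scalar_prod_def atLeast0LessThan)
  also have "\<dots> = (\<Sum>r<p. \<Sum>r'<q. A $$ (r, i) * B $$ (r, r') * C $$ (r', j))"
    by (simp add: sum_distrib_left mult.assoc)
  finally show ?thesis .
qed

context interval begin

lemma kop_sum_op:
  assumes "\<And>r. r \<in> I \<Longrightarrow> bdd2 (k r)" "f \<in> sq_int" "s \<in> {a..b}"
  shows "(\<Sum>r\<in>I. kop (c r) (k r) f s) = kop (\<lambda>s. \<Sum>r\<in>I. c r s) (\<lambda>s t. \<Sum>r\<in>I. k r s t) f s"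
proof -
  have "(LINT t|M. (\<Sum>r\<in>I. k r s t * f t)) = (\<Sum>r\<in>I. LINT t|M. k r s t * f t)"
    by (intro LINT_sum kernel_section_integrable assms)
  then show ?thesis unfolding kop_def by (simp add: sum_distrib_right sum.distrib)
qed

text \<open>For fixed \<open>s\<close> the diagonal contributes one point in the integration
  variable, so the kernels need to agree only off the diagonal, while the multipliers need to agree
  only at \<open>s\<close>.\<close>

lemma kop_cong:
  assumes "c s = c' s" "\<And>t. t \<in> {a..b} \<Longrightarrow> t \<noteq> s \<Longrightarrow> k s t = k' s t"
    "bdd2 k" "bdd2 k'" "f \<in> sq_int" "s \<in> {a..b}"
  shows "kop c k f s = kop c' k' f s"
proof -
  have "(LINT t|M. k s t * f t) = (LINT t|M. k' s t * f t)"
  proof (rule integral_cong_AE)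
    show "AE t in M. k s t * f t = k' s t * f t"
      using AE_M_neq[of s] AE_space by eventually_elim (simp add: assms(2))
  qed (intro sq_intD sq_int_bounded_mult bdd1_section assms)+
  then show ?thesis unfolding kop_def using assms(1) by simp
qed

text \<open>The first argument is the variable of integration; it comes last in the product space, as required for the
  measurability of parametric integrals.\<close>

definition bdd3 :: "(real \<Rightarrow> real \<Rightarrow> real \<Rightarrow> real) \<Rightarrow> bool" where
  "bdd3 k \<longleftrightarrow> bdd ((M \<Otimes>\<^sub>M M) \<Otimes>\<^sub>M M) (\<lambda>x. k (snd x) (fst (fst x)) (snd (fst x)))"

lemma bdd3_const [simp, intro]: "bdd3 (\<lambda>_ _ _. c)" unfolding bdd3_def by (rule bdd_const)

lemma bdd3_mult: "bdd3 k \<Longrightarrow> bdd3 l \<Longrightarrow> bdd3 (\<lambda>u s t. k u s t * l u s t)"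
  unfolding bdd3_def by (rule bdd_mult)

lemma bdd3_sum: "(\<And>i. i \<in> I \<Longrightarrow> bdd3 (k i)) \<Longrightarrow> bdd3 (\<lambda>u s t. \<Sum>i\<in>I. k i u s t)"
  unfolding bdd3_def by (rule bdd_sum)

lemma bdd3_12: assumes "bdd2 k" shows "bdd3 (\<lambda>u s t. k u s)"
proof -
  have "(\<lambda>x. (snd x, fst (fst x))) \<in> measurable ((M \<Otimes>\<^sub>M M) \<Otimes>\<^sub>M M) (M \<Otimes>\<^sub>M M)"
    by (intro measurable_Pair measurable_snd measurable_compose[OF measurable_fst measurable_fst])
  from bdd_compose[OF assms[unfolded bdd2_def] this] show ?thesis unfolding bdd3_def by simp
qed

lemma bdd3_13: assumes "bdd2 k" shows "bdd3 (\<lambda>u s t. k u t)"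
proof -
  have "(\<lambda>x. (snd x, snd (fst x))) \<in> measurable ((M \<Otimes>\<^sub>M M) \<Otimes>\<^sub>M M) (M \<Otimes>\<^sub>M M)"
    by (intro measurable_Pair measurable_snd measurable_compose[OF measurable_fst measurable_snd])
  from bdd_compose[OF assms[unfolded bdd2_def] this] show ?thesis unfolding bdd3_def by simp
qed

lemma bdd3_section: assumes "bdd3 k" "s \<in> {a..b}" "t \<in> {a..b}" shows "bdd1 (\<lambda>u. k u s t)"
  using bdd_compose[OF assms(1)[unfolded bdd3_def] measurable_Pair1'[of "(s, t)" "M \<Otimes>\<^sub>M M" M]] assms(2,3)
  by (simp add: space_pair_measure)

text \<open>Kernels of compositions, and the integral terms in the kernels of \<Omega>, are
  integrals with two parameters; finite measure keeps them bounded.\<close>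

lemma bdd2_integral: assumes "bdd3 k" shows "bdd2 (\<lambda>s t. LINT u|M. k u s t)"
proof -
  obtain C where C: "\<forall>x\<in>space ((M \<Otimes>\<^sub>M M) \<Otimes>\<^sub>M M). \<bar>k (snd x) (fst (fst x)) (snd (fst x))\<bar> \<le> C"
    by (rule bdd_bound[OF assms[unfolded bdd3_def]])
  have "(\<lambda>x. LINT u|M. k u (fst x) (snd x)) \<in> borel_measurable (M \<Otimes>\<^sub>M M)"
    using assms unfolding bdd3_def bdd_def
    by (intro M.borel_measurable_lebesgue_integral) (simp add: case_prod_unfold)
  moreover have "\<bar>LINT u|M. k u s t\<bar> \<le> C * (b - a)" if "s \<in> {a..b}" "t \<in> {a..b}" for s t
  proof -
    have "integrable M (\<lambda>u. k u s t)" by (intro sq_int_integrable bdd1_sq_int bdd3_section assms that)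
    then have "\<bar>LINT u|M. k u s t\<bar> \<le> (LINT u|M. C)"
      using C that by (intro order_trans[OF integral_abs_bound] integral_mono) (auto simp: space_pair_measure)
    also have "\<dots> = C * (b - a)" using ab by (simp add: measure_restrict_space)
    finally show ?thesis .
  qed
  ultimately show ?thesis
    unfolding bdd2_def bdd_def by (intro conjI exI[of _ "C * (b - a)"]) (auto simp: space_pair_measure)
qed

subsection \<open>Positivity\<close>

text \<open>The hypotheses on \<open>C\<close> and \<open>K\<close> say that \<open>R = F\<^sup>* (g P) F\<close>, where \<open>F\<close> has multiplier \<open>D\<close> and kernel
  \<open>E\<close>; the kernel of \<open>R\<close> is prescribed off the diagonal only, which is a null set.\<close>

lemma quadratic_kop_nonneg:
  assumes D: "\<And>r c. r < q \<Longrightarrow> c < n \<Longrightarrow> bdd1 (D r c)" and E: "\<And>r c. r < q \<Longrightarrow> c < n \<Longrightarrow> bdd2 (E r c)"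
    and g: "bdd1 g" "\<And>s. s \<in> {a..b} \<Longrightarrow> 0 \<le> g s" and P: "psd_mat q P"
    and R: "is_kop n n R C K"
    and C: "\<And>i l s. i < n \<Longrightarrow> l < n \<Longrightarrow> s \<in> {a..b} \<Longrightarrow>
      C i l s = (\<Sum>r<q. \<Sum>r'<q. g s * (D r i s * P $$ (r, r') * D r' l s))"
    and K: "\<And>i l s t. i < n \<Longrightarrow> l < n \<Longrightarrow> s \<in> {a..b} \<Longrightarrow> t \<in> {a..b} \<Longrightarrow> t \<noteq> s \<Longrightarrow>
      K i l s t = (\<Sum>r<q. \<Sum>r'<q. g s * (D r i s * P $$ (r, r') * E r' l s t))
        + (\<Sum>r<q. \<Sum>r'<q. g t * (E r i t s * P $$ (r, r') * D r' l t))
        + (LINT u|M. (\<Sum>r<q. \<Sum>r'<q. g u * (E r i u s * P $$ (r, r') * E r' l u t)))"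
    and x: "x \<in> L2 a b n"
  shows "0 \<le> l2_inner a b x (R x)"
proof -
  \<comment> \<open>The primed data absorb the pointwise matrix \<open>g s\<close> times
    \<open>P\<close>. Thus \<open>F'\<close> is \<open>g P F\<close>, and the factorization to be
    verified becomes the composition of the transpose of \<open>F\<close> with
    \<open>F'\<close>.\<close>
  define D' where "D' r c s = (\<Sum>r'<q. g s * P $$ (r, r') * D r' c s)" for r c s
  define E' where "E' r c s t = (\<Sum>r'<q. g s * P $$ (r, r') * E r' c s t)" for r c s t
  have D': "bdd1 (D' r c)" if "r < q" "c < n" for r c
    unfolding D'_def using that by (intro bdd_sum bdd_mult g bdd_const D) auto
  have E': "bdd2 (E' r c)" if "r < q" "c < n" for r c
    unfolding E'_def using that by (intro bdd2_sum bdd2_mult bdd2_fst[OF g(1)] bdd2_const E) auto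
  define F where "F = mat_kop q n D E"
  define F' where "F' = mat_kop q n D' E'"
  define Ft where "Ft = mat_kop n q (\<lambda>i j. D j i) (\<lambda>i j s t. E j i t s)"
  have F: "is_kop q n F D E" unfolding F_def by (rule is_kop_mat_kop[OF D E])
  have F': "is_kop q n F' D' E'" unfolding F'_def by (rule is_kop_mat_kop[OF D' E'])
  have Ft: "is_kop n q Ft (\<lambda>i j. D j i) (\<lambda>i j s t. E j i t s)"
    unfolding Ft_def by (rule is_kop_mat_kop) (auto intro: D bdd2_swap[OF E])
  note x' = L2_comp[OF x]
  have Rx: "R x s = Ft (F' x) s" if s: "s \<in> {a..b}" for s
  proof (rule eq_vecI)
    note F'x = is_kop_L2[OF F' x]
    show "dim_vec (R x s) = dim_vec (Ft (F' x) s)"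
      using is_kopD(3)[OF R x s] is_kopD(3)[OF Ft F'x s] by auto
    fix i assume "i < dim_vec (Ft (F' x) s)"
    then have i: "i < n" using is_kopD(3)[OF Ft F'x s] by auto
    define kk where "kk r l s t = D r i s * E' r l s t + E r i t s * D' r l t + (LINT u|M. E r i u s * E' r l u t)" for r l s t
    have bi: "bdd3 (\<lambda>u s t. E r i u s * E' r l u t)" if "r < q" "l < n" for r l
      by (intro bdd3_mult bdd3_12 bdd3_13 E E' that i)
    have kk: "bdd2 (kk r l)" if "r < q" "l < n" for r l
      unfolding kk_def
      by (intro bdd2_add bdd2_mult bdd2_fst[OF D[OF that(1) i]] bdd2_snd[OF D'[OF that]] E' that bdd2_swap[OF E[OF that(1) i]]
          bdd2_integral bi)
    have "Ft (F' x) s $ i = (\<Sum>r<q. kop (D r i) (\<lambda>s t. E r i t s) (\<lambda>s. F' x s $ r) s)"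
      by (rule is_kopD(4)[OF Ft F'x s i])
    also have "\<dots> = (\<Sum>r<q. kop (D r i) (\<lambda>s t. E r i t s) (\<lambda>s. \<Sum>l<n. kop (D' r l) (E' r l) (\<lambda>s. x s $ l) s) s)"
    proof (rule sum.cong[OF refl])
      fix r assume r: "r \<in> {..<q}"
      have *: "F' x s $ r = (\<Sum>l<n. kop (D' r l) (E' r l) (\<lambda>s. x s $ l) s)" if "s \<in> {a..b}" for s
        using r by (intro is_kopD(4)[OF F' x that]) auto
      show "kop (D r i) (\<lambda>s t. E r i t s) (\<lambda>s. F' x s $ r) s = kop (D r i) (\<lambda>s t. E r i t s) (\<lambda>s. \<Sum>l<n. kop (D' r l) (E' r l) (\<lambda>s. x s $ l) s) s"
        unfolding kop_def[of "D r i"] *[OF s]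
        by (intro arg_cong2[where f="(+)"] refl LINT_cong) (auto simp: *)
    qed
    also have "\<dots> = (\<Sum>r<q. \<Sum>l<n. kop (D r i) (\<lambda>s t. E r i t s) (kop (D' r l) (E' r l) (\<lambda>s. x s $ l)) s)"
      by (intro sum.cong refl kop_sum_arg bdd2_swap[OF E[OF _ i]] kop_sq_int D' E' x' s) auto
    also have "\<dots> = (\<Sum>r<q. \<Sum>l<n. kop (\<lambda>s. D r i s * D' r l s) (kk r l) (\<lambda>s. x s $ l) s)"
      unfolding kk_def by (intro sum.cong refl kop_compose bdd2_swap[OF E[OF _ i]] D[OF _ i] D' E' x' s) auto
    also have "\<dots> = (\<Sum>l<n. \<Sum>r<q. kop (\<lambda>s. D r i s * D' r l s) (kk r l) (\<lambda>s. x s $ l) s)"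
      by (rule sum.swap)
    also have "\<dots> = (\<Sum>l<n. kop (\<lambda>s. \<Sum>r<q. D r i s * D' r l s) (\<lambda>s t. \<Sum>r<q. kk r l s t) (\<lambda>s. x s $ l) s)"
      by (intro sum.cong refl kop_sum_op kk x' s) auto
    also have "\<dots> = (\<Sum>l<n. kop (C i l) (K i l) (\<lambda>s. x s $ l) s)"
    proof (intro sum.cong refl kop_cong is_kopD(2)[OF R] i s x' bdd2_sum kk)
      fix l assume "l \<in> {..<n}"
      then have l: "l < n" by simp
      show "(\<Sum>r<q. D r i s * D' r l s) = C i l s"
        unfolding C[OF i l s] D'_def sum_distrib_left by (simp add: mult_ac)
      fix t assume t: "t \<in> {a..b}" "t \<noteq> s"
      \<comment> \<open>The prescribed kernel has one integral around the whole double sum, whereas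
        composition gives one integral for each row \<open>r\<close>.\<close>
      have "(\<Sum>r<q. LINT u|M. E r i u s * E' r l u t) = (LINT u|M. (\<Sum>r<q. E r i u s * E' r l u t))"
        by (rule LINT_sum[symmetric])
           (auto intro!: sq_int_integrable bdd1_sq_int bdd3_section[OF bi] l s t(1)[simplified])
      then show "(\<Sum>r<q. kk r l s t) = K i l s t"
        unfolding K[OF i l s t] kk_def E'_def D'_def sum_distrib_left sum.distrib by (simp add: mult_ac)
    qed auto
    also have "\<dots> = R x s $ i" by (rule is_kopD(4)[OF R x s i, symmetric])
    finally show "R x s $ i = Ft (F' x) s $ i" by simp
  qed
  have "l2_inner a b x (R x) = l2_inner a b x (Ft (F' x))" by (rule l2_inner_cong) (auto simp: Rx)
  also have "\<dots> = l2_inner a b (F x) (F' x)"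
    by (rule is_kop_adjoint[OF F Ft x is_kop_L2[OF F' x], symmetric])
  also have "\<dots> = (LINT s|M. F x s \<bullet> F' x s)" by (rule l2_inner_M)
  also have "0 \<le> \<dots>"
  proof (rule integral_nonneg_AE, rule AE_I2)
    fix s assume "s \<in> space M"
    then have s: "s \<in> {a..b}" by simp
    let ?w = "F x s"
    have w: "?w \<in> carrier_vec q" by (rule is_kopD(3)[OF F x s])
    have Pc: "P \<in> carrier_mat q q" using P unfolding psd_mat_def by simp
    \<comment> \<open>The matrix factor depends only on the output point \<open>s\<close>, so it can
      be pulled out of the operators. The integrand becomes \<open>g s\<close> times a quadratic
      form in \<open>P\<close>, nonnegative at each point.\<close>
    have "F' x s = g s \<cdot>\<^sub>v (P *\<^sub>v ?w)"
    proof (rule eq_vecI)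
      show "dim_vec (F' x s) = dim_vec (g s \<cdot>\<^sub>v (P *\<^sub>v F x s))"
        using is_kopD(3)[OF F' x s] Pc by auto
      fix r assume "r < dim_vec (g s \<cdot>\<^sub>v (P *\<^sub>v F x s))"
      then have r: "r < q" using Pc by auto
      have "F' x s $ r = (\<Sum>l<n. kop (D' r l) (E' r l) (\<lambda>s. x s $ l) s)" by (rule is_kopD(4)[OF F' x s r])
      also have "\<dots> = (\<Sum>l<n. \<Sum>r'<q. g s * P $$ (r, r') * kop (D r' l) (E r' l) (\<lambda>s. x s $ l) s)"
      proof (rule sum.cong[OF refl])
        fix l assume "l \<in> {..<n}"
        then have l: "l < n" by simp
        have "kop (D' r l) (E' r l) (\<lambda>s. x s $ l) s =
           (\<Sum>r'<q. kop (\<lambda>s. g s * P $$ (r, r') * D r' l s) (\<lambda>s t. g s * P $$ (r, r') * E r' l s t) (\<lambda>s. x s $ l) s)"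
          unfolding D'_def E'_def using l
          by (intro kop_sum_op[symmetric] bdd2_mult bdd2_fst[OF g(1)] bdd2_const E x' s) auto
        also have "\<dots> = (\<Sum>r'<q. g s * P $$ (r, r') * kop (D r' l) (E r' l) (\<lambda>s. x s $ l) s)"
          unfolding kop_def by (simp add: mult.assoc distrib_left)
        finally show "kop (D' r l) (E' r l) (\<lambda>s. x s $ l) s = \<dots>" .
      qed
      also have "\<dots> = (\<Sum>r'<q. \<Sum>l<n. g s * P $$ (r, r') * kop (D r' l) (E r' l) (\<lambda>s. x s $ l) s)" by (rule sum.swap)
      also have "\<dots> = (\<Sum>r'<q. g s * P $$ (r, r') * F x s $ r')"
        by (intro sum.cong refl) (simp add: is_kopD(4)[OF F x s] sum_distrib_left)
      also have "\<dots> = (g s \<cdot>\<^sub>v (P *\<^sub>v F x s)) $ r"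
        using r Pc by (simp add: mult_mat_vec_index[OF Pc w r] sum_distrib_left mult.assoc del: index_mult_mat_vec)
      finally show "F' x s $ r = (g s \<cdot>\<^sub>v (P *\<^sub>v F x s)) $ r" .
    qed
    moreover have "?w \<bullet> (g s \<cdot>\<^sub>v (P *\<^sub>v ?w)) = g s * (?w \<bullet> (P *\<^sub>v ?w))"
      using w Pc by (intro scalar_prod_smult_right) auto
    ultimately show "0 \<le> F x s \<bullet> F' x s"
      using g(2)[OF s] P w unfolding psd_mat_def by auto
  qed
  finally show ?thesis .
qed

end

section \<open>Nonnegativity of the operators built from positive semidefinite matrices\<close>

lemma P_block_carrier: "P_block d n P p p' \<in> carrier_mat (P_size d n p) (P_size d n p')"
  unfolding P_block_def sub_block_def by simp

lemma Z1_carrier: "Z1 d n s \<in> carrier_mat (P_size d n 1) n"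
  unfolding Z1_def P_size_def by simp

lemma Z2_carrier: "p \<noteq> 1 \<Longrightarrow> Z2 d n s t \<in> carrier_mat (P_size d n p) n"
  unfolding Z2_def P_size_def by simp

text \<open>Entries of a block are rewritten as entries of the full matrix with row and column
  offsets, the form in which they appear when sums over the whole index range of \<open>P\<close>
  are split into three ranges.\<close>

lemma block_bilinear:
  assumes "A \<in> carrier_mat (P_size d n p) n" "C \<in> carrier_mat (P_size d n p') n" "i < n" "l < n"
  shows "(A\<^sup>T * P_block d n P p p' * C) $$ (i, l) =
    (\<Sum>r<P_size d n p. \<Sum>r'<P_size d n p'.
       A $$ (r, i) * P $$ ((\<Sum>k=1..<p. P_size d n k) + r, (\<Sum>k=1..<p'. P_size d n k) + r') * C $$ (r', l))"
  unfolding bilinear_index[OF assms(1) P_block_carrier assms(2-4)]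
  by (intro sum.cong refl) (simp add: P_block_def sub_block_def)

context interval begin

lemma integral_add3:
  assumes "bdd1 f" "bdd1 g" "bdd1 h" "\<And>u. u \<in> {a..b} \<Longrightarrow> F u = f u + g u + h u"
  shows "(LINT u|M. F u) = (LINT u|M. f u) + (LINT u|M. g u) + (LINT u|M. h u)"
proof -
  have i: "integrable M f" "integrable M g" "integrable M h" by (intro sq_int_integrable bdd1_sq_int assms)+
  have "(LINT u|M. F u) = (LINT u|M. f u + g u + h u)"
    by (rule LINT_cong) (auto simp: assms(4))
  then show ?thesis using i by simp
qed

lemma bdd1_id: "bdd1 (\<lambda>s. s)" by (intro continuous_bdd1 continuous_intros)

lemma bdd2_Z1: "r < P_size d n 1 \<Longrightarrow> i < n \<Longrightarrow> bdd2 (\<lambda>s t. Z1 d n s $$ (r, i))"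
  unfolding Z1_def P_size_def by (cases "r mod n = i") (auto intro!: bdd2_power[OF bdd2_fst[OF bdd1_id]])

lemma bdd2_Z2: "p \<noteq> 1 \<Longrightarrow> r < P_size d n p \<Longrightarrow> i < n \<Longrightarrow> bdd2 (\<lambda>s t. Z2 d n s t $$ (r, i))"
  unfolding Z2_def P_size_def
  by (cases "r mod n = i") (auto intro!: bdd2_mult bdd2_power bdd2_fst[OF bdd1_id] bdd2_snd[OF bdd1_id])

text \<open>The common integrand of all integral terms in the two kernels, as a scalar function with
  the integration variable \<open>u\<close> first.\<close>

definition hZ :: "nat \<Rightarrow> nat \<Rightarrow> (real \<Rightarrow> real) \<Rightarrow> real mat \<Rightarrow> nat \<Rightarrow> nat \<Rightarrow> nat \<Rightarrow> nat \<Rightarrow> real \<Rightarrow> real \<Rightarrow> real \<Rightarrow> real" where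
  "hZ d n g P p p' i l u s t = g u * ((Z2 d n u s)\<^sup>T * P_block d n P p p' * Z2 d n u t) $$ (i, l)"

context
  fixes d n :: nat and g :: "real \<Rightarrow> real" and P :: "real mat"
  assumes g: "bdd1 g"
begin

lemma bdd3_hZ:
  assumes "p \<noteq> 1" "p' \<noteq> 1" "i < n" "l < n"
  shows "bdd3 (hZ d n g P p p' i l)"
  unfolding hZ_def block_bilinear[OF Z2_carrier[OF assms(1)] Z2_carrier[OF assms(2)] assms(3,4)]
  by (intro bdd3_mult bdd3_sum bdd3_const bdd3_12[OF bdd2_fst[OF g]] bdd3_12[OF bdd2_Z2[OF assms(1) _ assms(3)]]
      bdd3_13[OF bdd2_Z2[OF assms(2) _ assms(4)]]) auto

lemma bdd2_Z1_Z2: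
  assumes "p \<noteq> 1" "i < n" "l < n"
  shows "bdd2 (\<lambda>s t. g s * ((Z1 d n s)\<^sup>T * P_block d n P 1 p * Z2 d n s t) $$ (i, l))"
  unfolding block_bilinear[OF Z1_carrier Z2_carrier[OF assms(1)] assms(2,3)]
  by (intro bdd2_mult bdd2_sum bdd2_const bdd2_fst[OF g] bdd2_Z1[OF _ assms(2)] bdd2_Z2[OF assms(1) _ assms(3)]) auto

lemma bdd2_Z2_Z1:
  assumes "p \<noteq> 1" "i < n" "l < n"
  shows "bdd2 (\<lambda>s t. g t * ((Z2 d n t s)\<^sup>T * P_block d n P p 1 * Z1 d n t) $$ (i, l))"
  unfolding block_bilinear[OF Z2_carrier[OF assms(1)] Z1_carrier assms(2,3)]
  by (intro bdd2_mult bdd2_sum bdd2_const bdd2_snd[OF g] bdd2_swap[OF bdd2_Z1[OF _ assms(3)]]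
      bdd2_swap[OF bdd2_Z2[OF assms(1) _ assms(2)]]) auto

lemma bdd2_Z1_Z1:
  assumes "i < n" "l < n"
  shows "bdd2 (\<lambda>s t. g s * ((Z1 d n s)\<^sup>T * P_block d n P 1 1 * Z1 d n s) $$ (i, l))"
  unfolding block_bilinear[OF Z1_carrier Z1_carrier assms]
  by (intro bdd2_mult bdd2_sum bdd2_const bdd2_fst[OF g] bdd2_Z1 assms) auto

lemma hZ_section:
  assumes "p \<noteq> 1" "p' \<noteq> 1" "i < n" "l < n" "s \<in> {a..b}" "t \<in> {a..b}"
  shows "bdd1 (\<lambda>u. hZ d n g P p p' i l u s t)"
  by (intro bdd3_section bdd3_hZ assms)

lemma M_entry_dims [simp]:
  "dim_row (Z1 d n s) = P_size d n 1" "dim_row (Z2 d n s t) = P_size d n 2"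
  "dim_col (Z1 d n s) = n" "dim_col (Z2 d n s t) = n"
  unfolding Z1_def Z2_def P_size_def by auto

lemma M0_entry:
  "i < n \<Longrightarrow> l < n \<Longrightarrow> M0 d n g P s $$ (i, l) = g s * ((Z1 d n s)\<^sup>T * P_block d n P 1 1 * Z1 d n s) $$ (i, l)"
  unfolding M0_def by (simp del: index_mult_mat(1))

text \<open>With all integration limits turned into weights, each entry is a parametric integral
  over the fixed interval, which gives joint measurability and makes it comparable with the kernel
  of a composition.\<close>

lemma M1_entry:
  assumes i: "i < n" and l: "l < n" and s: "s \<in> {a..b}" and t: "t \<in> {a..b}"
  shows "M1 a b d n g P s t $$ (i, l) =
    g s * ((Z1 d n s)\<^sup>T * P_block d n P 1 2 * Z2 d n s t) $$ (i, l)
    + g t * ((Z2 d n t s)\<^sup>T * P_block d n P 3 1 * Z1 d n t) $$ (i, l)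
    + (LINT u|M. (if u < t then 1 else 0) * hZ d n g P 3 3 i l u s t)
    + (LINT u|M. (if t < u then 1 else 0) * ((if u < s then 1 else 0) * hZ d n g P 3 2 i l u s t))
    + (LINT u|M. (if s < u then 1 else 0) * hZ d n g P 2 2 i l u s t)"
proof -
  have h: "(g u \<cdot>\<^sub>m ((Z2 d n u s)\<^sup>T * P_block d n P p p' * Z2 d n u t)) $$ (i, l) = hZ d n g P p p' i l u s t" for p p' u
    unfolding hZ_def using i l by (simp del: index_mult_mat(1))
  note m = bdd1D[OF hZ_section[OF _ _ i l s t]]
  have "M1 a b d n g P s t $$ (i, l) =
    g s * ((Z1 d n s)\<^sup>T * P_block d n P 1 2 * Z2 d n s t) $$ (i, l)
    + g t * ((Z2 d n t s)\<^sup>T * P_block d n P 3 1 * Z1 d n t) $$ (i, l)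
    + (LINT u:{a..t}|lebesgue. hZ d n g P 3 3 i l u s t)
    + (LINT u:{t..s}|lebesgue. hZ d n g P 3 2 i l u s t)
    + (LINT u:{s..b}|lebesgue. hZ d n g P 2 2 i l u s t)"
    unfolding M1_def mat_integral_def using i l by (simp add: h del: index_mult_mat(1))
  then show ?thesis
    using set_integral_left[OF m t] set_integral_mid[OF m s t] set_integral_right[OF m s] by simp
qed

lemma M2_entry:
  assumes i: "i < n" and l: "l < n" and s: "s \<in> {a..b}" and t: "t \<in> {a..b}"
  shows "M2 a b d n g P s t $$ (i, l) =
    g s * ((Z1 d n s)\<^sup>T * P_block d n P 1 3 * Z2 d n s t) $$ (i, l)
    + g t * ((Z2 d n t s)\<^sup>T * P_block d n P 2 1 * Z1 d n t) $$ (i, l)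
    + (LINT u|M. (if u < s then 1 else 0) * hZ d n g P 3 3 i l u s t)
    + (LINT u|M. (if s < u then 1 else 0) * ((if u < t then 1 else 0) * hZ d n g P 2 3 i l u s t))
    + (LINT u|M. (if t < u then 1 else 0) * hZ d n g P 2 2 i l u s t)"
proof -
  have h: "(g u \<cdot>\<^sub>m ((Z2 d n u s)\<^sup>T * P_block d n P p p' * Z2 d n u t)) $$ (i, l) = hZ d n g P p p' i l u s t" for p p' u
    unfolding hZ_def using i l by (simp del: index_mult_mat(1))
  note m = bdd1D[OF hZ_section[OF _ _ i l s t]]
  have "M2 a b d n g P s t $$ (i, l) =
    g s * ((Z1 d n s)\<^sup>T * P_block d n P 1 3 * Z2 d n s t) $$ (i, l)
    + g t * ((Z2 d n t s)\<^sup>T * P_block d n P 2 1 * Z1 d n t) $$ (i, l)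
    + (LINT u:{a..s}|lebesgue. hZ d n g P 3 3 i l u s t)
    + (LINT u:{s..t}|lebesgue. hZ d n g P 2 3 i l u s t)
    + (LINT u:{t..b}|lebesgue. hZ d n g P 2 2 i l u s t)"
    unfolding M2_def mat_integral_def using i l by (simp add: h del: index_mult_mat(1))
  then show ?thesis
    using set_integral_left[OF m s] set_integral_mid[OF m t s] set_integral_right[OF m t] by simp
qed

lemma matb_M0: "matb n n (\<lambda>s _. M0 d n g P s)"
  unfolding matb_def
proof (intro conjI ballI allI impI)
  show "M0 d n g P s \<in> carrier_mat n n" for s unfolding M0_def by (auto intro: carrier_matI)
  fix i j assume "i < n" "j < n"
  then show "bdd2 (\<lambda>s t. M0 d n g P s $$ (i, j))" by (simp only: M0_entry bdd2_Z1_Z1)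
qed

lemma matb_M1: "matb n n (M1 a b d n g P)"
  unfolding matb_def
proof (intro conjI ballI allI impI)
  show "M1 a b d n g P s t \<in> carrier_mat n n" for s t
    unfolding M1_def mat_integral_def by (auto intro: carrier_matI)
  fix i j assume i: "i < n" and j: "j < n"
  show "bdd2 (\<lambda>s t. M1 a b d n g P s t $$ (i, j))"
    by (subst bdd2_cong[OF M1_entry[OF i j]], assumption, assumption)
      (intro bdd2_add bdd2_Z1_Z2 bdd2_Z2_Z1 bdd2_integral bdd3_mult bdd3_hZ i j
       bdd3_12[OF bdd2_less] bdd3_13[OF bdd2_less] bdd3_12[OF bdd2_greater] bdd3_13[OF bdd2_greater]; simp)
qed

lemma matb_M2: "matb n n (M2 a b d n g P)"
  unfolding matb_def
proof (intro conjI ballI allI impI)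
  show "M2 a b d n g P s t \<in> carrier_mat n n" for s t
    unfolding M2_def mat_integral_def by (auto intro: carrier_matI)
  fix i j assume i: "i < n" and j: "j < n"
  show "bdd2 (\<lambda>s t. M2 a b d n g P s t $$ (i, j))"
    by (subst bdd2_cong[OF M2_entry[OF i j]], assumption, assumption)
      (intro bdd2_add bdd2_Z1_Z2 bdd2_Z2_Z1 bdd2_integral bdd3_mult bdd3_hZ i j
       bdd3_12[OF bdd2_less] bdd3_13[OF bdd2_less] bdd3_12[OF bdd2_greater] bdd3_13[OF bdd2_greater]; simp)
qed

lemma is_kop_PI_of_psd:
  "is_kop n n (PI_of_psd a b d n g P) (\<lambda>i j s. M0 d n g P s $$ (i, j))
     (PI_kernel (M1 a b d n g P) (M2 a b d n g P))"
  unfolding PI_of_psd_def by (intro is_kop_PI_op matb_M0 matb_M1 matb_M2)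

text \<open>The kernels arise by multiplying out the factorization. In the composed kernel the row
  block of \<open>P\<close> is 2 or 3 according to whether \<open>s\<close> lies below or above the
  integration variable \<open>u\<close>, and the column block is determined in the same way by
  \<open>t\<close>. For t < s this yields the blocks 33, 32, 22 on the successive intervals for
  \<open>u\<close>, and for s < t the blocks 33, 23, 22, exactly as in \<open>M1\<close> and
  \<open>M2\<close>.\<close>

lemma PI_of_psd_nonneg:
  assumes g0: "\<And>s. s \<in> {a..b} \<Longrightarrow> 0 \<le> g s" and P: "psd_mat (\<Sum>k=1..3. P_size d n k) P" and x: "x \<in> L2 a b n"
  shows "0 \<le> l2_inner a b x (PI_of_psd a b d n g P x)"
proof -
  define q1 where "q1 = P_size d n 1"
  define q2 where "q2 = P_size d n 2"
  have q3: "P_size d n 3 = q2" unfolding q2_def P_size_def by simp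
  note q = q1_def[symmetric] q2_def[symmetric] q3
  have sets: "{1..<2} = {1::nat}" "{1..<3} = {1::nat, 2}" "{1..3} = {1::nat, 2, 3}" by auto
  have off: "(\<Sum>k=1..<1. P_size d n k) = 0" "(\<Sum>k=1..<2. P_size d n k) = q1" "(\<Sum>k=1..<3. P_size d n k) = q1 + q2"
    using sets by (simp_all add: q q1_def[symmetric, unfolded One_nat_def])
  have tot: "(\<Sum>k=1..3. P_size d n k) = q1 + q2 + q2"
    using sets by (simp add: q q1_def[symmetric, unfolded One_nat_def])
  \<comment> \<open>The operator with multiplier \<open>D\<close> and kernel \<open>E\<close> is \<open>x \<mapsto> (Z1 x, \<integral>\<^sub>a\<^sup>s Z2 x, \<integral>\<^sub>s\<^sup>b Z2 x)\<close>.\<close>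
  define D where "D r c s = (if r < q1 then Z1 d n s $$ (r, c) else 0)" for r c s
  define E where "E r c u s = (if r < q1 then 0 else if r < q1 + q2 then (if s < u then 1 else 0) * Z2 d n u s $$ (r - q1, c)
     else (if u < s then 1 else 0) * Z2 d n u s $$ (r - (q1 + q2), c))" for r c u s
  define S where "S p p' A C i l = ((A::real mat)\<^sup>T * P_block d n P p p' * C) $$ (i, l)" for p p' A C i l
  have Z22: "Z2 d n s t \<in> carrier_mat (P_size d n 2) n" and Z23: "Z2 d n s t \<in> carrier_mat (P_size d n 3) n" for s t
    by (rule Z2_carrier, simp)+
  note bb = block_bilinear[OF Z1_carrier Z1_carrier] block_bilinear[OF Z1_carrier Z22] block_bilinear[OF Z1_carrier Z23]
     block_bilinear[OF Z22 Z1_carrier] block_bilinear[OF Z23 Z1_carrier]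
     block_bilinear[OF Z22 Z22] block_bilinear[OF Z22 Z23]
     block_bilinear[OF Z23 Z22] block_bilinear[OF Z23 Z23]
  have DD: "(\<Sum>r<q1+q2+q2. \<Sum>r'<q1+q2+q2. g s * (D r i s * P $$ (r, r') * D r' l s)) = g s * S 1 1 (Z1 d n s) (Z1 d n s) i l"
    if "i < n" "l < n" for i l s
    unfolding S_def D_def sum_lessThan_add bb(1)[OF that, unfolded off q]
    by (simp add: sum_distrib_left q1_def[symmetric, unfolded One_nat_def])
  have DE: "(\<Sum>r<q1+q2+q2. \<Sum>r'<q1+q2+q2. g s * (D r i s * P $$ (r, r') * E r' l s t)) =
     (if t < s then 1 else 0) * (g s * S 1 2 (Z1 d n s) (Z2 d n s t) i l)
      + (if s < t then 1 else 0) * (g s * S 1 3 (Z1 d n s) (Z2 d n s t) i l)"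
    if "i < n" "l < n" for i l s t
    unfolding S_def D_def E_def sum_lessThan_add bb(2,3)[OF that, unfolded off q]
    by (simp add: sum_distrib_left q1_def[symmetric, unfolded One_nat_def])
  have ED: "(\<Sum>r<q1+q2+q2. \<Sum>r'<q1+q2+q2. g t * (E r i t s * P $$ (r, r') * D r' l t)) =
     (if s < t then 1 else 0) * (g t * S 2 1 (Z2 d n t s) (Z1 d n t) i l)
      + (if t < s then 1 else 0) * (g t * S 3 1 (Z2 d n t s) (Z1 d n t) i l)"
    if "i < n" "l < n" for i l s t
    unfolding S_def D_def E_def sum_lessThan_add bb(4,5)[OF that, unfolded off q]
    by (simp add: sum_distrib_left q1_def[symmetric, unfolded One_nat_def])
  have EE: "(\<Sum>r<q1+q2+q2. \<Sum>r'<q1+q2+q2. g u * (E r i u s * P $$ (r, r') * E r' l u t)) =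
      (if s < u then 1 else 0) * ((if t < u then 1 else 0) * hZ d n g P 2 2 i l u s t)
      + (if s < u then 1 else 0) * ((if u < t then 1 else 0) * hZ d n g P 2 3 i l u s t)
      + (if t < u then 1 else 0) * ((if u < s then 1 else 0) * hZ d n g P 3 2 i l u s t)
      + (if u < s then 1 else 0) * ((if u < t then 1 else 0) * hZ d n g P 3 3 i l u s t)"
    if "i < n" "l < n" for i l u s t
    unfolding hZ_def E_def sum_lessThan_add bb(6-9)[OF that, unfolded off q]
    by (simp add: sum_distrib_left q1_def[symmetric, unfolded One_nat_def])
  show ?thesis
  proof (rule quadratic_kop_nonneg[where D=D and E=E and g=g and P=P and q="q1+q2+q2", OF _ _ g g0 _ is_kop_PI_of_psd _ _ x])
    show "psd_mat (q1 + q2 + q2) P" using P unfolding tot .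
    show "bdd1 (D r c)" if "r < q1 + q2 + q2" "c < n" for r c
      unfolding D_def bdd1_iff_bdd2 using that by (cases "r < q1") (auto intro!: bdd2_Z1 simp: q1_def)
    show "bdd2 (E r c)" if "r < q1 + q2 + q2" "c < n" for r c
    proof -
      consider "r < q1" | "\<not> r < q1" "r < q1 + q2" | "\<not> r < q1" "\<not> r < q1 + q2" by blast
      then show ?thesis
      proof cases
        case 1 then show ?thesis unfolding E_def by simp
      next
        case 2 then show ?thesis using that unfolding E_def
          by (simp, intro bdd2_mult bdd2_less bdd2_Z2[where p=2]) (auto simp: q)
      next
        case 3 then show ?thesis using that unfolding E_def
          by (simp, intro bdd2_mult bdd2_greater bdd2_Z2[where p=2]) (auto simp: q)
      qed
    qed
    fix i l s assume i: "i < n" and l: "l < n" and s: "s \<in> {a..b}"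
    show "M0 d n g P s $$ (i, l) = (\<Sum>r<q1+q2+q2. \<Sum>r'<q1+q2+q2. g s * (D r i s * P $$ (r, r') * D r' l s))"
      unfolding DD[OF i l] M0_entry[OF i l] S_def ..
    fix t assume t: "t \<in> {a..b}" "t \<noteq> s"
    note h = hZ_section[OF _ _ i l s t(1)]
    note less = bdd1_section[OF bdd2_less s] bdd1_section[OF bdd2_less t(1)] bdd1_section[OF bdd2_greater s] bdd1_section[OF bdd2_greater t(1)]
    show "PI_kernel (M1 a b d n g P) (M2 a b d n g P) i l s t =
       (\<Sum>r<q1+q2+q2. \<Sum>r'<q1+q2+q2. g s * (D r i s * P $$ (r, r') * E r' l s t))
        + (\<Sum>r<q1+q2+q2. \<Sum>r'<q1+q2+q2. g t * (E r i t s * P $$ (r, r') * D r' l t))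
        + (LINT u|M. (\<Sum>r<q1+q2+q2. \<Sum>r'<q1+q2+q2. g u * (E r i u s * P $$ (r, r') * E r' l u t)))"
    \<comment> \<open>Of the two mixed products of weights only one survives: u cannot be both above
      \<open>s\<close> and below \<open>t\<close> when t < s, and conversely. In the two products
      with equal block numbers one weight implies the other.\<close>
    proof (cases "t < s")
      case True
      have "(LINT u|M. (\<Sum>r<q1+q2+q2. \<Sum>r'<q1+q2+q2. g u * (E r i u s * P $$ (r, r') * E r' l u t))) =
          (LINT u|M. (if u < t then 1 else 0) * hZ d n g P 3 3 i l u s t)
        + (LINT u|M. (if t < u then 1 else 0) * ((if u < s then 1 else 0) * hZ d n g P 3 2 i l u s t))
        + (LINT u|M. (if s < u then 1 else 0) * hZ d n g P 2 2 i l u s t)"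
        unfolding EE[OF i l] by (rule integral_add3) (intro bdd_mult less h; simp | use True in auto)+
      then show ?thesis
        using True unfolding DE[OF i l] ED[OF i l] PI_kernel_def M1_entry[OF i l s t(1)] S_def by simp
    next
      case False
      with t have True: "s < t" by simp
      have "(LINT u|M. (\<Sum>r<q1+q2+q2. \<Sum>r'<q1+q2+q2. g u * (E r i u s * P $$ (r, r') * E r' l u t))) =
          (LINT u|M. (if u < s then 1 else 0) * hZ d n g P 3 3 i l u s t)
        + (LINT u|M. (if s < u then 1 else 0) * ((if u < t then 1 else 0) * hZ d n g P 2 3 i l u s t))
        + (LINT u|M. (if t < u then 1 else 0) * hZ d n g P 2 2 i l u s t)"
        unfolding EE[OF i l] by (rule integral_add3) (intro bdd_mult less h; simp | use True in auto)+
      then show ?thesis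
        using True unfolding DE[OF i l] ED[OF i l] PI_kernel_def M2_entry[OF i l s t(1)] S_def by simp
    qed
  qed
qed

end

text \<open>Both weights 1 and (s - a)(b - s) are nonnegative on [a,b]. Membership in \<Omega> fixes
  \<open>R x\<close> only outside a null set, where its values may even have the wrong dimension;
  this is why \<open>R x\<close> is required to lie in \<open>L2\<close>.\<close>

lemma Omega_nonneg:
  assumes R: "R \<in> Omega a b n d" and x: "x \<in> L2 a b n" and Rx: "R x \<in> L2 a b n"
  shows "0 \<le> l2_inner a b x (R x)"
proof -
  obtain P P' where P: "psd_mat (\<Sum>k=1..3. P_size d n k) P" and P': "psd_mat (\<Sum>k=1..3. P_size d n k) P'"
    and e: "ae_eq a b (R x) (\<lambda>s. PI_of_psd a b d n (\<lambda>s. 1) P x s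
           + PI_of_psd a b d n (\<lambda>s. (s - a) * (b - s)) P' x s)"
    using R x unfolding Omega_def by blast
  have g: "bdd1 (\<lambda>s. (s - a) * (b - s))" by (intro continuous_bdd1 continuous_intros)
  note K1 = is_kop_PI_of_psd[OF bdd_const[of M 1], of n d P] and K2 = is_kop_PI_of_psd[OF g, of n d P']
  note L1 = is_kop_L2[OF K1 x] and L2 = is_kop_L2[OF K2 x]
  have "l2_inner a b x (R x) = l2_inner a b x (\<lambda>s. PI_of_psd a b d n (\<lambda>s. 1) P x s
           + PI_of_psd a b d n (\<lambda>s. (s - a) * (b - s)) P' x s)"
    by (rule l2_inner_ae_cong[OF _ e x x Rx L2_add[OF L1 L2]]) (simp add: ae_eq_def)
  also have "\<dots> = l2_inner a b x (PI_of_psd a b d n (\<lambda>s. 1) P x) + l2_inner a b x (PI_of_psd a b d n (\<lambda>s. (s - a) * (b - s)) P' x)"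
    by (rule l2_inner_add_right[OF L1 L2 x])
  also have "0 \<le> \<dots>"
    by (intro add_nonneg_nonneg PI_of_psd_nonneg g P P' x bdd_const) auto
  finally show ?thesis .
qed

end

subsection \<open>Smooth functions\<close>

text \<open>If each member of a family has a derivative in the family, iterating a choice of
  derivatives supplies all orders. Smoothness then follows from exhibiting a closed family, with no
  formula for higher derivatives.\<close>

lemma smooth_coinduct:
  assumes step: "\<And>f. f \<in> S \<Longrightarrow> \<exists>f'\<in>S. \<forall>t. (f has_real_derivative f' t) (at t)" and f: "f \<in> S"
  shows "smooth_fun f"
proof -
  obtain d where d: "\<And>f. f \<in> S \<Longrightarrow> d f \<in> S" "\<And>f t. f \<in> S \<Longrightarrow> (f has_real_derivative d f t) (at t)"
    using step by metis
  have "(d ^^ k) f \<in> S" for k by (induction k) (auto simp: f d)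
  then show ?thesis unfolding smooth_fun_def
    by (intro exI[of _ "\<lambda>k. (d ^^ k) f"]) (auto intro: d)
qed

lemma smooth_funE:
  assumes "smooth_fun f"
  obtains f' where "smooth_fun f'" "\<And>t. (f has_real_derivative f' t) (at t)"
proof -
  obtain D where D: "D 0 = f" "\<And>k t. (D k has_real_derivative D (Suc k) t) (at t)"
    using assms unfolding smooth_fun_def by blast
  have "smooth_fun (D (Suc 0))" unfolding smooth_fun_def
    by (intro exI[of _ "\<lambda>k. D (Suc k)"]) (auto intro: D)
  then show ?thesis using that D by metis
qed

lemma smooth_fun_antiderivative:
  assumes "smooth_fun f'" "\<And>t. (f has_real_derivative f' t) (at t)"
  shows "smooth_fun f"
proof -
  obtain D where D: "D 0 = f'" "\<And>k t. (D k has_real_derivative D (Suc k) t) (at t)"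
    using assms unfolding smooth_fun_def by blast
  show ?thesis unfolding smooth_fun_def
    by (intro exI[of _ "case_nat f D"]) (auto split: nat.split simp: D assms(2))
qed

lemma smooth_fun_continuous: "smooth_fun f \<Longrightarrow> continuous_on S f"
  by (erule smooth_funE) (meson DERIV_continuous continuous_at_imp_continuous_on)

lemma smooth_fun_const: "smooth_fun (\<lambda>_. c)"
  by (rule smooth_coinduct[where S="range (\<lambda>c _. c)"]) (auto intro!: exI[of _ 0])

lemma smooth_fun_add:
  assumes "smooth_fun f" "smooth_fun g" shows "smooth_fun (\<lambda>x. f x + g x)"
proof (rule smooth_coinduct[where S="{\<lambda>x. f x + g x |f g. smooth_fun f \<and> smooth_fun g}"])
  fix h assume "h \<in> {\<lambda>x. f x + g x |f g. smooth_fun f \<and> smooth_fun g}"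
  then obtain f g where h: "h = (\<lambda>x. f x + g x)" "smooth_fun f" "smooth_fun g" by auto
  obtain f' g' where "smooth_fun f'" "\<And>t. (f has_real_derivative f' t) (at t)"
    "smooth_fun g'" "\<And>t. (g has_real_derivative g' t) (at t)"
    using h(2,3) by (metis smooth_funE)
  then show "\<exists>h'\<in>{\<lambda>x. f x + g x |f g. smooth_fun f \<and> smooth_fun g}. \<forall>t. (h has_real_derivative h' t) (at t)"
    unfolding h by (intro bexI[of _ "\<lambda>x. f' x + g' x"]) (auto intro!: derivative_eq_intros)
qed (use assms in auto)

text \<open>The derivative of a product is a sum of two products, so products alone are not closed
  under differentiation, whereas finite sums of products are.\<close>

inductive_set smooth_products :: "(real \<Rightarrow> real) set" where
  prod: "smooth_fun f \<Longrightarrow> smooth_fun g \<Longrightarrow> (\<lambda>x. f x * g x) \<in> smooth_products"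
| add: "u \<in> smooth_products \<Longrightarrow> v \<in> smooth_products \<Longrightarrow> (\<lambda>x. u x + v x) \<in> smooth_products"

lemma smooth_fun_mult:
  assumes "smooth_fun f" "smooth_fun g" shows "smooth_fun (\<lambda>x. f x * g x)"
proof (rule smooth_coinduct[where S=smooth_products])
  fix h assume "h \<in> smooth_products"
  then show "\<exists>h'\<in>smooth_products. \<forall>t. (h has_real_derivative h' t) (at t)"
  proof induction
    case (prod f g)
    obtain f' g' where "smooth_fun f'" "\<And>t. (f has_real_derivative f' t) (at t)"
      "smooth_fun g'" "\<And>t. (g has_real_derivative g' t) (at t)"
      using prod by (metis smooth_funE)
    then show ?case using prod
      by (intro bexI[of _ "\<lambda>x. f x * g' x + f' x * g x"])
         (auto intro!: derivative_eq_intros smooth_products.intros)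
  next
    case (add u v)
    then obtain u' v' where "u' \<in> smooth_products" "\<forall>t. (u has_real_derivative u' t) (at t)"
      "v' \<in> smooth_products" "\<forall>t. (v has_real_derivative v' t) (at t)" by blast
    then show ?case
      by (intro bexI[of _ "\<lambda>x. u' x + v' x"]) (auto intro!: derivative_eq_intros smooth_products.intros)
  qed
qed (rule smooth_products.prod[OF assms])

lemma smooth_fun_affine:
  assumes "smooth_fun f" shows "smooth_fun (\<lambda>x. f (k * x + c))"
proof -
  \<comment> \<open>The scalar \<open>r\<close> is carried along to absorb the factor
    \<open>k\<close> that the chain rule produces at each differentiation.\<close>
  have "smooth_fun (\<lambda>x. r * f (k * x + c))" for r
  proof (rule smooth_coinduct[where S="{\<lambda>x. r * f (k * x + c) |r f. smooth_fun f}"])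
    fix h assume "h \<in> {\<lambda>x. r * f (k * x + c) |r f. smooth_fun f}"
    then obtain r f where h: "h = (\<lambda>x. r * f (k * x + c))" "smooth_fun f" by auto
    obtain f' where f': "smooth_fun f'" "\<And>t. (f has_real_derivative f' t) (at t)"
      using h(2) by (metis smooth_funE)
    have "(h has_real_derivative (r * k) * f' (k * t + c)) (at t)" for t
    proof -
      have "((\<lambda>x. k * x + c) has_real_derivative k) (at t)" by (auto intro!: derivative_eq_intros)
      from DERIV_chain2[OF f'(2) this] show ?thesis
        unfolding h by (auto intro!: derivative_eq_intros)
    qed
    then show "\<exists>h'\<in>{\<lambda>x. r * f (k * x + c) |r f. smooth_fun f}. \<forall>t. (h has_real_derivative h' t) (at t)"
      using f'(1) by (intro bexI[of _ "\<lambda>t. (r * k) * f' (k * t + c)"]) auto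
  qed (use assms in auto)
  from this[of 1] show ?thesis by simp
qed

text \<open>The functions u exp(f) with smooth u form a closed family: differentiation replaces u by
  u' + u f'.\<close>

lemma smooth_fun_exp:
  assumes "smooth_fun f" shows "smooth_fun (\<lambda>x. exp (f x))"
proof -
  obtain f' where f': "smooth_fun f'" "\<And>t. (f has_real_derivative f' t) (at t)"
    using assms by (metis smooth_funE)
  show ?thesis
  proof (rule smooth_coinduct[where S="{\<lambda>x. u x * exp (f x) |u. smooth_fun u}"])
    fix h assume "h \<in> {\<lambda>x. u x * exp (f x) |u. smooth_fun u}"
    then obtain u where h: "h = (\<lambda>x. u x * exp (f x))" "smooth_fun u" by auto
    obtain u' where u': "smooth_fun u'" "\<And>t. (u has_real_derivative u' t) (at t)"
      using h(2) by (metis smooth_funE)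
    have "(h has_real_derivative (u' t + u t * f' t) * exp (f t)) (at t)" for t
      unfolding h using DERIV_mult[OF u'(2) DERIV_fun_exp[OF f'(2)]] by (simp add: algebra_simps)
    moreover have "smooth_fun (\<lambda>t. u' t + u t * f' t)"
      by (intro smooth_fun_add smooth_fun_mult u' h f')
    ultimately show "\<exists>h'\<in>{\<lambda>x. u x * exp (f x) |u. smooth_fun u}. \<forall>t. (h has_real_derivative h' t) (at t)"
      by (intro bexI[of _ "\<lambda>t. (u' t + u t * f' t) * exp (f t)"]) auto
  next
    show "(\<lambda>x. exp (f x)) \<in> {\<lambda>x. u x * exp (f x) |u. smooth_fun u}"
      using smooth_fun_const[of 1] by (intro CollectI exI[of _ "\<lambda>_. 1"]) auto
  qed
qed

lemma poly_times_exp_neg_tendsto_0: "((\<lambda>y. poly p y * exp (- y)) \<longlongrightarrow> 0) at_top" for p :: "real poly"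
proof -
  have "((\<lambda>y. \<Sum>i\<le>degree p. coeff p i * (y ^ i / exp y)) \<longlongrightarrow> (\<Sum>i\<le>degree p. coeff p i * 0)) at_top"
    by (intro tendsto_sum tendsto_mult tendsto_const tendsto_power_div_exp_0)
  then show ?thesis
    by (simp add: poly_altdef exp_minus divide_inverse sum_distrib_right mult.assoc)
qed

text \<open>The family \<open>p(1/x) exp(-1/x)\<close>, extended by zero to \<open>x \<le> 0\<close>, is closed under differentiation.\<close>

definition flat :: "real poly \<Rightarrow> real \<Rightarrow> real" where
  "flat p x = (if x \<le> 0 then 0 else poly p (1 / x) * exp (- (1 / x)))"

text \<open>With y = 1/x the derivative of p(y) exp(-y) in x is y^2 (p(y) - p'(y)) exp(-y), and the
  polynomial factor \<open>[:0, 0, 1:]\<close> is y^2. At 0 the right difference quotient is y p(y)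
  exp(-y), which tends to 0 because the exponential beats every polynomial.\<close>

lemma flat_deriv: "(flat p has_real_derivative flat ([:0, 0, 1:] * (p - pderiv p)) t) (at t)"
proof -
  consider "t < 0" | "t > 0" | "t = 0" by linarith
  then show ?thesis
  proof cases
    case 1
    have "((\<lambda>_. 0) has_real_derivative 0) (at t)" by simp
    then have "(flat p has_real_derivative 0) (at t)"
      by (rule has_field_derivative_transform_within_open[where S="{..<0}"]) (use 1 in \<open>auto simp: flat_def\<close>)
    then show ?thesis using 1 by (simp add: flat_def)
  next
    case 2
    have "((\<lambda>x. poly p (1 / x) * exp (- (1 / x))) has_real_derivative
       flat ([:0, 0, 1:] * (p - pderiv p)) t) (at t)"
      unfolding flat_def using 2
      by (auto intro!: derivative_eq_intros simp: field_simps power2_eq_square)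
    then show ?thesis
      by (rule has_field_derivative_transform_within_open[where S="{0<..}"]) (use 2 in \<open>auto simp: flat_def\<close>)
  next
    case 3
    have "((\<lambda>x. flat p x / x) \<longlongrightarrow> 0) (at_right 0)"
    proof -
      have "((\<lambda>x. poly ([:0, 1:] * p) (inverse x) * exp (- inverse x)) \<longlongrightarrow> 0) (at_right 0)"
        by (rule filterlim_compose[OF poly_times_exp_neg_tendsto_0 filterlim_inverse_at_top_right])
      then show ?thesis
        by (rule Lim_transform_eventually)
           (auto simp: flat_def eventually_at_filter divide_inverse)
    qed
    moreover have "((\<lambda>x. flat p x / x) \<longlongrightarrow> 0) (at_left 0)"
      by (rule tendsto_eventually) (auto simp: flat_def eventually_at_filter)
    ultimately have "((\<lambda>x. flat p x / x) \<longlongrightarrow> 0) (at 0)" by (simp add: filterlim_split_at)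
    then have "(flat p has_real_derivative 0) (at 0)"
      unfolding has_field_derivative_iff by (simp add: flat_def)
    then show ?thesis using 3 by (simp add: flat_def)
  qed
qed

lemma smooth_fun_flat: "smooth_fun (flat p)"
  by (rule smooth_coinduct[where S="range flat"]) (use flat_deriv in auto)

text \<open>The product of the two flat functions is positive exactly on the open interval from c to
  d, so increasing \<open>n\<close> drives the bump to the indicator of that interval while it stays
  between 0 and 1.\<close>

definition bump :: "real \<Rightarrow> real \<Rightarrow> nat \<Rightarrow> real \<Rightarrow> real" where
  "bump c d n x = 1 - exp (- (real n * (flat 1 (x - c) * flat 1 (d - x))))"

lemma flat_1_pos: "x > 0 \<Longrightarrow> flat 1 x > 0" and flat_1_nonneg: "flat 1 x \<ge> 0"
  unfolding flat_def by auto

lemma test_fun_bump: assumes "a < c" "d < b" shows "test_fun a b (bump c d n)"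
proof -
  have "smooth_fun (\<lambda>x. flat 1 (1 * x + (- c)))" "smooth_fun (\<lambda>x. flat 1 ((-1) * x + d))"
    by (intro smooth_fun_affine smooth_fun_flat)+
  then have s: "smooth_fun (\<lambda>x. flat 1 (x - c))" "smooth_fun (\<lambda>x. flat 1 (d - x))" by simp_all
  have "smooth_fun (\<lambda>x. 1 + (-1) * exp ((- real n) * (flat 1 (x - c) * flat 1 (d - x))))"
    by (intro smooth_fun_add smooth_fun_mult smooth_fun_exp smooth_fun_const s)
  then have "smooth_fun (bump c d n)" unfolding bump_def by simp
  moreover have "bump c d n x = 0" if "x \<notin> {c..d}" for x
    using that unfolding bump_def flat_def by auto
  ultimately show ?thesis using assms unfolding test_fun_def by blast
qed

lemma bump_range: "0 \<le> bump c d n x" "bump c d n x \<le> 1"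
  unfolding bump_def using flat_1_nonneg by auto

lemma bump_tendsto: "(\<lambda>n. bump c d n x) \<longlonglongrightarrow> indicator {c<..<d} x"
proof (cases "x \<in> {c<..<d}")
  case True
  then have "flat 1 (x - c) * flat 1 (d - x) > 0" using flat_1_pos by auto
  then have "filterlim (\<lambda>n. real n * (flat 1 (x - c) * flat 1 (d - x))) at_top sequentially"
    by (intro filterlim_at_top_mult_tendsto_pos[OF tendsto_const] filterlim_real_sequentially) (auto simp: mult.commute)
  then have "(\<lambda>n. exp (- (real n * (flat 1 (x - c) * flat 1 (d - x))))) \<longlonglongrightarrow> 0"
    by (intro filterlim_compose[OF exp_at_bot] filterlim_uminus_at_bot_at_top[THEN filterlim_compose])
  then have "(\<lambda>n. bump c d n x) \<longlonglongrightarrow> 1 - 0" unfolding bump_def by (intro tendsto_intros)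
  then show ?thesis using True by simp
next
  case False
  then have "flat 1 (x - c) * flat 1 (d - x) = 0" unfolding flat_def by auto
  then have "bump c d n x = 0" for n unfolding bump_def by (simp only: mult_zero_right) simp
  then show ?thesis using False by simp
qed

lemma test_funD:
  assumes "test_fun a b \<phi>"
  shows "smooth_fun \<phi>" "smooth_fun (deriv \<phi>)" "(\<phi> has_real_derivative deriv \<phi> t) (at t)" "\<phi> a = 0" "\<phi> b = 0"
proof -
  show s: "smooth_fun \<phi>" using assms unfolding test_fun_def by simp
  then obtain f' where f': "smooth_fun f'" "\<And>t. (\<phi> has_real_derivative f' t) (at t)"
    by (metis smooth_funE)
  have "deriv \<phi> = f'" using f'(2) by (auto intro: DERIV_imp_deriv)
  then show "smooth_fun (deriv \<phi>)" "(\<phi> has_real_derivative deriv \<phi> t) (at t)" using f' by auto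
  obtain c d where "a < c" "d < b" "\<And>s. s \<notin> {c..d} \<Longrightarrow> \<phi> s = 0"
    using assms unfolding test_fun_def by blast
  then show "\<phi> a = 0" "\<phi> b = 0" by auto
qed

lemma test_fun_lincomb:
  assumes "test_fun a b \<phi>" "test_fun a b \<psi>" shows "test_fun a b (\<lambda>x. \<phi> x + r * \<psi> x)"
proof -
  obtain c d where 1: "a < c" "d < b" "\<And>s. s \<notin> {c..d} \<Longrightarrow> \<phi> s = 0"
    using assms unfolding test_fun_def by blast
  obtain c' d' where 2: "a < c'" "d' < b" "\<And>s. s \<notin> {c'..d'} \<Longrightarrow> \<psi> s = 0"
    using assms unfolding test_fun_def by blast
  have "\<phi> s + r * \<psi> s = 0" if "s \<notin> {min c c'..max d d'}" for s
  proof -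
    have "s \<notin> {c..d}" "s \<notin> {c'..d'}" using that by auto
    then show ?thesis using 1(3) 2(3) by simp
  qed
  moreover have "a < min c c'" "max d d' < b" using 1 2 by auto
  moreover have "smooth_fun (\<lambda>x. \<phi> x + r * \<psi> x)"
    using assms unfolding test_fun_def by (intro smooth_fun_add smooth_fun_mult smooth_fun_const) auto
  ultimately show ?thesis unfolding test_fun_def by blast
qed

text \<open>A primitive started left of the support vanishes there, and it vanishes again right of
  the support because the total integral is 0.\<close>

lemma test_fun_antiderivative:
  assumes "a < b" and \<chi>: "test_fun a b \<chi>" and int: "integral {a..b} \<chi> = 0"
  obtains \<Phi> where "test_fun a b \<Phi>" "deriv \<Phi> = \<chi>"
proof -
  obtain c d where cd: "a < c" "d < b" and out: "\<And>s. s \<notin> {c..d} \<Longrightarrow> \<chi> s = 0" and sm: "smooth_fun \<chi>"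
    using \<chi> unfolding test_fun_def by blast
  have cont: "continuous_on S \<chi>" for S by (rule smooth_fun_continuous[OF sm])
  \<comment> \<open>Starting left of \<open>a\<close> makes the fundamental theorem available on a
    neighbourhood of [a,b]; points at or below \<open>A\<close> lie where the primitive is
    identically 0.\<close>
  define A where "A = a - 1"
  define G where "G x = integral {A..x} \<chi>" for x
  have intg: "\<chi> integrable_on {x..y}" for x y by (rule integrable_continuous_interval[OF cont])
  have G: "(G has_real_derivative \<chi> x) (at x)" if "A < x" for x
  proof -
    have "(G has_real_derivative \<chi> x) (at x within {A..x+1})"
      unfolding G_def by (rule integral_has_real_derivative[OF cont]) (use that in auto)
    then show ?thesis using that by (simp add: at_within_Icc_at)
  qed
  have zl: "G x = 0" if "x < c" for x
  proof -
    have "integral {A..x} \<chi> = integral {A..x} (\<lambda>_. 0)"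
      by (rule Henstock_Kurzweil_Integration.integral_cong) (use that out in auto)
    then show ?thesis unfolding G_def by simp
  qed
  have zr: "G x = 0" if "d < x" "a \<le> x" for x
  proof -
    have gb: "G b = 0"
      using Henstock_Kurzweil_Integration.integral_combine[OF _ _ intg, of A a b] zl[of a] cd int \<open>a < b\<close>
      unfolding G_def A_def by simp
    have zero: "integral {x..y} \<chi> = 0" if "d < x" for x y
    proof -
      have "integral {x..y} \<chi> = integral {x..y} (\<lambda>_. 0)"
        by (rule Henstock_Kurzweil_Integration.integral_cong) (use that out in auto)
      then show ?thesis by simp
    qed
    show ?thesis
    proof (cases "x \<le> b")
      case True
      then have "G x + integral {x..b} \<chi> = G b"
        using Henstock_Kurzweil_Integration.integral_combine[OF _ _ intg, of A x b] that unfolding G_def A_def by simp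
      then show ?thesis using gb zero[OF that(1)] by simp
    next
      case False
      then have "G b + integral {b..x} \<chi> = G x"
        using Henstock_Kurzweil_Integration.integral_combine[OF _ _ intg, of A b x] \<open>a < b\<close> unfolding G_def A_def by simp
      then show ?thesis using gb zero[OF cd(2)] by simp
    qed
  qed
  have G': "(G has_real_derivative \<chi> x) (at x)" for x
  proof (cases "A < x")
    case False
    then have "x < c" using cd unfolding A_def by simp
    have "((\<lambda>_. 0) has_real_derivative 0) (at x)" by simp
    then have "(G has_real_derivative 0) (at x)"
      by (rule has_field_derivative_transform_within_open[where S="{..<c}"]) (use \<open>x < c\<close> zl in auto)
    then show ?thesis using out[of x] \<open>x < c\<close> by simp
  qed (rule G)
  have "smooth_fun G" by (rule smooth_fun_antiderivative[OF sm G'])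
  \<comment> \<open>The bound \<open>d\<close> of the support of \<open>\<chi>\<close> may lie below
    \<open>a\<close>, while vanishing on the right was shown only from \<open>a\<close> on; hence
    the maximum.\<close>
  moreover have "G s = 0" if "s \<notin> {c..max d a}" for s
    using that zl zr by (cases "s < c") auto
  moreover have "max d a < b" using cd \<open>a < b\<close> by simp
  ultimately have "test_fun a b G" unfolding test_fun_def using cd by blast
  moreover have "deriv G = \<chi>" using G' by (auto intro: DERIV_imp_deriv)
  ultimately show ?thesis using that by blast
qed

subsection \<open>Weak derivatives\<close>

context interval begin

lemma smooth_bdd1: "smooth_fun f \<Longrightarrow> bdd1 f"
  by (intro continuous_bdd1 smooth_fun_continuous)

lemma LINT_eq_integral:
  assumes "f \<in> sq_int" "{c..d} \<subseteq> {a..b}"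
  shows "set_lebesgue_integral lebesgue {c..d} f = integral {c..d} f" "f integrable_on {c..d}"
proof -
  have "set_integrable lebesgue {a..b} f"
    using sq_int_integrable[OF assms(1)] unfolding set_integrable_def
    by (subst (asm) integrable_restrict_space) auto
  then have "set_integrable lebesgue {c..d} f" by (rule set_integrable_subset) (use assms in auto)
  then show "set_lebesgue_integral lebesgue {c..d} f = integral {c..d} f" "f integrable_on {c..d}"
    by (rule set_lebesgue_integral_eq_integral)+
qed

text \<open>Bumps converge to indicators of intervals, so all integrals of \<open>f\<close> over intervals vanish, and almost every point
  is a Lebesgue point.\<close>

lemma fundamental_lemma:
  assumes f: "f \<in> sq_int" and zero: "\<And>\<phi>. test_fun a b \<phi> \<Longrightarrow> (LINT s|M. f s * \<phi> s) = 0"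
  shows "AE s in M. f s = 0"
proof -
  have ind: "(LINT s|M. f s * indicator {c<..<d} s) = 0" if "a < c" "d < b" for c d
  proof (rule LIMSEQ_unique)
    show "(\<lambda>n. LINT s|M. f s * bump c d n s) \<longlonglongrightarrow> 0"
      using zero[OF test_fun_bump[OF that]] by simp
    show "(\<lambda>n. LINT s|M. f s * bump c d n s) \<longlonglongrightarrow> (LINT s|M. f s * indicator {c<..<d} s)"
    proof (rule integral_dominated_convergence)
      show "integrable M (\<lambda>s. \<bar>f s\<bar>)" using sq_int_integrable[OF f] by (rule integrable_abs)
      show "(\<lambda>s. f s * bump c d n s) \<in> borel_measurable M" for n
        using smooth_bdd1[OF test_funD(1)[OF test_fun_bump[OF that]]] sq_intD[OF f] by (auto dest: bdd1D)
      show "AE s in M. (\<lambda>n. f s * bump c d n s) \<longlonglongrightarrow> f s * indicator {c<..<d} s"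
        by (intro AE_I2 tendsto_mult tendsto_const bump_tendsto)
      show "AE s in M. norm (f s * bump c d n s) \<le> \<bar>f s\<bar>" for n
        using bump_range by (auto simp: abs_mult intro!: mult_left_le)
      show "(\<lambda>s. f s * indicator {c<..<d} s) \<in> borel_measurable M"
        by (intro borel_measurable_times borel_measurable_indicator sq_intD[OF f])
           (use that in \<open>auto simp: sets_restrict_space_iff\<close>)
    qed
  qed
  \<comment> \<open>Extension by zero gives a function integrable on every interval of the line, as
    the differentiation theorem for integrals requires.\<close>
  define F where "F s = (if s \<in> {a..b} then f s else 0)" for s
  have int0: "integral {c..d} F = 0" if "a < c" "d < b" for c d
  proof -
    have sub: "{c..d} \<subseteq> {a..b}" using that by auto
    have "integral {c..d} F = integral {c..d} f"
      by (rule Henstock_Kurzweil_Integration.integral_cong) (use that in \<open>auto simp: F_def\<close>)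
    also have "\<dots> = set_lebesgue_integral lebesgue {c..d} f" using LINT_eq_integral(1)[OF f sub] by simp
    also have "\<dots> = (LINT s|M. indicator {c<..<d} s * f s)"
      by (rule set_integral_weight[OF sq_intD[OF f] borel_measurable_indicator sub])
         (use that in \<open>auto simp: sets_restrict_space_iff indicator_def\<close>)
    also have "\<dots> = (LINT s|M. f s * indicator {c<..<d} s)" by (simp add: mult.commute)
    finally show ?thesis using ind[OF that] by simp
  qed
  have "F integrable_on cbox c d" for c d
  proof -
    have "f integrable_on {a..b}" using LINT_eq_integral(2)[OF f] by simp
    then have "F integrable_on UNIV" unfolding F_def by (subst integrable_restrict_UNIV)
    then show ?thesis by (rule integrable_on_subcbox) simp
  qed
  from integrable_ccontinuous_explicit[OF this]
  obtain N where N: "negligible N" and lim: "\<And>x e. \<lbrakk>x \<notin> N; 0 < e\<rbrakk> \<Longrightarrow>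
       \<exists>d>0. \<forall>h. 0 < h \<and> h < d \<longrightarrow> norm (integral (cbox x (x + h *\<^sub>R One)) F /\<^sub>R h ^ DIM(real) - F x) < e"
    by blast
  have zeroF: "F x = 0" if x: "x \<notin> N" "a < x" "x < b" for x
  proof (rule ccontr)
    assume "F x \<noteq> 0"
    then obtain d where d: "d > 0" "\<And>h. 0 < h \<Longrightarrow> h < d \<Longrightarrow> norm (integral (cbox x (x + h *\<^sub>R One)) F /\<^sub>R h ^ DIM(real) - F x) < \<bar>F x\<bar>"
      using lim[OF x(1), of "\<bar>F x\<bar>"] by auto
    \<comment> \<open>Small enough for the Lebesgue point estimate and for [x, x + h] to stay inside
      the open interval. The mean over [x, x + h] is then 0, and the estimate would read \<bar>F
      x\<bar> < \<bar>F x\<bar>.\<close>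
    define h where "h = min (d / 2) ((b - x) / 2)"
    have h: "0 < h" "h < d" "x + h < b" using d(1) x unfolding h_def by (auto simp: min_def field_simps)
    have "integral {x..x+h} F = 0" by (rule int0) (use x h in auto)
    then show False using d(2)[OF h(1,2)] by simp
  qed
  have "N \<union> {a, b} \<in> null_sets lebesgue"
    using N by (auto simp: negligible_iff_null_sets[symmetric] negligible_Un)
  then have "AE s in lebesgue. s \<notin> N \<union> {a, b}" by (rule AE_not_in)
  then have "AE s in lebesgue. s \<in> {a..b} \<longrightarrow> f s = 0"
  proof eventually_elim
    case (elim s)
    then show ?case using zeroF[of s] by (auto simp: F_def)
  qed
  then show ?thesis by (subst AE_restrict_space_iff) auto
qed

definition swd :: "(real \<Rightarrow> real) \<Rightarrow> (real \<Rightarrow> real) \<Rightarrow> bool" where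
  "swd u v \<longleftrightarrow> (\<forall>\<phi>. test_fun a b \<phi> \<longrightarrow> (LINT s|M. u s * deriv \<phi> s) = - (LINT s|M. v s * \<phi> s))"

lemma has_weak_deriv_iff: "has_weak_deriv a b m u v \<longleftrightarrow> (\<forall>i<m. swd (\<lambda>s. u s $ i) (\<lambda>s. v s $ i))"
  unfolding has_weak_deriv_def swd_def set_integral_M by blast

lemma test_sq_int: "test_fun a b \<phi> \<Longrightarrow> \<phi> \<in> sq_int" "test_fun a b \<phi> \<Longrightarrow> deriv \<phi> \<in> sq_int"
  by (auto intro: bdd1_sq_int smooth_bdd1 test_funD)

lemma swd_lincomb:
  assumes "swd u v" "swd u' v'" "u \<in> sq_int" "v \<in> sq_int" "u' \<in> sq_int" "v' \<in> sq_int"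
  shows "swd (\<lambda>s. u s + r * u' s) (\<lambda>s. v s + r * v' s)"
  unfolding swd_def
proof (intro allI impI)
  fix \<phi> assume t: "test_fun a b \<phi>"
  note i = sq_int_mult_integrable[OF assms(3) test_sq_int(2)[OF t]] sq_int_mult_integrable[OF assms(5) test_sq_int(2)[OF t]]
    sq_int_mult_integrable[OF assms(4) test_sq_int(1)[OF t]] sq_int_mult_integrable[OF assms(6) test_sq_int(1)[OF t]]
  have "(LINT s|M. (u s + r * u' s) * deriv \<phi> s) = (LINT s|M. u s * deriv \<phi> s + r * (u' s * deriv \<phi> s))"
    by (simp add: algebra_simps)
  also have "\<dots> = (LINT s|M. u s * deriv \<phi> s) + r * (LINT s|M. u' s * deriv \<phi> s)" using i by simp
  also have "\<dots> = - ((LINT s|M. v s * \<phi> s) + r * (LINT s|M. v' s * \<phi> s))"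
    using assms(1,2) t unfolding swd_def by simp
  also have "\<dots> = - (LINT s|M. v s * \<phi> s + r * (v' s * \<phi> s))" using i by simp
  finally show "(LINT s|M. (u s + r * u' s) * deriv \<phi> s) = - (LINT s|M. (v s + r * v' s) * \<phi> s)"
    by (simp add: algebra_simps)
qed

lemma swd_cong_AE:
  assumes "swd u v" "AE s in M. u s = u' s" "u \<in> sq_int" "u' \<in> sq_int"
  shows "swd u' v"
  unfolding swd_def
proof (intro allI impI)
  fix \<phi> assume t: "test_fun a b \<phi>"
  have "(LINT s|M. u' s * deriv \<phi> s) = (LINT s|M. u s * deriv \<phi> s)"
  proof (rule integral_cong_AE)
    show "AE s in M. u' s * deriv \<phi> s = u s * deriv \<phi> s" using assms(2) by eventually_elim simp
  qed (intro borel_measurable_times sq_intD assms test_sq_int t)+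
  then show "(LINT s|M. u' s * deriv \<phi> s) = - (LINT s|M. v s * \<phi> s)" using assms(1) t unfolding swd_def by simp
qed

text \<open>The difference of two weak derivatives of the same function is a weak derivative of 0,
  hence integrates to 0 against every test function.\<close>

lemma swd_unique:
  assumes "swd u v" "swd u v'" "u \<in> sq_int" "v \<in> sq_int" "v' \<in> sq_int"
  shows "AE s in M. v s = v' s"
proof -
  have s: "swd (\<lambda>s. u s + (-1) * u s) (\<lambda>s. v s + (-1) * v' s)" by (rule swd_lincomb) fact+
  have "AE s in M. v s + (-1) * v' s = 0"
  proof (rule fundamental_lemma)
    show "(\<lambda>s. v s + (-1) * v' s) \<in> sq_int" by (intro sq_int_add sq_int_cmult assms)
    fix \<phi> assume "test_fun a b \<phi>"
    then show "(LINT s|M. (v s + (-1) * v' s) * \<phi> s) = 0" using s unfolding swd_def by simp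
  qed
  then show ?thesis by simp
qed

text \<open>For a fixed test function \<open>h\<close> of nonzero mean, \<open>\<phi> - (\<integral>\<phi> / \<integral>h) h\<close> is the derivative of a test function.\<close>

lemma swd_zero_const:
  assumes "swd u (\<lambda>_. 0)" "u \<in> sq_int"
  obtains c where "AE s in M. u s = c"
proof -
  \<comment> \<open>If every test function had mean zero, the constant 1 would integrate to 0
    against all of them and so vanish almost everywhere on an interval of positive length.\<close>
  obtain h0 where h0: "test_fun a b h0" "(LINT s|M. h0 s) \<noteq> 0"
  proof (rule ccontr)
    assume "\<not> thesis"
    then have "AE s in M. (1::real) = 0"
      by (intro fundamental_lemma) (use that in auto)
    then have "AE s in M. False" by simp
    then have "emeasure M (space M) = 0" unfolding ae_filter_eq_bot_iff[symmetric] by (simp add: trivial_limit_def)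
    then show False using ab by (simp add: emeasure_restrict_space)
  qed
  define r where "r \<phi> = (LINT s|M. \<phi> s) / (LINT s|M. h0 s)" for \<phi>
  define c where "c = (LINT s|M. u s * h0 s) / (LINT s|M. h0 s)"
  have "AE s in M. u s + (- c) = 0"
  proof (rule fundamental_lemma)
    show "(\<lambda>s. u s + (- c)) \<in> sq_int" by (intro sq_int_add sq_int_const assms)
    fix \<phi> assume t: "test_fun a b \<phi>"
    let ?\<chi> = "\<lambda>s. \<phi> s + (- r \<phi>) * h0 s"
    have \<chi>: "test_fun a b ?\<chi>" by (rule test_fun_lincomb[OF t h0(1)])
    have "integral {a..b} ?\<chi> = (LINT s|M. ?\<chi> s)"
      using LINT_eq_integral(1)[OF test_sq_int(1)[OF \<chi>], of a b] by (simp add: set_integral_M)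
    also have "\<dots> = (LINT s|M. \<phi> s) + (- r \<phi>) * (LINT s|M. h0 s)"
      using sq_int_integrable[OF test_sq_int(1)[OF t]] sq_int_integrable[OF test_sq_int(1)[OF h0(1)]] by simp
    also have "\<dots> = 0" unfolding r_def using h0(2) by simp
    finally obtain \<Phi> where \<Phi>: "test_fun a b \<Phi>" "deriv \<Phi> = ?\<chi>"
      using test_fun_antiderivative[OF ab \<chi>] by blast
    have "(LINT s|M. u s * ?\<chi> s) = 0" using assms(1) \<Phi> unfolding swd_def by force
    moreover have "(LINT s|M. u s * ?\<chi> s) = (LINT s|M. u s * \<phi> s + (- r \<phi>) * (u s * h0 s))"
      by (simp add: algebra_simps)
    moreover have "\<dots> = (LINT s|M. u s * \<phi> s) + (- r \<phi>) * (LINT s|M. u s * h0 s)"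
      using sq_int_mult_integrable[OF assms(2) test_sq_int(1)[OF t]] sq_int_mult_integrable[OF assms(2) test_sq_int(1)[OF h0(1)]] by simp
    moreover have "(- r \<phi>) * (LINT s|M. u s * h0 s) = (- c) * (LINT s|M. \<phi> s)" unfolding r_def c_def by simp
    moreover have "(LINT s|M. (u s + (- c)) * \<phi> s) = (LINT s|M. u s * \<phi> s + (- c) * \<phi> s)" by (simp add: algebra_simps)
    moreover have "\<dots> = (LINT s|M. u s * \<phi> s) + (- c) * (LINT s|M. \<phi> s)"
      using sq_int_mult_integrable[OF assms(2) test_sq_int(1)[OF t]] sq_int_integrable[OF test_sq_int(1)[OF t]] by simp
    ultimately show "(LINT s|M. (u s + (- c)) * \<phi> s) = 0" by simp
  qed
  then show ?thesis using that[of c] by simp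
qed

text \<open>The primitive that vanishes at \<open>a\<close>, written as an integral operator on
  [a,b] so that the kernel lemmas, Fubini in particular, apply to it.\<close>

definition prim :: "(real \<Rightarrow> real) \<Rightarrow> real \<Rightarrow> real" where
  "prim v s = (LINT t|M. (if t < s then 1 else 0) * v t)"

lemma prim_eq_set: "v \<in> sq_int \<Longrightarrow> s \<in> {a..b} \<Longrightarrow> prim v s = (LINT t:{a..s}|lebesgue. v t)"
  unfolding prim_def using set_integral_left[OF sq_intD] by simp

lemma prim_sq_int: "v \<in> sq_int \<Longrightarrow> prim v \<in> sq_int"
  unfolding prim_def[abs_def] by (rule kernel_sq_int[OF bdd2_less])

lemma prim_continuous:
  assumes "v \<in> sq_int" shows "continuous_on {a..b} (prim v)"
proof -
  have *: "continuous_on {a..b} (\<lambda>s. integral {a..s} v)"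
    by (rule indefinite_integral_continuous_1) (rule LINT_eq_integral(2)[OF assms order_refl])
  have "prim v s = integral {a..s} v" if "s \<in> {a..b}" for s
    using prim_eq_set[OF assms that] LINT_eq_integral(1)[OF assms, of a s] that by simp
  then show ?thesis by (intro continuous_on_eq[OF *]) simp
qed

text \<open>Integration by parts through Fubini: the inner integral of the derivative of
  \<open>\<phi>\<close> from t to b is -\<phi>(t), since \<open>\<phi>\<close> vanishes at
  \<open>b\<close>.\<close>

lemma swd_prim:
  assumes v: "v \<in> sq_int" shows "swd (prim v) v"
  unfolding swd_def
proof (intro allI impI)
  fix \<phi> assume test: "test_fun a b \<phi>"
  have "(LINT s|M. prim v s * deriv \<phi> s) = (LINT t|M. v t * (LINT s|M. (if t < s then 1 else 0) * deriv \<phi> s))"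
    unfolding prim_def by (rule kernel_Fubini[OF bdd2_less v test_sq_int(2)[OF test]])
  also have "\<dots> = (LINT t|M. - (v t * \<phi> t))"
  proof (rule LINT_cong[OF refl])
    fix t assume "t \<in> space M"
    then have t: "t \<in> {a..b}" by simp
    have "(LINT s|M. (if t < s then 1 else 0) * deriv \<phi> s) = integral {t..b} (deriv \<phi>)"
      using set_integral_right[OF sq_intD[OF test_sq_int(2)[OF test]] t] LINT_eq_integral(1)[OF test_sq_int(2)[OF test], of t b] t by simp
    also have "\<dots> = \<phi> b - \<phi> t"
      by (rule integral_unique, rule fundamental_theorem_of_calculus)
         (use t test_funD(3)[OF test] in \<open>auto simp: has_real_derivative_iff_has_vector_derivative[symmetric] intro: DERIV_subset\<close>)
    finally show "v t * (LINT s|M. (if t < s then 1 else 0) * deriv \<phi> s) = - (v t * \<phi> t)"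
      using test_funD(5)[OF test] by simp
  qed
  finally show "(LINT s|M. prim v s * deriv \<phi> s) = - (LINT s|M. v s * \<phi> s)" by simp
qed

text \<open>Subtracting the primitive of \<open>v\<close> leaves a function with weak derivative 0,
  which is almost everywhere constant.\<close>

lemma swd_representation:
  assumes "swd u v" "u \<in> sq_int" "v \<in> sq_int"
  obtains c where "AE s in M. u s = c + prim v s"
proof -
  have "swd (\<lambda>s. u s + (-1) * prim v s) (\<lambda>s. v s + (-1) * v s)"
    by (intro swd_lincomb swd_prim prim_sq_int assms)
  then have "swd (\<lambda>s. u s + (-1) * prim v s) (\<lambda>_. 0)" by simp
  then obtain c where "AE s in M. u s + (-1) * prim v s = c"
    by (rule swd_zero_const) (intro sq_int_add sq_int_cmult prim_sq_int assms)
  then have "AE s in M. u s = c + prim v s" by eventually_elim simp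
  then show ?thesis by (rule that)
qed

lemma continuous_AE_eq:
  assumes f: "continuous_on {a..b} f" and g: "continuous_on {a..b} g" and e: "AE s in M. f s = g s" and s: "s \<in> {a..b}"
  shows "f s = (g s :: real)"
proof -
  let ?h = "\<lambda>s. \<bar>f s - g s\<bar>"
  have h: "continuous_on {a..b} ?h" by (intro continuous_intros f g)
  have "(LINT s|M. ?h s) = (LINT s|M. 0)"
    by (rule integral_cong_AE) (use e h in \<open>auto intro: bdd1D continuous_bdd1\<close>)
  then have "integral {a..b} ?h = 0"
    using LINT_eq_integral(1)[OF bdd1_sq_int[OF continuous_bdd1[OF h]], of a b] by (simp add: set_integral_M)
  then have "?h s = 0" using integral_eq_0_iff[OF h] ab s by auto
  then show ?thesis by simp
qed

text \<open>Two continuous functions equal almost everywhere agree on all of [a,b], end points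
  included. So any continuous representative found by hand computes the one chosen by
  \<open>SOME\<close>.\<close>

lemma cont_rep_eq:
  assumes g: "continuous_on {a..b} g" and e: "AE s in M. f s = g s" and s: "s \<in> {a..b}"
  shows "cont_rep a b f s = g s"
proof -
  have "\<exists>g. continuous_on {a..b} g \<and> ae_eq a b f g" using g e unfolding ae_eq_def by blast
  from someI_ex[OF this, folded cont_rep_def]
  have c: "continuous_on {a..b} (cont_rep a b f)" "AE s in M. f s = cont_rep a b f s" unfolding ae_eq_def by auto
  from c(2) e have "AE s in M. cont_rep a b f s = g s" by eventually_elim simp
  then show ?thesis by (rule continuous_AE_eq[OF c(1) g _ s])
qed

text \<open>Cauchy's formula for the repeated integral: after Fubini the inner integral is the
  length of the interval from \<eta> to s. This is the origin of the entry s - \<theta> in the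
  kernel \<open>G1\<close>.\<close>

lemma prim_prim:
  assumes q: "q \<in> sq_int" and s: "s \<in> {a..b}"
  shows "prim (prim q) s = (LINT t:{a..s}|lebesgue. (s - t) * q t)"
proof -
  have less: "(\<lambda>t. if t < s then 1 else 0) \<in> sq_int" by (intro bdd1_sq_int bdd1_section[OF bdd2_less s])
  have "prim (prim q) s = (LINT t|M. (LINT \<eta>|M. (if \<eta> < t then 1 else 0) * q \<eta>) * (if t < s then 1 else 0))"
    unfolding prim_def by (simp add: mult.commute)
  also have "\<dots> = (LINT \<eta>|M. q \<eta> * (LINT t|M. (if \<eta> < t then 1 else 0) * (if t < s then 1 else 0)))"
    by (rule kernel_Fubini[OF bdd2_less q less])
  also have "\<dots> = (LINT \<eta>|M. (if \<eta> < s then 1 else 0) * ((s - \<eta>) * q \<eta>))"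
  proof (rule LINT_cong[OF refl])
    fix \<eta> assume "\<eta> \<in> space M"
    then have \<eta>: "\<eta> \<in> {a..b}" by simp
    have "(LINT t|M. (if \<eta> < t then 1 else 0) * ((if t < s then 1 else 0) * 1)) = (LINT u:{\<eta>..s}|lebesgue. (1::real))"
      by (rule set_integral_mid[of "\<lambda>_. 1", symmetric]) (use s \<eta> in auto)
    also have "\<dots> = integral {\<eta>..s} (\<lambda>_. 1)"
      using LINT_eq_integral(1)[OF sq_int_const, of \<eta> s 1] s \<eta> by auto
    also have "\<dots> = (if \<eta> < s then s - \<eta> else 0)" by simp
    finally show "q \<eta> * (LINT t|M. (if \<eta> < t then 1 else 0) * (if t < s then 1 else 0)) = (if \<eta> < s then 1 else 0) * ((s - \<eta>) * q \<eta>)"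
      by simp
  qed
  also have "\<dots> = (LINT t:{a..s}|lebesgue. (s - t) * q t)"
    by (rule set_integral_left[OF _ s, symmetric])
       (auto intro!: sq_intD[OF sq_int_bounded_mult[OF _ q]] continuous_bdd1 continuous_intros)
  finally show ?thesis .
qed

subsection \<open>Sobolev functions of one variable\<close>

lemma weak_deriv_exists:
  assumes "v \<in> L2 a b m" "has_weak_deriv a b m u v"
  shows "weak_deriv a b m u \<in> L2 a b m" "has_weak_deriv a b m u (weak_deriv a b m u)"
  using someI_ex[of "\<lambda>v. v \<in> L2 a b m \<and> has_weak_deriv a b m u v"] assms unfolding weak_deriv_def by blast+

lemma has_weak_deriv_unique:
  assumes "has_weak_deriv a b m u v" "has_weak_deriv a b m u v'" "u \<in> L2 a b m" "v \<in> L2 a b m" "v' \<in> L2 a b m"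
  shows "ae_eq a b v v'"
proof -
  have "AE s in M. \<forall>i\<in>{..<m}. v s $ i = v' s $ i"
    by (rule AE_finite_allI) (use assms in \<open>auto intro!: swd_unique[where u="\<lambda>s. u s $ _"] L2_comp simp: has_weak_deriv_iff\<close>)
  then show ?thesis unfolding ae_eq_def using AE_space
  proof eventually_elim
    case (elim s)
    then show ?case using L2_dim[OF assms(4), of s] L2_dim[OF assms(5), of s] by (auto intro!: eq_vecI)
  qed
qed

lemma has_weak_deriv_cong_AE:
  assumes "has_weak_deriv a b m u v" "ae_eq a b u u'" "u \<in> L2 a b m" "u' \<in> L2 a b m"
  shows "has_weak_deriv a b m u' v"
  using assms ae_eq_comp[OF assms(2)] unfolding has_weak_deriv_iff by (auto intro: swd_cong_AE[OF _ _ L2_comp L2_comp])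

lemma sobolev_1D:
  assumes "u \<in> sobolev 1 a b m"
  shows "u \<in> L2 a b m" "weak_deriv a b m u \<in> L2 a b m" "has_weak_deriv a b m u (weak_deriv a b m u)"
  using assms weak_deriv_exists by auto

text \<open>The derivative picked by \<open>weak_deriv\<close> may differ on a null set from the one
  that witnesses membership in the Sobolev space. By uniqueness they agree almost everywhere, so the
  second derivative of the witness is also one of the chosen version.\<close>

lemma sobolev_2D:
  assumes "u \<in> sobolev 2 a b m"
  defines "p \<equiv> weak_deriv a b m u"
  shows "u \<in> L2 a b m" "p \<in> L2 a b m" "has_weak_deriv a b m u p"
    "weak_deriv a b m p \<in> L2 a b m" "has_weak_deriv a b m p (weak_deriv a b m p)"
proof -
  obtain v w where u: "u \<in> L2 a b m" and v: "v \<in> L2 a b m" "has_weak_deriv a b m u v"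
    and w: "w \<in> L2 a b m" "has_weak_deriv a b m v w"
    using assms by (auto simp: numeral_2_eq_2)
  show "u \<in> L2 a b m" by fact
  show p: "p \<in> L2 a b m" "has_weak_deriv a b m u p"
    unfolding p_def using weak_deriv_exists[OF v] by auto
  have "ae_eq a b v p" by (rule has_weak_deriv_unique[OF v(2) p(2) u v(1) p(1)])
  then have "has_weak_deriv a b m p w" by (rule has_weak_deriv_cong_AE[OF w(2) _ v(1) p(1)])
  from weak_deriv_exists[OF w(1) this]
  show "weak_deriv a b m p \<in> L2 a b m" "has_weak_deriv a b m p (weak_deriv a b m p)" by auto
qed

end

subsection \<open>Block matrices\<close>

lemma append_cols_dims [simp]:
  "dim_row (A @\<^sub>c C) = dim_row A" "dim_col (A @\<^sub>c C) = dim_col A + dim_col C"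
  unfolding append_cols_def by auto

lemma append_rows_dims [simp]:
  "dim_row (A @\<^sub>r C) = dim_row A + dim_row C" "dim_col (A @\<^sub>r C) = dim_col A"
  unfolding append_rows_def by auto

lemma append_cols_index:
  "i < dim_row A \<Longrightarrow> j < dim_col A + dim_col C \<Longrightarrow>
    (A @\<^sub>c C) $$ (i, j) = (if j < dim_col A then A $$ (i, j) else C $$ (i, j - dim_col A))"
  unfolding append_cols_def by auto

lemma append_rows_index:
  assumes "i < dim_row A + dim_row C" "j < dim_col A"
  shows "(A @\<^sub>r C) $$ (i, j) = (if i < dim_row A then A $$ (i, j) else C $$ (i - dim_row A, j))"
  using assms unfolding append_rows_def by auto

lemma append_rows_mult_vec:
  assumes "dim_col A = dim_vec v" "dim_col C = dim_vec v"
  shows "(A @\<^sub>r C) *\<^sub>v v = (A *\<^sub>v v) @\<^sub>v (C *\<^sub>v v)"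
  by (rule mat_mult_append[of A "dim_row A" "dim_vec v" C "dim_row C"]) (use assms in auto)

lemma append_cols_mult_vec:
  assumes "dim_col A = dim_vec v" "dim_col C = dim_vec w" "dim_row A = dim_row C"
  shows "(A @\<^sub>c C) *\<^sub>v (v @\<^sub>v w) = A *\<^sub>v v + C *\<^sub>v w"
proof (rule eq_vecI)
  show "dim_vec ((A @\<^sub>c C) *\<^sub>v (v @\<^sub>v w)) = dim_vec (A *\<^sub>v v + C *\<^sub>v w)" using assms by simp
  fix i assume "i < dim_vec (A *\<^sub>v v + C *\<^sub>v w)"
  then have i: "i < dim_row A" "i < dim_row C" using assms by auto
  have "((A @\<^sub>c C) *\<^sub>v (v @\<^sub>v w)) $ i = (\<Sum>j<dim_vec v + dim_vec w. (A @\<^sub>c C) $$ (i, j) * (v @\<^sub>v w) $ j)"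
    using i by (simp add: scalar_prod_def atLeast0LessThan assms)
  also have "\<dots> = (\<Sum>j<dim_vec v. A $$ (i, j) * v $ j) + (\<Sum>j<dim_vec w. C $$ (i, j) * w $ j)"
    unfolding sum_lessThan_add using i by (simp add: append_cols_index assms)
  also have "\<dots> = (A *\<^sub>v v + C *\<^sub>v w) $ i"
    using i by (simp add: scalar_prod_def atLeast0LessThan assms)
  finally show "((A @\<^sub>c C) *\<^sub>v (v @\<^sub>v w)) $ i = (A *\<^sub>v v + C *\<^sub>v w) $ i" .
qed

lemma zero_mult_vec: "dim_vec v = c \<Longrightarrow> 0\<^sub>m r c *\<^sub>v v = (0\<^sub>v r :: real vec)"
  by (rule eq_vecI) (auto simp: scalar_prod_def)

lemma one_mult_vec: "dim_vec v = n \<Longrightarrow> 1\<^sub>m n *\<^sub>v v = (v :: real vec)"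
  by (rule one_mult_mat_vec) auto

lemma smult_mat_vec: "dim_vec v = dim_col A \<Longrightarrow> (k \<cdot>\<^sub>m A) *\<^sub>v v = k \<cdot>\<^sub>v (A *\<^sub>v (v :: real vec))"
  by (rule eq_vecI) (auto simp: scalar_prod_def sum_distrib_left mult.assoc)

lemma smult_one_mult_vec: "dim_vec v = n \<Longrightarrow> (k \<cdot>\<^sub>m 1\<^sub>m n) *\<^sub>v v = k \<cdot>\<^sub>v (v :: real vec)"
  using one_mult_vec[of v n] by (simp add: smult_mat_vec)

lemma mult_vec_assoc:
  "dim_col A = dim_row C \<Longrightarrow> dim_col C = dim_vec v \<Longrightarrow> (A * C) *\<^sub>v v = A *\<^sub>v (C *\<^sub>v (v :: real vec))"
  by (rule assoc_mult_mat_vec) auto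

lemma add_mult_vec:
  "dim_row A = dim_row C \<Longrightarrow> dim_col A = dim_vec v \<Longrightarrow> dim_col C = dim_vec v \<Longrightarrow>
    (A + C) *\<^sub>v v = A *\<^sub>v v + C *\<^sub>v (v :: real vec)"
  by (rule add_mult_distrib_mat_vec[of A "dim_row A" "dim_vec v"]) auto

lemma mult_vec_add:
  "dim_vec v = dim_col A \<Longrightarrow> dim_vec w = dim_col A \<Longrightarrow> A *\<^sub>v (v + w) = A *\<^sub>v v + A *\<^sub>v (w :: real vec)"
  by (rule mult_add_distrib_mat_vec[of A "dim_row A" "dim_col A"]) (auto intro: carrier_vecI)

lemma mult_vec_smult: "dim_vec v = dim_col A \<Longrightarrow> A *\<^sub>v (k \<cdot>\<^sub>v v) = k \<cdot>\<^sub>v (A *\<^sub>v (v :: real vec))"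
  by (rule mult_mat_vec[of A "dim_row A" "dim_col A"]) (auto intro: carrier_vecI)

lemma append_vec_add': "dim_vec v = dim_vec v' \<Longrightarrow> dim_vec w = dim_vec w' \<Longrightarrow>
    (v @\<^sub>v w) + (v' @\<^sub>v w') = (v + v') @\<^sub>v (w + w' :: real vec)"
  by (rule append_vec_add[of v "dim_vec v" v' w "dim_vec w"]) (auto intro: carrier_vecI)

lemma add_zero_vec: "dim_vec v = n \<Longrightarrow> v + 0\<^sub>v n = (v :: real vec)" "dim_vec v = n \<Longrightarrow> 0\<^sub>v n + v = (v :: real vec)"
  by auto

lemmas block_simps = append_rows_mult_vec append_cols_mult_vec zero_mult_vec one_mult_vec smult_one_mult_vec
  append_vec_add' add_zero_vec

context interval begin

subsection \<open>Bounded matrix kernels\<close>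

lemma matb_const: "A \<in> carrier_mat r c \<Longrightarrow> matb r c (\<lambda>_ _. A)"
  unfolding matb_def by auto

lemma matbI:
  assumes "\<And>s t. s \<in> {a..b} \<Longrightarrow> t \<in> {a..b} \<Longrightarrow> N s t \<in> carrier_mat r c"
    and e: "\<And>i j s t. i < r \<Longrightarrow> j < c \<Longrightarrow> s \<in> {a..b} \<Longrightarrow> t \<in> {a..b} \<Longrightarrow> N s t $$ (i, j) = k i j s t"
    and k: "\<And>i j. i < r \<Longrightarrow> j < c \<Longrightarrow> bdd2 (k i j)"
  shows "matb r c N"
  unfolding matb_def using assms(1) bdd2_cong[OF e] k by simp

lemma matb_mult:
  assumes N: "matb r m N" and K: "matb m c K" shows "matb r c (\<lambda>s t. N s t * K s t)"
proof (rule matbI[where k="\<lambda>i j s t. \<Sum>l<m. N s t $$ (i, l) * K s t $$ (l, j)"])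
  fix s t assume "s \<in> {a..b}" "t \<in> {a..b}"
  note c = matbD(1)[OF N this] matbD(1)[OF K this]
  show "N s t * K s t \<in> carrier_mat r c" using c by simp
  show "(N s t * K s t) $$ (i, j) = (\<Sum>l<m. N s t $$ (i, l) * K s t $$ (l, j))" if "i < r" "j < c" for i j
    using c that by (simp add: scalar_prod_def atLeast0LessThan)
qed (intro bdd2_sum bdd2_mult matbD(2)[OF N] matbD(2)[OF K]; simp)

lemma matb_add:
  assumes N: "matb r c N" and K: "matb r c K" shows "matb r c (\<lambda>s t. N s t + K s t)"
proof (rule matbI[where k="\<lambda>i j s t. N s t $$ (i, j) + K s t $$ (i, j)"])
  fix s t assume "s \<in> {a..b}" "t \<in> {a..b}"
  note c = matbD(1)[OF N this] matbD(1)[OF K this]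
  show "N s t + K s t \<in> carrier_mat r c" using c by simp
  show "(N s t + K s t) $$ (i, j) = N s t $$ (i, j) + K s t $$ (i, j)" if "i < r" "j < c" for i j
    using c that by simp
qed (intro bdd2_add matbD(2)[OF N] matbD(2)[OF K])

lemma matb_smult:
  assumes f: "bdd2 f" and N: "matb r c N" shows "matb r c (\<lambda>s t. f s t \<cdot>\<^sub>m N s t)"
proof (rule matbI[where k="\<lambda>i j s t. f s t * N s t $$ (i, j)"])
  fix s t assume "s \<in> {a..b}" "t \<in> {a..b}"
  note c = matbD(1)[OF N this]
  show "f s t \<cdot>\<^sub>m N s t \<in> carrier_mat r c" using c by simp
  show "(f s t \<cdot>\<^sub>m N s t) $$ (i, j) = f s t * N s t $$ (i, j)" if "i < r" "j < c" for i j
    using c that by simp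
qed (intro bdd2_mult f matbD(2)[OF N])

lemma matb_uminus:
  assumes N: "matb r c N" shows "matb r c (\<lambda>s t. - N s t)"
proof (rule matbI[where k="\<lambda>i j s t. - N s t $$ (i, j)"])
  fix s t assume "s \<in> {a..b}" "t \<in> {a..b}"
  note c = matbD(1)[OF N this]
  show "- N s t \<in> carrier_mat r c" using c by simp
  show "(- N s t) $$ (i, j) = - N s t $$ (i, j)" if "i < r" "j < c" for i j
    using c that by simp
qed (intro bdd2_uminus matbD(2)[OF N])

lemma matb_append_cols:
  assumes N: "matb r c N" and K: "matb r c' K" shows "matb r (c + c') (\<lambda>s t. N s t @\<^sub>c K s t)"
proof (rule matbI[where k="\<lambda>i j s t. if j < c then N s t $$ (i, j) else K s t $$ (i, j - c)"])
  fix s t assume "s \<in> {a..b}" "t \<in> {a..b}"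
  note d = matbD(1)[OF N this] matbD(1)[OF K this]
  show "N s t @\<^sub>c K s t \<in> carrier_mat r (c + c')" using d by (auto intro!: carrier_matI)
  show "(N s t @\<^sub>c K s t) $$ (i, j) = (if j < c then N s t $$ (i, j) else K s t $$ (i, j - c))"
    if "i < r" "j < c + c'" for i j
    using d that by (subst append_cols_index) auto
next
  fix i j assume "i < r" "j < c + c'"
  then show "bdd2 (\<lambda>s t. if j < c then N s t $$ (i, j) else K s t $$ (i, j - c))"
    using matbD(2)[OF N, of i j] matbD(2)[OF K, of i "j - c"] by (cases "j < c") auto
qed

lemma matb_append_rows:
  assumes N: "matb r c N" and K: "matb r' c K" shows "matb (r + r') c (\<lambda>s t. N s t @\<^sub>r K s t)"
proof (rule matbI[where k="\<lambda>i j s t. if i < r then N s t $$ (i, j) else K s t $$ (i - r, j)"])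
  fix s t assume "s \<in> {a..b}" "t \<in> {a..b}"
  note d = matbD(1)[OF N this] matbD(1)[OF K this]
  show "N s t @\<^sub>r K s t \<in> carrier_mat (r + r') c" using d by (auto intro!: carrier_matI)
  show "(N s t @\<^sub>r K s t) $$ (i, j) = (if i < r then N s t $$ (i, j) else K s t $$ (i - r, j))"
    if "i < r + r'" "j < c" for i j
    using d that by (subst append_rows_index) auto
next
  fix i j assume "i < r + r'" "j < c"
  then show "bdd2 (\<lambda>s t. if i < r then N s t $$ (i, j) else K s t $$ (i - r, j))"
    using matbD(2)[OF N, of i j] matbD(2)[OF K, of "i - r" j] by (cases "i < r") auto
qed

lemma matb_bounded_measurable:
  assumes "bounded_measurable_mat a b r c A" shows "matb r c (\<lambda>s _. A s)"
  using assms unfolding matb_def bounded_measurable_mat_def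
  by (auto simp: bdd_def bdd1_iff_bdd2[symmetric])

lemma matb_poly1:
  assumes "poly_mat1 a b r c A" shows "matb r c (\<lambda>s _. A s)"
  unfolding matb_def
proof (intro conjI ballI allI impI)
  show "A s \<in> carrier_mat r c" if "s \<in> {a..b}" for s using assms that unfolding poly_mat1_def by auto
  fix i j assume "i < r" "j < c"
  then obtain p where "\<And>s. s \<in> {a..b} \<Longrightarrow> A s $$ (i, j) = poly p s" using assms unfolding poly_mat1_def by blast
  then show "bdd2 (\<lambda>s t. A s $$ (i, j))"
    using bdd_cong[of M "\<lambda>s. A s $$ (i, j)" "poly p"] continuous_bdd1[of "poly p"]
    by (simp add: bdd1_iff_bdd2[symmetric] continuous_intros)
qed

lemma matb_poly2:
  assumes "poly_mat2 a b r c A" shows "matb r c A"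
  unfolding matb_def
proof (intro conjI ballI allI impI)
  show "A s t \<in> carrier_mat r c" if "s \<in> {a..b}" "t \<in> {a..b}" for s t
    using assms that unfolding poly_mat2_def by auto
  fix i j assume "i < r" "j < c"
  then obtain m \<alpha> where "\<And>s t. s \<in> {a..b} \<Longrightarrow> t \<in> {a..b} \<Longrightarrow>
      A s t $$ (i, j) = (\<Sum>k\<le>(m::nat). \<Sum>l\<le>m. \<alpha> k l * s^k * t^l)"
    using assms unfolding poly_mat2_def by blast
  then have "bdd2 (\<lambda>s t. A s t $$ (i, j)) = bdd2 (\<lambda>s t. \<Sum>k\<le>m. \<Sum>l\<le>m. \<alpha> k l * s^k * t^l)" by (rule bdd2_cong)
  also have "\<dots>" by (intro bdd2_sum bdd2_mult bdd2_const bdd2_power bdd2_fst[OF bdd1_id] bdd2_snd[OF bdd1_id])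
  finally show "bdd2 (\<lambda>s t. A s t $$ (i, j))" .
qed

lemma matb_mult_vec_L2:
  assumes N: "matb r c N" and x: "x \<in> L2 a b c" and s: "s \<in> {a..b}"
  shows "(\<lambda>t. N s t *\<^sub>v x t) \<in> L2 a b r"
proof (rule L2I[where f="\<lambda>i t. \<Sum>j<c. N s t $$ (i, j) * x t $ j"])
  show "N s t *\<^sub>v x t \<in> carrier_vec r" if "t \<in> {a..b}" for t
    using matbD(1)[OF N s that] by (auto intro!: carrier_vecI)
  show "(N s t *\<^sub>v x t) $ i = (\<Sum>j<c. N s t $$ (i, j) * x t $ j)" if "i < r" "t \<in> {a..b}" for i t
    by (rule mult_mat_vec_index[OF matbD(1)[OF N s that(2)] L2_carrier[OF x that(2)] that(1)])
  show "(\<lambda>t. \<Sum>j<c. N s t $$ (i, j) * x t $ j) \<in> sq_int" if "i < r" for i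
    by (intro sq_int_sum sq_int_bounded_mult bdd1_section[OF matbD(2)[OF N that] s] L2_comp[OF x]) auto
qed

subsection \<open>Integrals of vector-valued functions\<close>

lemma L2_set_integrable:
  assumes "x \<in> L2 a b m" "i < m" "{p..q} \<subseteq> {a..b}"
  shows "set_integrable lebesgue {p..q} (\<lambda>t. x t $ i)"
proof -
  have "set_integrable lebesgue {a..b} (\<lambda>t. x t $ i)"
    using sq_int_integrable[OF L2_comp[OF assms(1,2)]] unfolding set_integrable_def
    by (subst (asm) integrable_restrict_space) auto
  then show ?thesis by (rule set_integrable_subset) (use assms in auto)
qed

lemma dim_vec_integral [simp]: "dim_vec (vec_integral m S f) = m" unfolding vec_integral_def by simp

lemma vec_integral_cong:
  assumes "\<And>t. t \<in> {p..q} \<Longrightarrow> f t = g t" shows "vec_integral m {p..q} f = vec_integral m {p..q} g"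
  unfolding vec_integral_def
  by (intro arg_cong[where f="vec m"] ext set_lebesgue_integral_cong) (use assms in auto)

lemma vec_integral_add:
  assumes "x \<in> L2 a b m" "y \<in> L2 a b m" "{p..q} \<subseteq> {a..b}"
  shows "vec_integral m {p..q} (\<lambda>t. x t + y t) = vec_integral m {p..q} x + vec_integral m {p..q} y"
proof (rule eq_vecI)
  fix i assume "i < dim_vec (vec_integral m {p..q} x + vec_integral m {p..q} y)"
  then have i: "i < m" by simp
  have "(LINT t:{p..q}|lebesgue. (x t + y t) $ i) = (LINT t:{p..q}|lebesgue. x t $ i + y t $ i)"
    by (rule set_lebesgue_integral_cong) (use i assms(3) L2_dim[OF assms(2)] in auto)
  also have "\<dots> = (LINT t:{p..q}|lebesgue. x t $ i) + (LINT t:{p..q}|lebesgue. y t $ i)"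
    by (intro set_integral_add L2_set_integrable[OF assms(1) i assms(3)] L2_set_integrable[OF assms(2) i assms(3)])
  finally show "vec_integral m {p..q} (\<lambda>t. x t + y t) $ i = (vec_integral m {p..q} x + vec_integral m {p..q} y) $ i"
    using i unfolding vec_integral_def by simp
qed simp

lemma vec_integral_mult:
  assumes A: "A \<in> carrier_mat r m" and x: "x \<in> L2 a b m" and pq: "{p..q} \<subseteq> {a..b}"
  shows "vec_integral r {p..q} (\<lambda>t. A *\<^sub>v x t) = A *\<^sub>v vec_integral m {p..q} x"
proof (rule eq_vecI)
  show "dim_vec (vec_integral r {p..q} (\<lambda>t. A *\<^sub>v x t)) = dim_vec (A *\<^sub>v vec_integral m {p..q} x)" using A by simp
  fix i assume "i < dim_vec (A *\<^sub>v vec_integral m {p..q} x)"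
  then have i: "i < r" using A by simp
  have "(LINT t:{p..q}|lebesgue. (A *\<^sub>v x t) $ i) = (LINT t:{p..q}|lebesgue. (\<Sum>j<m. A $$ (i, j) * x t $ j))"
    by (rule set_lebesgue_integral_cong) (use pq in \<open>auto simp: mult_mat_vec_index[OF A L2_carrier[OF x] i]\<close>)
  also have "\<dots> = (\<Sum>j<m. LINT t:{p..q}|lebesgue. A $$ (i, j) * x t $ j)"
  proof -
    have "set_integrable lebesgue {p..q} (\<lambda>t. A $$ (i, j) * x t $ j)" if "j < m" for j
      by (intro set_integrable_mult_right L2_set_integrable[OF x that pq])
    then show ?thesis
      unfolding set_lebesgue_integral_def scaleR_sum_right set_integrable_def
      by (intro LINT_sum) auto
  qed
  also have "\<dots> = (\<Sum>j<m. A $$ (i, j) * vec_integral m {p..q} x $ j)"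
    unfolding vec_integral_def by simp
  also have "\<dots> = (A *\<^sub>v vec_integral m {p..q} x) $ i"
    by (rule mult_mat_vec_index[OF A _ i, symmetric]) (auto intro: carrier_vecI)
  finally show "vec_integral r {p..q} (\<lambda>t. A *\<^sub>v x t) $ i = (A *\<^sub>v vec_integral m {p..q} x) $ i"
    using i unfolding vec_integral_def by simp
qed

lemma vec_integral_combine:
  assumes x: "x \<in> L2 a b m" and s: "s \<in> {a..b}"
  shows "vec_integral m {a..s} x + vec_integral m {s..b} x = vec_integral m {a..b} x"
proof (rule eq_vecI)
  fix i assume "i < dim_vec (vec_integral m {a..b} x)"
  then have i: "i < m" by simp
  note sq = L2_comp[OF x i]
  have "(LINT t:{a..s}|lebesgue. x t $ i) + (LINT t:{s..b}|lebesgue. x t $ i) = (LINT t:{a..b}|lebesgue. x t $ i)"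
    using s LINT_eq_integral[OF sq, of a s] LINT_eq_integral[OF sq, of s b] LINT_eq_integral[OF sq, of a b]
    by (simp add: Henstock_Kurzweil_Integration.integral_combine)
  then show "(vec_integral m {a..s} x + vec_integral m {s..b} x) $ i = vec_integral m {a..b} x $ i"
    using i unfolding vec_integral_def by simp
qed simp

lemma vec_integral_append:
  assumes "\<And>t. t \<in> {p..q} \<Longrightarrow> dim_vec (f t) = m" "\<And>t. t \<in> {p..q} \<Longrightarrow> dim_vec (g t) = k"
  shows "vec_integral (m + k) {p..q} (\<lambda>t. f t @\<^sub>v g t) = vec_integral m {p..q} f @\<^sub>v vec_integral k {p..q} g"
proof (rule eq_vecI)
  fix i assume "i < dim_vec (vec_integral m {p..q} f @\<^sub>v vec_integral k {p..q} g)"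
  then have i: "i < m + k" by simp
  have "(LINT t:{p..q}|lebesgue. (f t @\<^sub>v g t) $ i) =
     (LINT t:{p..q}|lebesgue. if i < m then f t $ i else g t $ (i - m))"
    by (rule set_lebesgue_integral_cong) (use i assms in auto)
  then show "vec_integral (m + k) {p..q} (\<lambda>t. f t @\<^sub>v g t) $ i = (vec_integral m {p..q} f @\<^sub>v vec_integral k {p..q} g) $ i"
    using i unfolding vec_integral_def by auto
qed simp

lemma vec_integral_zero [simp]: "vec_integral m S (\<lambda>_. 0\<^sub>v m) = 0\<^sub>v m"
  unfolding vec_integral_def by (auto simp: set_lebesgue_integral_def)

text \<open>The two kernels share the summand L(s) Q(t), whose integrals over [a,s] and [s,b] join
  into one constant vector. What remains is a Volterra operator plus a term of finite rank, which
  carries the boundary conditions.\<close>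

lemma PI_op_split:
  assumes N': "matb r c N'" and Q: "matb k c (\<lambda>_. Q)" and L: "\<And>s. s \<in> {a..b} \<Longrightarrow> L s \<in> carrier_mat r k"
    and N0: "\<And>s. s \<in> {a..b} \<Longrightarrow> N0 s \<in> carrier_mat r c"
    and x: "x \<in> L2 a b c" and s: "s \<in> {a..b}"
  shows "PI_op a b r N0 (\<lambda>s t. N' s t + L s * Q t) (\<lambda>s t. L s * Q t) x s =
    N0 s *\<^sub>v x s + vec_integral r {a..s} (\<lambda>t. N' s t *\<^sub>v x t) + L s *\<^sub>v vec_integral k {a..b} (\<lambda>t. Q t *\<^sub>v x t)"
proof -
  have sub: "{a..s} \<subseteq> {a..b}" "{s..b} \<subseteq> {a..b}" using s by auto
  note NL = matb_mult_vec_L2[OF N' x s] and QL = matb_mult_vec_L2[OF Q x s]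
  have LQL: "(\<lambda>t. L s *\<^sub>v (Q t *\<^sub>v x t)) \<in> L2 a b r"
    using matb_mult_vec_L2[OF matb_const[OF L[OF s]] QL s] .
  have mv: "(L s * Q t) *\<^sub>v x t = L s *\<^sub>v (Q t *\<^sub>v x t)" if "t \<in> {a..b}" for t
    using L[OF s] matbD(1)[OF Q s that] L2_dim[OF x that] by (intro mult_vec_assoc) auto
  have mv2: "(N' s t + L s * Q t) *\<^sub>v x t = N' s t *\<^sub>v x t + L s *\<^sub>v (Q t *\<^sub>v x t)" if "t \<in> {a..b}" for t
    unfolding mv[OF that, symmetric]
    using L[OF s] matbD(1)[OF Q s that] matbD(1)[OF N' s that] L2_dim[OF x that] by (intro add_mult_vec) auto
  let ?q1 = "vec_integral k {a..s} (\<lambda>t. Q t *\<^sub>v x t)" and ?q2 = "vec_integral k {s..b} (\<lambda>t. Q t *\<^sub>v x t)"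
  have "vec_integral r {a..s} (\<lambda>t. (N' s t + L s * Q t) *\<^sub>v x t) =
     vec_integral r {a..s} (\<lambda>t. N' s t *\<^sub>v x t + L s *\<^sub>v (Q t *\<^sub>v x t))"
    by (rule vec_integral_cong) (use mv2 sub in auto)
  also have "\<dots> = vec_integral r {a..s} (\<lambda>t. N' s t *\<^sub>v x t) + L s *\<^sub>v ?q1"
    unfolding vec_integral_add[OF NL LQL sub(1)] vec_integral_mult[OF L[OF s] QL sub(1)] ..
  finally have 1: "vec_integral r {a..s} (\<lambda>t. (N' s t + L s * Q t) *\<^sub>v x t) =
     vec_integral r {a..s} (\<lambda>t. N' s t *\<^sub>v x t) + L s *\<^sub>v ?q1" .
  have 2: "vec_integral r {s..b} (\<lambda>t. (L s * Q t) *\<^sub>v x t) = L s *\<^sub>v ?q2"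
    unfolding vec_integral_mult[OF L[OF s] QL sub(2), symmetric]
    by (rule vec_integral_cong) (use mv sub in auto)
  have "L s *\<^sub>v vec_integral k {a..b} (\<lambda>t. Q t *\<^sub>v x t) = L s *\<^sub>v ?q1 + L s *\<^sub>v ?q2"
    unfolding vec_integral_combine[OF QL s, symmetric] using L[OF s] by (intro mult_vec_add) auto
  then show ?thesis unfolding PI_op_def 1 2
    using N0[OF s] L[OF s] by (intro eq_vecI) auto
qed

subsection \<open>Representation of Sobolev functions by their highest derivative\<close>

lemma ae_eq_vecI:
  assumes "\<And>i. i < m \<Longrightarrow> AE s in M. x s $ i = y s $ i"
    "\<And>s. s \<in> {a..b} \<Longrightarrow> dim_vec (x s) = m" "\<And>s. s \<in> {a..b} \<Longrightarrow> dim_vec (y s) = m"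
  shows "ae_eq a b x y"
proof -
  have "AE s in M. \<forall>i\<in>{..<m}. x s $ i = y s $ i" by (rule AE_finite_allI) (use assms in auto)
  then show ?thesis unfolding ae_eq_def using AE_space
    by eventually_elim (auto intro!: eq_vecI simp: assms)
qed

lemma prim_a: "prim v a = 0"
proof -
  have "prim v a = (LINT t|M. 0)"
    unfolding prim_def by (rule LINT_cong) auto
  then show ?thesis by simp
qed

text \<open>A constant plus the primitive of \<open>v\<close> is a continuous representative of the
  component, and the primitive vanishes at \<open>a\<close>; so the constant is the point value
  there.\<close>

lemma weak_deriv_representation:
  assumes u: "u \<in> L2 a b m" and v: "v \<in> L2 a b m" and d: "has_weak_deriv a b m u v" and i: "i < m"
  shows "AE s in M. u s $ i = point_value a b m u a $ i + prim (\<lambda>s. v s $ i) s"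
    and "point_value a b m u b $ i = point_value a b m u a $ i + prim (\<lambda>s. v s $ i) b"
proof -
  obtain c where c: "AE s in M. u s $ i = c + prim (\<lambda>s. v s $ i) s"
    using swd_representation[of "\<lambda>s. u s $ i" "\<lambda>s. v s $ i"] d i L2_comp[OF u i] L2_comp[OF v i]
    unfolding has_weak_deriv_iff by blast
  have "continuous_on {a..b} (\<lambda>s. c + prim (\<lambda>s. v s $ i) s)"
    by (intro continuous_intros prim_continuous L2_comp[OF v i])
  note r = cont_rep_eq[OF this c]
  have "point_value a b m u a $ i = c" "point_value a b m u b $ i = c + prim (\<lambda>s. v s $ i) b"
    unfolding point_value_def using i ab r[of a] r[of b] prim_a by auto
  then show "AE s in M. u s $ i = point_value a b m u a $ i + prim (\<lambda>s. v s $ i) s"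
    "point_value a b m u b $ i = point_value a b m u a $ i + prim (\<lambda>s. v s $ i) b" using c by auto
qed

lemma prim_vec_integral: "v \<in> L2 a b m \<Longrightarrow> i < m \<Longrightarrow> s \<in> {a..b} \<Longrightarrow> prim (\<lambda>s. v s $ i) s = vec_integral m {a..s} v $ i"
  unfolding vec_integral_def by (simp add: prim_eq_set[OF L2_comp])

lemma dim_point_value [simp]: "dim_vec (point_value a b m u s) = m" unfolding point_value_def by simp

lemma first_order_representation:
  assumes u: "u \<in> L2 a b m" and v: "v \<in> L2 a b m" and d: "has_weak_deriv a b m u v"
  shows "ae_eq a b u (\<lambda>s. point_value a b m u a + vec_integral m {a..s} v)"
    and "point_value a b m u b = point_value a b m u a + vec_integral m {a..b} v"
proof -
  show "ae_eq a b u (\<lambda>s. point_value a b m u a + vec_integral m {a..s} v)"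
  proof (rule ae_eq_vecI)
    fix i assume i: "i < m"
    show "AE s in M. u s $ i = (point_value a b m u a + vec_integral m {a..s} v) $ i"
      using weak_deriv_representation(1)[OF u v d i] AE_space
      by eventually_elim (use i v in \<open>simp add: prim_vec_integral\<close>)
  qed (use L2_dim[OF u] in auto)
  show "point_value a b m u b = point_value a b m u a + vec_integral m {a..b} v"
    using weak_deriv_representation(2)[OF u v d] ab v by (intro eq_vecI) (auto simp: prim_vec_integral)
qed

lemma prim_const: "s \<in> {a..b} \<Longrightarrow> prim (\<lambda>_. e) s = e * (s - a)"
  by (simp add: prim_eq_set LINT_eq_integral)

text \<open>Taylor's formula with integral remainder. The first order formula is used for
  \<open>u\<close> and for \<open>p\<close>; inserting the second into the primitive of
  \<open>p\<close> leaves an affine term and a repeated primitive of \<open>q\<close>.\<close>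

lemma second_order_representation:
  assumes u: "u \<in> L2 a b m" and p: "p \<in> L2 a b m" and d: "has_weak_deriv a b m u p"
    and q: "q \<in> L2 a b m" and d': "has_weak_deriv a b m p q"
  shows "ae_eq a b u (\<lambda>s. point_value a b m u a + (s - a) \<cdot>\<^sub>v point_value a b m p a
      + vec_integral m {a..s} (\<lambda>t. (s - t) \<cdot>\<^sub>v q t))"
    and "point_value a b m u b = point_value a b m u a + (b - a) \<cdot>\<^sub>v point_value a b m p a
      + vec_integral m {a..b} (\<lambda>t. (b - t) \<cdot>\<^sub>v q t)"
proof -
  have pp: "prim (\<lambda>s. p s $ i) s = (s - a) * point_value a b m p a $ i
      + vec_integral m {a..s} (\<lambda>t. (s - t) \<cdot>\<^sub>v q t) $ i" if i: "i < m" and s: "s \<in> {a..b}" for i s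
  proof -
    let ?e = "point_value a b m p a $ i"
    note qi = L2_comp[OF q i] and less = bdd1_section[OF bdd2_less s]
    note prq = prim_sq_int[OF qi]
    have "prim (\<lambda>s. p s $ i) s = (LINT t|M. (if t < s then 1 else 0) * ?e + (if t < s then 1 else 0) * prim (\<lambda>s. q s $ i) t)"
      unfolding prim_def[of "\<lambda>s. p s $ i"]
    proof (rule integral_cong_AE)
      show "AE t in M. (if t < s then 1 else 0) * p t $ i = (if t < s then 1 else 0) * ?e + (if t < s then 1 else 0) * prim (\<lambda>s. q s $ i) t"
        using weak_deriv_representation(1)[OF p q d' i] by eventually_elim (auto simp: algebra_simps)
    qed (intro borel_measurable_times borel_measurable_add bdd1D[OF less] sq_intD[OF L2_comp[OF p i]] sq_intD[OF prq] borel_measurable_const)+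
    also have "\<dots> = prim (\<lambda>_. ?e) s + prim (prim (\<lambda>s. q s $ i)) s"
      unfolding prim_def[of "\<lambda>_. ?e"] prim_def[of "prim (\<lambda>s. q s $ i)"]
      by (intro LINT_add sq_int_integrable sq_int_bounded_mult less prq sq_int_const)
    also have "prim (prim (\<lambda>s. q s $ i)) s = vec_integral m {a..s} (\<lambda>t. (s - t) \<cdot>\<^sub>v q t) $ i"
    proof -
      have "(LINT t:{a..s}|lebesgue. (s - t) * q t $ i) = (LINT t:{a..s}|lebesgue. ((s - t) \<cdot>\<^sub>v q t) $ i)"
        by (rule set_lebesgue_integral_cong) (use i s L2_dim[OF q] in auto)
      then show ?thesis unfolding prim_prim[OF qi s] vec_integral_def using i by simp
    qed
    finally show ?thesis using prim_const[OF s] by (simp add: mult.commute)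
  qed
  show "ae_eq a b u (\<lambda>s. point_value a b m u a + (s - a) \<cdot>\<^sub>v point_value a b m p a
      + vec_integral m {a..s} (\<lambda>t. (s - t) \<cdot>\<^sub>v q t))"
  proof (rule ae_eq_vecI)
    fix i assume i: "i < m"
    show "AE s in M. u s $ i = (point_value a b m u a + (s - a) \<cdot>\<^sub>v point_value a b m p a
      + vec_integral m {a..s} (\<lambda>t. (s - t) \<cdot>\<^sub>v q t)) $ i"
      using weak_deriv_representation(1)[OF u p d i] AE_space
      by eventually_elim (use i in \<open>simp add: pp\<close>)
  qed (use L2_dim[OF u] in auto)
  show "point_value a b m u b = point_value a b m u a + (b - a) \<cdot>\<^sub>v point_value a b m p a
      + vec_integral m {a..b} (\<lambda>t. (b - t) \<cdot>\<^sub>v q t)"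
    using weak_deriv_representation(2)[OF u p d] ab by (intro eq_vecI) (auto simp: pp)
qed

lemma vec_integral_appendI:
  assumes "\<And>t. t \<in> {p..q} \<Longrightarrow> dim_vec (f t) = m" "\<And>t. t \<in> {p..q} \<Longrightarrow> dim_vec (g t) = k"
    "vec_integral m {p..q} f = F" "vec_integral k {p..q} g = G"
  shows "vec_integral (m + k) {p..q} (\<lambda>t. f t @\<^sub>v g t) = F @\<^sub>v G"
  using vec_integral_append[of p q f m g k] assms by simp

end

section \<open>The state space of the equation and its fundamental state\<close>

locale pde_space = interval a b for a b :: real +
  fixes n0 n1 n2 :: nat and B :: "real mat"
  assumes B_dim: "B \<in> carrier_mat (n1 + 2 * n2) (2 * n1 + 4 * n2)"
    and BT_inv: "invertible_mat (B * T_mat a b n1 n2)"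
begin

abbreviation n :: nat where "n \<equiv> n0 + n1 + n2"

text \<open>Membership in X without the boundary conditions. This suffices for the fundamental state
  to make sense and is closed under linear combinations without any statement about boundary
  values.\<close>

definition regular :: "(real \<Rightarrow> real vec) \<Rightarrow> bool" where
  "regular x \<longleftrightarrow> (\<forall>s\<in>{a..b}. x s \<in> carrier_vec n) \<and> part 0 n0 x \<in> L2 a b n0 \<and>
     part n0 n1 x \<in> sobolev 1 a b n1 \<and> part (n0 + n1) n2 x \<in> sobolev 2 a b n2"

definition d1 :: "(real \<Rightarrow> real vec) \<Rightarrow> real \<Rightarrow> real vec" where
  "d1 x = weak_deriv a b n1 (part n0 n1 x)"
definition d2 :: "(real \<Rightarrow> real vec) \<Rightarrow> real \<Rightarrow> real vec" where
  "d2 x = weak_deriv a b n2 (part (n0 + n1) n2 x)"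
definition d22 :: "(real \<Rightarrow> real vec) \<Rightarrow> real \<Rightarrow> real vec" where
  "d22 x = weak_deriv a b n2 (d2 x)"

text \<open>The fundamental state \<open>(x\<^sub>0, \<partial>x\<^sub>1, \<partial>\<^sup>2x\<^sub>2)\<close> of \<open>x\<close>, on which \<open>T\<close> and \<open>A\<close> act.\<close>

definition fund :: "(real \<Rightarrow> real vec) \<Rightarrow> real \<Rightarrow> real vec" where
  "fund x s = part 0 n0 x s @\<^sub>v d1 x s @\<^sub>v d22 x s"

lemma dim_part [simp]: "dim_vec (part k m x s) = m" unfolding part_def by simp

lemma regularD:
  assumes "regular x"
  shows "part 0 n0 x \<in> L2 a b n0"
    "part n0 n1 x \<in> L2 a b n1" "d1 x \<in> L2 a b n1" "has_weak_deriv a b n1 (part n0 n1 x) (d1 x)"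
    "part (n0 + n1) n2 x \<in> L2 a b n2" "d2 x \<in> L2 a b n2" "has_weak_deriv a b n2 (part (n0 + n1) n2 x) (d2 x)"
    "d22 x \<in> L2 a b n2" "has_weak_deriv a b n2 (d2 x) (d22 x)"
  using assms sobolev_1D[of "part n0 n1 x" n1] sobolev_2D[of "part (n0 + n1) n2 x" n2]
  unfolding regular_def d1_def d2_def d22_def by auto

lemma L2_append:
  assumes f: "f \<in> L2 a b m" and g: "g \<in> L2 a b k" shows "(\<lambda>s. f s @\<^sub>v g s) \<in> L2 a b (m + k)"
proof (rule L2I[where f="\<lambda>i s. if i < m then f s $ i else g s $ (i - m)"])
  show "(\<lambda>s. if i < m then f s $ i else g s $ (i - m)) \<in> sq_int" if "i < m + k" for i
    using L2_comp[OF f, of i] L2_comp[OF g, of "i - m"] that by (cases "i < m") auto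
qed (use L2_carrier[OF f] L2_carrier[OF g] in \<open>auto simp: L2_dim[OF f] L2_dim[OF g]\<close>)

lemma fund_L2: assumes "regular x" shows "fund x \<in> L2 a b n"
  using L2_append[OF regularD(1)[OF assms] L2_append[OF regularD(3,8)[OF assms]]]
  unfolding fund_def[abs_def] by (simp add: add.assoc)

lemma state_split:
  assumes "x s \<in> carrier_vec n"
  shows "x s = part 0 n0 x s @\<^sub>v part n0 n1 x s @\<^sub>v part (n0 + n1) n2 x s"
  using assms by (intro eq_vecI) (auto simp: part_def)

lemma regular_L2: assumes "regular x" shows "x \<in> L2 a b n"
proof -
  have "(\<lambda>s. part 0 n0 x s @\<^sub>v part n0 n1 x s @\<^sub>v part (n0 + n1) n2 x s) \<in> L2 a b n"
    using L2_append[OF regularD(1)[OF assms] L2_append[OF regularD(2,5)[OF assms]]] by (simp add: add.assoc)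
  moreover have "x s = part 0 n0 x s @\<^sub>v part n0 n1 x s @\<^sub>v part (n0 + n1) n2 x s" if "s \<in> {a..b}" for s
    using assms that by (intro state_split) (auto simp: regular_def)
  ultimately show ?thesis by (subst L2_cong) auto
qed

lemma l2_inner_append:
  assumes "f \<in> L2 a b m" "f' \<in> L2 a b m" "g \<in> L2 a b k" "g' \<in> L2 a b k"
  shows "l2_inner a b (\<lambda>s. f s @\<^sub>v g s) (\<lambda>s. f' s @\<^sub>v g' s) = l2_inner a b f f' + l2_inner a b g g'"
proof -
  have 1: "(LINT s|M. (f s @\<^sub>v g s) $ i * (f' s @\<^sub>v g' s) $ i) = (LINT s|M. f s $ i * f' s $ i)" if "i < m" for i
    by (rule LINT_cong) (use that L2_dim[OF assms(1)] L2_dim[OF assms(2)] L2_dim[OF assms(3)] L2_dim[OF assms(4)] in auto)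
  have 2: "(LINT s|M. (f s @\<^sub>v g s) $ (m + i) * (f' s @\<^sub>v g' s) $ (m + i)) = (LINT s|M. g s $ i * g' s $ i)" if "i < k" for i
    by (rule LINT_cong) (use that L2_dim[OF assms(1)] L2_dim[OF assms(2)] L2_dim[OF assms(3)] L2_dim[OF assms(4)] in auto)
  show ?thesis
    unfolding l2_inner_sum[OF L2_append[OF assms(1,3)] L2_append[OF assms(2,4)]] l2_inner_sum[OF assms(1,2)]
      l2_inner_sum[OF assms(3,4)] sum_lessThan_add by (simp add: 1 2)
qed

text \<open>The three terms of the inner product of X are those of the fundamental state, block by
  block. Estimates for operators on \<open>L2\<close> thereby become estimates in the norm of
  X.\<close>

lemma X_norm_fund: assumes "regular x" shows "X_norm a b n0 n1 n2 x = l2_norm a b (fund x)"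
proof -
  note r = regularD[OF assms]
  have "l2_inner a b (fund x) (fund x) = X_inner a b n0 n1 n2 x x"
    unfolding X_inner_def d1_def[symmetric] d2_def[symmetric] d22_def[symmetric] fund_def[abs_def]
      l2_inner_append[OF r(1,1) L2_append[OF r(3,8)] L2_append[OF r(3,8)]] l2_inner_append[OF r(3,3,8,8)] by simp
  then show ?thesis unfolding X_norm_def l2_norm_def by simp
qed

subsection \<open>Linearity of the highest derivatives\<close>

lemma has_weak_deriv_lincomb:
  assumes "has_weak_deriv a b m u v" "has_weak_deriv a b m u' v'" "u \<in> L2 a b m" "v \<in> L2 a b m" "u' \<in> L2 a b m" "v' \<in> L2 a b m"
    "\<And>s. s \<in> {a..b} \<Longrightarrow> w s = u s + r \<cdot>\<^sub>v u' s"
  shows "has_weak_deriv a b m w (\<lambda>s. v s + r \<cdot>\<^sub>v v' s)"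
  unfolding has_weak_deriv_iff
proof (intro allI impI)
  fix i assume i: "i < m"
  have s: "swd (\<lambda>s. u s $ i + r * u' s $ i) (\<lambda>s. v s $ i + r * v' s $ i)"
    using assms(1,2) i unfolding has_weak_deriv_iff by (intro swd_lincomb L2_comp[OF _ i] assms) auto
  have e: "w s $ i = u s $ i + r * u' s $ i" "(v s + r \<cdot>\<^sub>v v' s) $ i = v s $ i + r * v' s $ i" if "s \<in> {a..b}" for s
    using i that L2_dim[OF assms(5) that] L2_dim[OF assms(6) that] by (auto simp: assms(7))
  have "(LINT s|M. w s $ i * deriv \<phi> s) = (LINT s|M. (u s $ i + r * u' s $ i) * deriv \<phi> s)"
    "(LINT s|M. (v s + r \<cdot>\<^sub>v v' s) $ i * \<phi> s) = (LINT s|M. (v s $ i + r * v' s $ i) * \<phi> s)" for \<phi>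
    by (rule LINT_cong; simp add: e)+
  then show "swd (\<lambda>s. w s $ i) (\<lambda>s. (v s + r \<cdot>\<^sub>v v' s) $ i)" using s unfolding swd_def by simp
qed

lemma lincomb_L2:
  assumes "u \<in> L2 a b m" "u' \<in> L2 a b m" shows "(\<lambda>s. u s + r \<cdot>\<^sub>v u' s) \<in> L2 a b m"
  by (rule L2_add[OF assms(1) L2_smult[OF assms(2)]])

text \<open>Weak derivatives are chosen representatives, so linearity holds only almost everywhere.
  For the second derivative the chosen \<open>d2 z\<close> is first replaced by the combination of
  \<open>d2 x\<close> and \<open>d2 y\<close>, and only then is uniqueness applied again.\<close>

lemma regular_lincomb:
  fixes r :: real
  assumes x: "regular x" and y: "regular y"
  defines "z \<equiv> (\<lambda>s. x s + r \<cdot>\<^sub>v y s)"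
  shows "regular z" "ae_eq a b (fund z) (\<lambda>s. fund x s + r \<cdot>\<^sub>v fund y s)"
proof -
  note X = regularD[OF x] and Y = regularD[OF y]
  have p: "part k m z s = part k m x s + r \<cdot>\<^sub>v part k m y s" if "s \<in> {a..b}" "k + m \<le> n" for k m s
  proof -
    have "dim_vec (y s) = n" using y that unfolding regular_def by auto
    then show ?thesis using that unfolding z_def part_def by (intro eq_vecI) auto
  qed
  have pL: "part k m z \<in> L2 a b m" if "part k m x \<in> L2 a b m" "part k m y \<in> L2 a b m" "k + m \<le> n" for k m
    using lincomb_L2[OF that(1,2), of r] p[OF _ that(3)] L2_cong[of "part k m z"] by simp
  have L0: "part 0 n0 z \<in> L2 a b n0" and L1: "part n0 n1 z \<in> L2 a b n1" and L2: "part (n0 + n1) n2 z \<in> L2 a b n2"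
    by (rule pL; use X Y in simp)+
  note v1 = lincomb_L2[OF X(3) Y(3), of r] and v2 = lincomb_L2[OF X(6) Y(6), of r] and v22 = lincomb_L2[OF X(8) Y(8), of r]
  have D1: "has_weak_deriv a b n1 (part n0 n1 z) (\<lambda>s. d1 x s + r \<cdot>\<^sub>v d1 y s)"
    by (rule has_weak_deriv_lincomb[OF X(4) Y(4) X(2,3) Y(2,3)]) (simp add: p)
  have D2: "has_weak_deriv a b n2 (part (n0 + n1) n2 z) (\<lambda>s. d2 x s + r \<cdot>\<^sub>v d2 y s)"
    by (rule has_weak_deriv_lincomb[OF X(7) Y(7) X(5,6) Y(5,6)]) (simp add: p)
  have D22: "has_weak_deriv a b n2 (\<lambda>s. d2 x s + r \<cdot>\<^sub>v d2 y s) (\<lambda>s. d22 x s + r \<cdot>\<^sub>v d22 y s)"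
    by (rule has_weak_deriv_lincomb[OF X(9) Y(9) X(6,8) Y(6,8)]) simp
  have S1: "part n0 n1 z \<in> sobolev 1 a b n1" using L1 D1 v1 by auto
  have S2: "part (n0 + n1) n2 z \<in> sobolev 2 a b n2"
    using L2 D2 D22 v2 v22 by (auto simp: numeral_2_eq_2)
  have c: "z s \<in> carrier_vec n" if "s \<in> {a..b}" for s
    using x y that unfolding regular_def z_def by auto
  show z: "regular z" unfolding regular_def using L0 S1 S2 c by auto
  note Z = regularD[OF z]
  have e1: "ae_eq a b (d1 z) (\<lambda>s. d1 x s + r \<cdot>\<^sub>v d1 y s)"
    by (rule has_weak_deriv_unique[OF Z(4) D1 L1 Z(3) v1])
  have e2: "ae_eq a b (d2 z) (\<lambda>s. d2 x s + r \<cdot>\<^sub>v d2 y s)"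
    by (rule has_weak_deriv_unique[OF Z(7) D2 L2 Z(6) v2])
  have D22z: "has_weak_deriv a b n2 (\<lambda>s. d2 x s + r \<cdot>\<^sub>v d2 y s) (d22 z)"
    by (rule has_weak_deriv_cong_AE[OF Z(9) e2 Z(6) v2])
  have e22: "ae_eq a b (d22 z) (\<lambda>s. d22 x s + r \<cdot>\<^sub>v d22 y s)"
    by (rule has_weak_deriv_unique[OF D22z D22 v2 Z(8) v22])
  show "ae_eq a b (fund z) (\<lambda>s. fund x s + r \<cdot>\<^sub>v fund y s)"
    unfolding ae_eq_def using e1[unfolded ae_eq_def] e22[unfolded ae_eq_def] AE_space
  proof eventually_elim
    case (elim s)
    then have s: "s \<in> {a..b}" by simp
    have dx: "dim_vec (d1 x s) = n1" "dim_vec (d22 x s) = n2" "dim_vec (d1 y s) = n1" "dim_vec (d22 y s) = n2"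
      using L2_dim[OF X(3) s] L2_dim[OF X(8) s] L2_dim[OF Y(3) s] L2_dim[OF Y(8) s] by auto
    have "r \<cdot>\<^sub>v (v @\<^sub>v w) = r \<cdot>\<^sub>v v @\<^sub>v r \<cdot>\<^sub>v w" for v w :: "real vec" by (intro eq_vecI) auto
    then show ?case unfolding fund_def elim using p[OF s, of 0 n0] by (simp add: append_vec_add' dx)
  qed
qed

subsection \<open>The fundamental state determines the state\<close>

abbreviation "Bi \<equiv> mat_inv (B * T_mat a b n1 n2)"

lemma T_mat_carrier: "T_mat a b n1 n2 \<in> carrier_mat (2 * n1 + 4 * n2) (n1 + 2 * n2)"
  unfolding T_mat_def by (auto intro!: carrier_matI)

text \<open>The inverse is extracted from an option value, so BT must first be recognised as a unit
  of the matrix ring; the dimensions of the abstract inverse are read off from the two product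
  identities.\<close>

lemma Bi: "Bi \<in> carrier_mat (n1 + 2 * n2) (n1 + 2 * n2)" "Bi * (B * T_mat a b n1 n2) = 1\<^sub>m (n1 + 2 * n2)"
proof -
  let ?A = "B * T_mat a b n1 n2"
  have A: "?A \<in> carrier_mat (n1 + 2 * n2) (n1 + 2 * n2)" using B_dim T_mat_carrier by auto
  obtain C where C: "?A * C = 1\<^sub>m (n1 + 2 * n2)" "C * ?A = 1\<^sub>m (dim_row C)"
    using BT_inv A unfolding invertible_mat_def inverts_mat_def by auto
  have "dim_col C = n1 + 2 * n2" using C(1) by (metis index_mult_mat(3) index_one_mat(3))
  moreover have "dim_row C = n1 + 2 * n2" using C(2) A by (metis carrier_matD(2) index_mult_mat(3) index_one_mat(3))
  ultimately have Cc: "C \<in> carrier_mat (n1 + 2 * n2) (n1 + 2 * n2)" "C * ?A = 1\<^sub>m (n1 + 2 * n2)" using C by auto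
  have "?A \<in> Units (ring_mat TYPE(real) (n1 + 2 * n2) ())"
    unfolding Units_def ring_mat_def using A Cc C by auto
  then obtain D where D: "mat_inverse ?A = Some D" using mat_inverse(1)[OF A, where b="()"] by (cases "mat_inverse ?A") auto
  then show "Bi \<in> carrier_mat (n1 + 2 * n2) (n1 + 2 * n2)" "Bi * ?A = 1\<^sub>m (n1 + 2 * n2)"
    using mat_inverse(2)[OF A D] unfolding mat_inv_def by auto
qed

lemma dims [simp]:
  "dim_row B = n1 + 2 * n2" "dim_col B = 2 * n1 + 4 * n2" "dim_row Bi = n1 + 2 * n2" "dim_col Bi = n1 + 2 * n2"
  "dim_row (K_mat a n0 n1 n2 s) = n" "dim_col (K_mat a n0 n1 n2 s) = n1 + 2 * n2"
  "dim_row (V_mat n1 n2) = n1 + n2" "dim_col (V_mat n1 n2) = n1 + 2 * n2"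
  "dim_row (Q_mat b n0 n1 n2 t) = 2 * n1 + 4 * n2" "dim_col (Q_mat b n0 n1 n2 t) = n"
  "dim_row (T_mat a b n1 n2) = 2 * n1 + 4 * n2" "dim_col (T_mat a b n1 n2) = n1 + 2 * n2"
  using B_dim Bi(1) T_mat_carrier by (auto simp: K_mat_def V_mat_def Q_mat_def)

lemma matb_0: "matb r c (\<lambda>_ _. 0\<^sub>m r c)" and matb_1: "matb r r (\<lambda>_ _. 1\<^sub>m r)"
  by (auto intro: matb_const)

lemma matb_scaled_1: "bdd2 f \<Longrightarrow> matb r r (\<lambda>s t. f s t \<cdot>\<^sub>m 1\<^sub>m r)"
  by (intro matb_smult matb_1)

lemmas matb_blocks = matb_append_rows matb_append_cols matb_0 matb_1 matb_scaled_1

lemma matb_dim: "matb r c N \<Longrightarrow> r = r' \<Longrightarrow> c = c' \<Longrightarrow> matb r' c' N" by simp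

lemma bdd2_affine:
  "bdd2 (\<lambda>s t. s - c)" "bdd2 (\<lambda>s t. c - s)" "bdd2 (\<lambda>s t. c - t)" "bdd2 (\<lambda>s t. s - t)"
  by (intro bdd2_diff bdd2_const bdd2_fst[OF bdd1_id] bdd2_snd[OF bdd1_id])+

lemma matb_Q: "matb (2 * n1 + 4 * n2) n (\<lambda>_. Q_mat b n0 n1 n2)"
  unfolding Q_mat_def by (rule matb_dim, (rule matb_blocks bdd2_affine)+, simp_all)

lemma matb_K: "matb n (n1 + 2 * n2) (\<lambda>s _. K_mat a n0 n1 n2 s)"
  unfolding K_mat_def by (rule matb_dim, (rule matb_blocks bdd2_affine)+, simp_all)

text \<open>The Volterra part of \<open>G1\<close>, which integrates the fundamental state from
  \<open>a\<close> with zero initial data; the rest of \<open>G1\<close> is the boundary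
  term.\<close>

definition G1' :: "real \<Rightarrow> real \<Rightarrow> real mat" where
  "G1' s t = (0\<^sub>m n0 n0 @\<^sub>c 0\<^sub>m n0 n1 @\<^sub>c 0\<^sub>m n0 n2) @\<^sub>r
      (0\<^sub>m n1 n0 @\<^sub>c 1\<^sub>m n1    @\<^sub>c 0\<^sub>m n1 n2) @\<^sub>r
      (0\<^sub>m n2 n0 @\<^sub>c 0\<^sub>m n2 n1 @\<^sub>c (s - t) \<cdot>\<^sub>m 1\<^sub>m n2)"

definition G4' :: "real mat" where
  "G4' = (0\<^sub>m n1 n0 @\<^sub>c 0\<^sub>m n1 n1 @\<^sub>c 0\<^sub>m n1 n2) @\<^sub>r
      (0\<^sub>m n2 n0 @\<^sub>c 0\<^sub>m n2 n1 @\<^sub>c 1\<^sub>m n2)"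

text \<open>Left factors of \<open>Q\<close>: \<open>G2\<close> is \<open>LT s\<close> times
  \<open>Q\<close>, and \<open>G5\<close> is \<open>LV\<close> times \<open>Q\<close>. This exposes
  the shape in which the boundary term has finite rank.\<close>

definition LT :: "real \<Rightarrow> real mat" where "LT s = - (K_mat a n0 n1 n2 s * Bi * B)"
definition LV :: "real mat" where "LV = - (V_mat n1 n2 * Bi * B)"

lemma matb_G1': "matb n n G1'"
  unfolding G1'_def[abs_def] by (rule matb_dim, (rule matb_blocks bdd2_affine)+, simp_all)

lemma matb_G4': "matb (n1 + n2) n (\<lambda>_ _. G4')"
  unfolding G4'_def by (rule matb_dim, (rule matb_blocks)+, simp_all)

lemma matb_G0: "matb n n (\<lambda>s _. G0 n0 n1 n2 s)"
  unfolding G0_def by (rule matb_dim, (rule matb_blocks)+, simp_all)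

lemma matb_G3: "matb (n1 + n2) n (\<lambda>s _. G3 n0 n1 n2 s)"
  unfolding G3_def by (rule matb_dim, (rule matb_blocks)+, simp_all)

lemma matb_LT: "matb n (2 * n1 + 4 * n2) (\<lambda>s _. LT s)"
  unfolding LT_def
  by (intro matb_uminus matb_mult[OF matb_mult[OF matb_K matb_const[OF Bi(1)]] matb_const[OF B_dim]])

lemma LV_carrier: "LV \<in> carrier_mat (n1 + n2) (2 * n1 + 4 * n2)"
  unfolding LV_def by (auto intro!: carrier_matI)

lemma LT_carrier: "LT s \<in> carrier_mat n (2 * n1 + 4 * n2)"
  unfolding LT_def by (auto intro!: carrier_matI)

lemma G0_carrier: "G0 n0 n1 n2 s \<in> carrier_mat n n" and G3_carrier: "G3 n0 n1 n2 s \<in> carrier_mat (n1 + n2) n"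
  unfolding G0_def G3_def by (auto intro!: carrier_matI)

lemma G2_eq: "G2 a b n0 n1 n2 B = (\<lambda>s t. LT s * Q_mat b n0 n1 n2 t)"
  unfolding G2_def LT_def by (intro ext uminus_mult_left_mat[symmetric]) simp

lemma G5_eq: "G5 a b n0 n1 n2 B = (\<lambda>s t. LV * Q_mat b n0 n1 n2 t)"
  unfolding G5_def LV_def by (intro ext uminus_mult_left_mat[symmetric]) simp

lemma G1_eq: "G1 a b n0 n1 n2 B = (\<lambda>s t. G1' s t + LT s * Q_mat b n0 n1 n2 t)"
  unfolding G1_def G1'_def G2_eq ..

lemma G4_eq: "G4 a b n0 n1 n2 B = (\<lambda>s t. G4' + LV * Q_mat b n0 n1 n2 t)"
  unfolding G4_def G4'_def G5_eq ..

lemma matb_G2: "matb n n (G2 a b n0 n1 n2 B)"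
  unfolding G2_eq by (intro matb_mult[OF matb_LT] matb_Q)
lemma matb_G1: "matb n n (G1 a b n0 n1 n2 B)"
  using matb_add[OF matb_G1' matb_G2] unfolding G1_eq G2_eq .
lemma matb_G5: "matb (n1 + n2) n (G5 a b n0 n1 n2 B)"
  unfolding G5_eq by (intro matb_mult[OF matb_const[OF LV_carrier]] matb_Q)
lemma matb_G4: "matb (n1 + n2) n (G4 a b n0 n1 n2 B)"
  using matb_add[OF matb_G4' matb_G5] unfolding G4_eq G5_eq .

text \<open>Recovers the first derivatives (\<partial>x1, \<partial>x2) from the fundamental state,
  as T recovers the state itself. It is the middle ingredient of A.\<close>

definition D_op :: "(real \<Rightarrow> real vec) \<Rightarrow> real \<Rightarrow> real vec" where
  "D_op = PI_op a b (n1 + n2) (G3 n0 n1 n2) (G4 a b n0 n1 n2 B) (G5 a b n0 n1 n2 B)"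

lemma is_kop_T: "is_kop n n (T_op a b n0 n1 n2 B) (\<lambda>i j s. G0 n0 n1 n2 s $$ (i, j))
    (PI_kernel (G1 a b n0 n1 n2 B) (G2 a b n0 n1 n2 B))"
  unfolding T_op_def by (intro is_kop_PI_op matb_G0 matb_G1 matb_G2)

lemma uminus_vec_smult: "- v = (-1) \<cdot>\<^sub>v (v :: real vec)" by (intro eq_vecI) auto

text \<open>For the fundamental state of an element \<open>x\<close> of \<open>X\<close> this is \<open>(x\<^sub>1(a), x\<^sub>2(a), \<partial>x\<^sub>2(a))\<close>: the boundary values are
  \<open>T y + \<integral>Q u\<close> with \<open>y\<close> this vector, and \<open>B\<close> annihilates them.\<close>

definition bdry_param :: "(real \<Rightarrow> real vec) \<Rightarrow> real vec" where
  "bdry_param u = - (Bi *\<^sub>v (B *\<^sub>v vec_integral (2 * n1 + 4 * n2) {a..b} (\<lambda>t. Q_mat b n0 n1 n2 t *\<^sub>v u t)))"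

lemma L_mult:
  assumes "dim_col K = n1 + 2 * n2" "dim_vec q = 2 * n1 + 4 * n2"
  shows "- (K * Bi * B) *\<^sub>v q = K *\<^sub>v (- (Bi *\<^sub>v (B *\<^sub>v q)))"
proof -
  have "K *\<^sub>v (- (Bi *\<^sub>v (B *\<^sub>v q))) = - (K *\<^sub>v (Bi *\<^sub>v (B *\<^sub>v q)))"
    unfolding uminus_vec_smult using assms by (intro mult_vec_smult) simp
  then show ?thesis using assms by (simp add: mult_vec_assoc)
qed

lemma T_op_split:
  assumes u: "u \<in> L2 a b n" and s: "s \<in> {a..b}"
  shows "T_op a b n0 n1 n2 B u s = G0 n0 n1 n2 s *\<^sub>v u s + vec_integral n {a..s} (\<lambda>t. G1' s t *\<^sub>v u t)
    + K_mat a n0 n1 n2 s *\<^sub>v bdry_param u"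
  unfolding T_op_def G1_eq G2_eq bdry_param_def
  using PI_op_split[OF matb_G1' matb_Q LT_carrier G0_carrier u s]
  by (simp add: L_mult[symmetric] LT_def)

lemma D_op_split:
  assumes u: "u \<in> L2 a b n" and s: "s \<in> {a..b}"
  shows "D_op u s = G3 n0 n1 n2 s *\<^sub>v u s + vec_integral (n1 + n2) {a..s} (\<lambda>t. G4' *\<^sub>v u t)
    + V_mat n1 n2 *\<^sub>v bdry_param u"
  unfolding D_op_def G4_eq G5_eq bdry_param_def
  using PI_op_split[OF matb_G4' matb_Q LV_carrier G3_carrier u s]
  by (simp add: L_mult[symmetric] LV_def)

context
  fixes x :: "real \<Rightarrow> real vec"
  assumes x: "x \<in> X_space a b n0 n1 n2 B"
begin

lemma X_regular: "regular x" using x unfolding X_space_def regular_def by auto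

private abbreviation "y1 \<equiv> point_value a b n1 (part n0 n1 x) a"
private abbreviation "y2 \<equiv> point_value a b n2 (part (n0 + n1) n2 x) a"
private abbreviation "y3 \<equiv> point_value a b n2 (d2 x) a"

private lemma dd: assumes "s \<in> {a..b}" shows "dim_vec (d1 x s) = n1" "dim_vec (d22 x s) = n2" "dim_vec (d2 x s) = n2"
  using L2_dim[OF regularD(3)[OF X_regular] assms] L2_dim[OF regularD(8)[OF X_regular] assms] L2_dim[OF regularD(6)[OF X_regular] assms] by auto

lemma X_bdry_param: "bdry_param (fund x) = y1 @\<^sub>v y2 @\<^sub>v y3"
proof -
  note r = regularD[OF X_regular]
  let ?q = "vec_integral (2 * n1 + 4 * n2) {a..b} (\<lambda>t. Q_mat b n0 n1 n2 t *\<^sub>v fund x t)"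
  let ?y = "y1 @\<^sub>v y2 @\<^sub>v y3"
  let ?U1 = "vec_integral n1 {a..b} (d1 x)" and ?U2 = "vec_integral n2 {a..b} (\<lambda>t. (b - t) \<cdot>\<^sub>v d22 x t)"
  let ?U3 = "vec_integral n2 {a..b} (d22 x)"
  have "?q = vec_integral (n1 + (n1 + (n2 + (n2 + (n2 + n2))))) {a..b}
      (\<lambda>t. 0\<^sub>v n1 @\<^sub>v d1 x t @\<^sub>v 0\<^sub>v n2 @\<^sub>v (b - t) \<cdot>\<^sub>v d22 x t @\<^sub>v 0\<^sub>v n2 @\<^sub>v d22 x t)"
  proof -
    have "?q = vec_integral (2 * n1 + 4 * n2) {a..b} (\<lambda>t. 0\<^sub>v n1 @\<^sub>v d1 x t @\<^sub>v 0\<^sub>v n2 @\<^sub>v (b - t) \<cdot>\<^sub>v d22 x t @\<^sub>v 0\<^sub>v n2 @\<^sub>v d22 x t)"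
      by (rule vec_integral_cong) (simp add: Q_mat_def fund_def block_simps dd)
    moreover have e: "2 * n1 + 4 * n2 = n1 + (n1 + (n2 + (n2 + (n2 + n2))))" by simp
    ultimately show ?thesis by (simp only: e)
  qed
  also have "\<dots> = 0\<^sub>v n1 @\<^sub>v ?U1 @\<^sub>v 0\<^sub>v n2 @\<^sub>v ?U2 @\<^sub>v 0\<^sub>v n2 @\<^sub>v ?U3"
    by (intro vec_integral_appendI; simp add: dd)
  finally have q: "?q = 0\<^sub>v n1 @\<^sub>v ?U1 @\<^sub>v 0\<^sub>v n2 @\<^sub>v ?U2 @\<^sub>v 0\<^sub>v n2 @\<^sub>v ?U3" .
  \<comment> \<open>Values at \<open>a\<close> are free parameters, entering through the rows of
    \<open>T_mat\<close>; values at \<open>b\<close> are their Taylor expansions from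
    \<open>a\<close>, whose affine parts are again in \<open>T_mat\<close> and whose remainders are
    the rows of the integral of \<open>Q\<close>.\<close>
  have bd: "bdry_vec a b n0 n1 n2 x = T_mat a b n1 n2 *\<^sub>v ?y + ?q"
    unfolding bdry_vec_def Let_def d2_def[symmetric] q
      first_order_representation(2)[OF r(2-4)] first_order_representation(2)[OF r(6,8,9)]
      second_order_representation(2)[OF r(5-9)]
    by (simp add: T_mat_def block_simps)
  let ?T = "T_mat a b n1 n2"
  have dy: "dim_vec ?y = n1 + 2 * n2" by simp
  have "0\<^sub>v (n1 + 2 * n2) = B *\<^sub>v (?T *\<^sub>v ?y + ?q)"
    using x unfolding X_space_def bd[symmetric] by simp
  also have "\<dots> = (B * ?T) *\<^sub>v ?y + B *\<^sub>v ?q"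
    using dy by (simp add: mult_vec_add mult_vec_assoc)
  finally have z: "(B * ?T) *\<^sub>v ?y + B *\<^sub>v ?q = 0\<^sub>v (n1 + 2 * n2)" ..
  have "(B * ?T) *\<^sub>v ?y = - (B *\<^sub>v ?q)"
  proof (rule eq_vecI)
    fix i assume "i < dim_vec (- (B *\<^sub>v ?q))"
    then have i: "i < n1 + 2 * n2" by simp
    have "((B * ?T) *\<^sub>v ?y + B *\<^sub>v ?q) $ i = 0" unfolding z using i by simp
    then show "((B * ?T) *\<^sub>v ?y) $ i = (- (B *\<^sub>v ?q)) $ i" using i by (simp del: index_mult_mat_vec)
  qed simp
  then have "Bi *\<^sub>v ((B * ?T) *\<^sub>v ?y) = Bi *\<^sub>v (- (B *\<^sub>v ?q))" by simp
  also have "Bi *\<^sub>v (- (B *\<^sub>v ?q)) = - (Bi *\<^sub>v (B *\<^sub>v ?q))"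
    unfolding uminus_vec_smult by (rule mult_vec_smult) simp
  also have "Bi *\<^sub>v ((B * ?T) *\<^sub>v ?y) = (Bi * (B * ?T)) *\<^sub>v ?y"
    by (rule mult_vec_assoc[symmetric]) (simp_all add: dy)
  also have "\<dots> = ?y" unfolding Bi(2) by (rule one_mult_vec[OF dy])
  finally show ?thesis unfolding bdry_param_def by simp
qed

text \<open>Once the finite rank term is known to carry the initial values at \<open>a\<close>, the
  blocks of T u are x0 itself and the first and second order Taylor representations of x1 and
  x2.\<close>

lemma T_op_fund: "ae_eq a b (T_op a b n0 n1 n2 B (fund x)) x"
proof -
  note r = regularD[OF X_regular]
  let ?t1 = "\<lambda>s. y1 + vec_integral n1 {a..s} (d1 x)"
  let ?t2 = "\<lambda>s. y2 + (s - a) \<cdot>\<^sub>v y3 + vec_integral n2 {a..s} (\<lambda>t. (s - t) \<cdot>\<^sub>v d22 x t)"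
  have T: "T_op a b n0 n1 n2 B (fund x) s = part 0 n0 x s @\<^sub>v ?t1 s @\<^sub>v ?t2 s" if s: "s \<in> {a..b}" for s
  proof -
    have st: "t \<in> {a..b}" if "t \<in> {a..s}" for t using that s by auto
    have "vec_integral n {a..s} (\<lambda>t. G1' s t *\<^sub>v fund x t) =
      vec_integral n {a..s} (\<lambda>t. 0\<^sub>v n0 @\<^sub>v d1 x t @\<^sub>v (s - t) \<cdot>\<^sub>v d22 x t)"
      by (rule vec_integral_cong) (use st in \<open>simp add: G1'_def fund_def block_simps dd\<close>)
    also have "\<dots> = 0\<^sub>v n0 @\<^sub>v vec_integral n1 {a..s} (d1 x) @\<^sub>v vec_integral n2 {a..s} (\<lambda>t. (s - t) \<cdot>\<^sub>v d22 x t)"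
      unfolding add.assoc using st by (intro vec_integral_appendI; simp add: dd)
    finally have 1: "vec_integral n {a..s} (\<lambda>t. G1' s t *\<^sub>v fund x t) = \<dots>" .
    have "v + w = w + v" if "dim_vec v = dim_vec w" for v w :: "real vec" using that by (intro eq_vecI) auto
    then show ?thesis
      unfolding T_op_split[OF fund_L2[OF X_regular] s] X_bdry_param 1
      using s by (simp add: fund_def G0_def K_mat_def block_simps dd)
  qed
  show ?thesis
    unfolding ae_eq_def
    using first_order_representation(1)[OF r(2-4), unfolded ae_eq_def]
      second_order_representation(1)[OF r(5-9), unfolded ae_eq_def] AE_space
  proof eventually_elim
    case (elim s)
    then have s: "s \<in> {a..b}" by simp
    have "x s = part 0 n0 x s @\<^sub>v part n0 n1 x s @\<^sub>v part (n0 + n1) n2 x s"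
      by (rule state_split) (use X_regular s in \<open>auto simp: regular_def\<close>)
    then show ?case unfolding T[OF s] using elim by simp
  qed
qed

lemma D_op_fund: "ae_eq a b (D_op (fund x)) (\<lambda>s. d1 x s @\<^sub>v d2 x s)"
proof -
  note r = regularD[OF X_regular]
  have D: "D_op (fund x) s = d1 x s @\<^sub>v (y3 + vec_integral n2 {a..s} (d22 x))" if s: "s \<in> {a..b}" for s
  proof -
    have st: "t \<in> {a..b}" if "t \<in> {a..s}" for t using that s by auto
    have "vec_integral (n1 + n2) {a..s} (\<lambda>t. G4' *\<^sub>v fund x t) =
      vec_integral (n1 + n2) {a..s} (\<lambda>t. 0\<^sub>v n1 @\<^sub>v d22 x t)"
      by (rule vec_integral_cong) (use st in \<open>simp add: G4'_def fund_def block_simps dd\<close>)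
    also have "\<dots> = 0\<^sub>v n1 @\<^sub>v vec_integral n2 {a..s} (d22 x)"
      using st by (intro vec_integral_appendI; simp add: dd)
    finally have 1: "vec_integral (n1 + n2) {a..s} (\<lambda>t. G4' *\<^sub>v fund x t) = \<dots>" .
    have "vec_integral n2 {a..s} (d22 x) + y3 = y3 + vec_integral n2 {a..s} (d22 x)" by (intro eq_vecI) auto
    then show ?thesis
      unfolding D_op_split[OF fund_L2[OF X_regular] s] X_bdry_param 1
      using s by (simp add: fund_def G3_def V_mat_def block_simps dd)
  qed
  show ?thesis
    unfolding ae_eq_def
    using first_order_representation(1)[OF r(6,8,9), unfolded ae_eq_def] AE_space
  proof eventually_elim
    case (elim s)
    then show ?case using D[of s] by simp
  qed
qed

end

section \<open>The right-hand side of the equation as an operator on the fundamental state\<close>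

context
  fixes A0 A1 A2 :: "real \<Rightarrow> real mat"
  assumes A0: "bounded_measurable_mat a b n n A0"
    and A1: "bounded_measurable_mat a b n (n1 + n2) A1"
    and A2: "bounded_measurable_mat a b n n2 A2"
begin

lemmas matb_A = A0[THEN matb_bounded_measurable] A1[THEN matb_bounded_measurable] A2[THEN matb_bounded_measurable]

lemma is_kop_A: "\<exists>c k. is_kop n n (A_op a b n0 n1 n2 B A0 A1 A2) c k"
proof -
  have "matb n n (\<lambda>s _. A0 s * G0 n0 n1 n2 s + A1 s * G3 n0 n1 n2 s + (0\<^sub>m n n0 @\<^sub>c 0\<^sub>m n n1 @\<^sub>c A2 s))"
    by (intro matb_add matb_mult[OF matb_A(1) matb_G0] matb_mult[OF matb_A(2) matb_G3],
        rule matb_dim, (rule matb_append_cols matb_0 matb_A(3))+, simp_all)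
  moreover have "matb n n (\<lambda>s t. A0 s * G1 a b n0 n1 n2 B s t + A1 s * G4 a b n0 n1 n2 B s t)"
    by (intro matb_add matb_mult[OF matb_A(1) matb_G1] matb_mult[OF matb_A(2) matb_G4])
  moreover have "matb n n (\<lambda>s t. A0 s * G2 a b n0 n1 n2 B s t + A1 s * G5 a b n0 n1 n2 B s t)"
    by (intro matb_add matb_mult[OF matb_A(1) matb_G2] matb_mult[OF matb_A(2) matb_G5])
  ultimately show ?thesis unfolding A_op_def by (intro exI, rule is_kop_PI_op)
qed

text \<open>The kernels of A are those of T and of \<open>D_op\<close> multiplied from the left by
  coefficients depending on \<open>s\<close> only, so these factor out of the integrals; the second
  derivative of x2 is a component of the fundamental state and needs no integral.\<close>

lemma A_op_split:
  assumes x: "regular x" and s: "s \<in> {a..b}"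
  shows "A_op a b n0 n1 n2 B A0 A1 A2 (fund x) s =
    A0 s *\<^sub>v T_op a b n0 n1 n2 B (fund x) s + A1 s *\<^sub>v D_op (fund x) s + A2 s *\<^sub>v d22 x s"
proof -
  let ?u = "fund x"
  note u = fund_L2[OF x] and r = regularD[OF x]
  have A: "A0 s \<in> carrier_mat n n" "A1 s \<in> carrier_mat n (n1 + n2)" "A2 s \<in> carrier_mat n n2"
    using matbD(1)[OF matb_A(1) s s] matbD(1)[OF matb_A(2) s s] matbD(1)[OF matb_A(3) s s] by auto
  have du: "dim_vec (?u s) = n" "dim_vec (part 0 n0 x s) = n0" "dim_vec (d1 x s) = n1" "dim_vec (d22 x s) = n2"
    using L2_dim[OF u s] L2_dim[OF r(3) s] L2_dim[OF r(8) s] by auto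
  have I: "vec_integral n {p..q} (\<lambda>t. (A0 s * N s t + A1 s * N' s t) *\<^sub>v ?u t) =
     A0 s *\<^sub>v vec_integral n {p..q} (\<lambda>t. N s t *\<^sub>v ?u t) + A1 s *\<^sub>v vec_integral (n1 + n2) {p..q} (\<lambda>t. N' s t *\<^sub>v ?u t)"
    if N: "matb n n N" and N': "matb (n1 + n2) n N'" and pq: "{p..q} \<subseteq> {a..b}" for N N' p q
  proof -
    note NL = matb_mult_vec_L2[OF N u s] and NL' = matb_mult_vec_L2[OF N' u s]
    have "vec_integral n {p..q} (\<lambda>t. (A0 s * N s t + A1 s * N' s t) *\<^sub>v ?u t) =
      vec_integral n {p..q} (\<lambda>t. A0 s *\<^sub>v (N s t *\<^sub>v ?u t) + A1 s *\<^sub>v (N' s t *\<^sub>v ?u t))"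
    proof (rule vec_integral_cong)
      fix t assume "t \<in> {p..q}"
      then have t: "t \<in> {a..b}" using pq by auto
      show "(A0 s * N s t + A1 s * N' s t) *\<^sub>v ?u t = A0 s *\<^sub>v (N s t *\<^sub>v ?u t) + A1 s *\<^sub>v (N' s t *\<^sub>v ?u t)"
        using matbD(1)[OF N s t] matbD(1)[OF N' s t] L2_dim[OF u t] A
        by (subst add_mult_vec) (auto simp: mult_vec_assoc)
    qed
    also have "\<dots> = A0 s *\<^sub>v vec_integral n {p..q} (\<lambda>t. N s t *\<^sub>v ?u t) + A1 s *\<^sub>v vec_integral (n1 + n2) {p..q} (\<lambda>t. N' s t *\<^sub>v ?u t)"
      unfolding vec_integral_mult[OF A(1) NL pq, symmetric] vec_integral_mult[OF A(2) NL' pq, symmetric]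
      by (rule vec_integral_add[OF matb_mult_vec_L2[OF matb_const[OF A(1)] NL s] matb_mult_vec_L2[OF matb_const[OF A(2)] NL' s] pq])
    finally show ?thesis .
  qed
  have sub: "{a..s} \<subseteq> {a..b}" "{s..b} \<subseteq> {a..b}" using s by auto
  have "(0\<^sub>m n n0 @\<^sub>c 0\<^sub>m n n1 @\<^sub>c A2 s) *\<^sub>v ?u s = A2 s *\<^sub>v d22 x s"
    unfolding fund_def using du A by (simp add: block_simps)
  then have N0: "(A0 s * G0 n0 n1 n2 s + A1 s * G3 n0 n1 n2 s + (0\<^sub>m n n0 @\<^sub>c 0\<^sub>m n n1 @\<^sub>c A2 s)) *\<^sub>v ?u s =
      A0 s *\<^sub>v (G0 n0 n1 n2 s *\<^sub>v ?u s) + A1 s *\<^sub>v (G3 n0 n1 n2 s *\<^sub>v ?u s) + A2 s *\<^sub>v d22 x s"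
    using A du G0_carrier[of s] G3_carrier[of s] by (simp add: add_mult_vec mult_vec_assoc)
  have T: "A0 s *\<^sub>v T_op a b n0 n1 n2 B ?u s = A0 s *\<^sub>v (G0 n0 n1 n2 s *\<^sub>v ?u s)
     + A0 s *\<^sub>v vec_integral n {a..s} (\<lambda>t. G1 a b n0 n1 n2 B s t *\<^sub>v ?u t)
     + A0 s *\<^sub>v vec_integral n {s..b} (\<lambda>t. G2 a b n0 n1 n2 B s t *\<^sub>v ?u t)"
    unfolding T_op_def PI_op_def using A(1) G0_carrier[of s] by (simp add: mult_vec_add)
  have D: "A1 s *\<^sub>v D_op ?u s = A1 s *\<^sub>v (G3 n0 n1 n2 s *\<^sub>v ?u s)
     + A1 s *\<^sub>v vec_integral (n1 + n2) {a..s} (\<lambda>t. G4 a b n0 n1 n2 B s t *\<^sub>v ?u t)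
     + A1 s *\<^sub>v vec_integral (n1 + n2) {s..b} (\<lambda>t. G5 a b n0 n1 n2 B s t *\<^sub>v ?u t)"
    unfolding D_op_def PI_op_def using A(2) G3_carrier[of s] by (simp add: mult_vec_add)
  show ?thesis
    unfolding T D unfolding A_op_def PI_op_def N0 I[OF matb_G1 matb_G4 sub(1)] I[OF matb_G2 matb_G5 sub(2)]
    using A by (intro eq_vecI) (auto simp del: index_mult_mat_vec)
qed

lemma A_op_fund:
  assumes x: "x \<in> X_space a b n0 n1 n2 B"
  shows "ae_eq a b (A_op a b n0 n1 n2 B A0 A1 A2 (fund x))
     (\<lambda>s. A0 s *\<^sub>v x s + A1 s *\<^sub>v (d1 x s @\<^sub>v d2 x s) + A2 s *\<^sub>v d22 x s)"
  unfolding ae_eq_def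
  using T_op_fund[OF x, unfolded ae_eq_def] D_op_fund[OF x, unfolded ae_eq_def] AE_space
proof eventually_elim
  case (elim s)
  then show ?case using A_op_split[OF X_regular[OF x], of s] by simp
qed

end

end

section \<open>Differentiation and decay of the quadratic form\<close>

lemma minus_vec_smult: "v - w = v + (-1) \<cdot>\<^sub>v (w :: real vec)"
  by (rule eq_vecI) auto

lemma minus_smult_vec: "v - k \<cdot>\<^sub>v w = v + (- k) \<cdot>\<^sub>v (w :: real vec)"
  by (rule eq_vecI) auto

context interval begin

lemma kop_form_left:
  assumes F: "is_kop m n F c k" and x: "x \<in> L2 a b m" and y: "y \<in> L2 a b m" and z: "z \<in> L2 a b n"
  shows "l2_inner a b (\<lambda>s. x s + r \<cdot>\<^sub>v y s) (F z) = l2_inner a b x (F z) + r * l2_inner a b y (F z)"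
  using l2_inner_add_left[OF x L2_smult[OF y] is_kop_L2[OF F z]] l2_inner_smult_left[OF y is_kop_L2[OF F z]] by simp

lemma kop_form_right:
  assumes F: "is_kop m n F c k" and x: "x \<in> L2 a b n" and y: "y \<in> L2 a b n" and z: "z \<in> L2 a b m"
  shows "l2_inner a b z (F (\<lambda>s. x s + r \<cdot>\<^sub>v y s)) = l2_inner a b z (F x) + r * l2_inner a b z (F y)"
proof -
  have "l2_inner a b z (F (\<lambda>s. x s + r \<cdot>\<^sub>v y s)) = l2_inner a b z (\<lambda>s. F x s + r \<cdot>\<^sub>v F y s)"
    by (rule l2_inner_cong) (use is_kop_linear[OF F x y] in auto)
  then show ?thesis
    using l2_inner_add_right[OF is_kop_L2[OF F x] L2_smult[OF is_kop_L2[OF F y]] z] l2_inner_smult_right[OF is_kop_L2[OF F y] z] by simp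
qed

lemma kop_form_bounded:
  assumes F: "is_kop m n F c k"
  obtains C where "C > 0" "\<And>x y. x \<in> L2 a b m \<Longrightarrow> y \<in> L2 a b n \<Longrightarrow> \<bar>l2_inner a b x (F y)\<bar> \<le> C * (l2_norm a b x * l2_norm a b y)"
proof -
  obtain C where C: "C > 0" "\<And>x. x \<in> L2 a b n \<Longrightarrow> l2_norm a b (F x) \<le> C * l2_norm a b x"
    by (rule is_kop_bounded[OF F]) blast
  show ?thesis
  proof (rule that[OF C(1)])
    fix x y assume x: "x \<in> L2 a b m" and y: "y \<in> L2 a b n"
    have "\<bar>l2_inner a b x (F y)\<bar> \<le> l2_norm a b x * l2_norm a b (F y)"
      by (rule l2_Cauchy_Schwarz[OF x is_kop_L2[OF F y]])
    also have "\<dots> \<le> l2_norm a b x * (C * l2_norm a b y)"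
      by (intro mult_left_mono C(2) y l2_norm_nonneg[OF x])
    finally show "\<bar>l2_inner a b x (F y)\<bar> \<le> C * (l2_norm a b x * l2_norm a b y)" by (simp add: mult_ac)
  qed
qed

lemma l2_norm_ae_cong:
  assumes "ae_eq a b x y" "x \<in> L2 a b n" "y \<in> L2 a b n" shows "l2_norm a b x = l2_norm a b y"
  unfolding l2_norm_def using l2_inner_ae_cong[OF assms(1,1,2,3,2,3)] by simp

end

text \<open>V(t) exp(c t) is nonincreasing. The derivative at 0 is one-sided, but monotonicity on
  [0,t] needs only continuity at the end points and two-sided derivatives inside.\<close>

lemma exponential_decay:
  fixes V V' :: "real \<Rightarrow> real"
  assumes der: "\<And>t. t \<ge> 0 \<Longrightarrow> (V has_real_derivative V' t) (at t within {0..})"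
    and le: "\<And>t. t \<ge> 0 \<Longrightarrow> V' t \<le> - c * V t" and t: "t \<ge> 0"
  shows "V t \<le> V 0 * exp (- c * t)"
proof (cases "t = 0")
  case False
  define f where "f t = V t * exp (c * t)" for t
  have "f t \<le> f 0"
  proof (rule DERIV_nonpos_imp_decreasing_open[where f=f and a=0 and b=t])
    show "0 \<le> t" by (rule t)
    show "continuous_on {0..t} f"
    proof -
      have "continuous_on {0..} V" using der by (meson DERIV_continuous_on atLeast_iff)
      then have "continuous_on {0..t} V" by (rule continuous_on_subset) auto
      then show ?thesis unfolding f_def by (intro continuous_intros)
    qed
    fix x assume x: "0 < x" "x < t"
    have "x \<in> interior {0..}" using x by (simp add: interior_real_atLeast)
    from at_within_interior[OF this]
    have "(V has_real_derivative V' x) (at x)" using der[of x] x by simp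
    then have "(f has_real_derivative (V' x + c * V x) * exp (c * x)) (at x)"
      unfolding f_def by (auto intro!: derivative_eq_intros simp: algebra_simps)
    moreover have "(V' x + c * V x) * exp (c * x) \<le> 0"
      using le[of x] x by (intro mult_nonpos_nonneg) auto
    ultimately show "\<exists>y. (f has_real_derivative y) (at x) \<and> y \<le> 0" by blast
  qed
  then have "V t * exp (c * t) \<le> V 0" unfolding f_def by simp
  then show ?thesis by (simp add: exp_minus field_simps)
qed simp

context pde_space begin

text \<open>The property of elements of X that the estimates use, in a form that passes to linear
  combinations by linearity of T. The remainder of a difference quotient can thus be bounded without
  examining its boundary values.\<close>

definition represented :: "(real \<Rightarrow> real vec) \<Rightarrow> bool" where
  "represented x \<longleftrightarrow> regular x \<and> ae_eq a b (T_op a b n0 n1 n2 B (fund x)) x"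

lemma X_represented: "x \<in> X_space a b n0 n1 n2 B \<Longrightarrow> represented x"
  unfolding represented_def using X_regular T_op_fund by auto

lemma represented_lincomb:
  assumes x: "represented x" and y: "represented y"
  shows "represented (\<lambda>s. x s + r \<cdot>\<^sub>v y s)"
proof -
  let ?z = "\<lambda>s. x s + r \<cdot>\<^sub>v y s" and ?T = "T_op a b n0 n1 n2 B"
  have rx: "regular x" and ry: "regular y" using assms unfolding represented_def by auto
  note z = regular_lincomb[OF rx ry, of r] and fx = fund_L2[OF rx] and fy = fund_L2[OF ry]
  have 1: "ae_eq a b (?T (fund ?z)) (?T (\<lambda>s. fund x s + r \<cdot>\<^sub>v fund y s))"
    by (rule is_kop_ae_cong[OF is_kop_T fund_L2[OF z(1)] lincomb_L2[OF fx fy] z(2)])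
  have "ae_eq a b (?T (fund ?z)) ?z"
    unfolding ae_eq_def using 1[unfolded ae_eq_def] x[unfolded represented_def ae_eq_def, THEN conjunct2]
      y[unfolded represented_def ae_eq_def, THEN conjunct2] AE_space
  proof eventually_elim
    case (elim s)
    then show ?case using is_kop_linear[OF is_kop_T fx fy, of s r] by simp
  qed
  then show ?thesis unfolding represented_def using z(1) by blast
qed

text \<open>A Poincare inequality: x is almost everywhere T applied to its fundamental state, T is
  bounded on \<open>L2\<close>, and the norm of the fundamental state is the norm of X.\<close>

lemma represented_norm:
  obtains C where "C > 0" "\<And>x. represented x \<Longrightarrow> l2_norm a b x \<le> C * X_norm a b n0 n1 n2 x"
proof -
  obtain C where C: "C > 0" "\<And>x. x \<in> L2 a b n \<Longrightarrow> l2_norm a b (T_op a b n0 n1 n2 B x) \<le> C * l2_norm a b x"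
    by (rule is_kop_bounded[OF is_kop_T]) blast
  show ?thesis
  proof (rule that[OF C(1)])
    fix x assume "represented x"
    then have x: "regular x" "ae_eq a b (T_op a b n0 n1 n2 B (fund x)) x" unfolding represented_def by auto
    show "l2_norm a b x \<le> C * X_norm a b n0 n1 n2 x"
      using C(2)[OF fund_L2[OF x(1)]] l2_norm_ae_cong[OF x(2) is_kop_L2[OF is_kop_T fund_L2[OF x(1)]] regular_L2[OF x(1)]]
      unfolding X_norm_fund[OF x(1)] by simp
  qed
qed

text \<open>The product rule for the bounded bilinear form given by \<open>F\<close>; both terms
  appear since \<open>F\<close> may be nonsymmetric. Differentiability is given in the norm of X and
  is transferred to \<open>L2\<close> by the Poincare inequality for the remainder.\<close>

lemma quadratic_form_derivative:
  assumes F: "is_kop n n F c k" and X: "\<And>t. t \<ge> 0 \<Longrightarrow> x t \<in> X_space a b n0 n1 n2 B"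
    and t: "t \<ge> 0" and d: "has_X_derivative a b n0 n1 n2 B x v t"
  shows "((\<lambda>r. l2_inner a b (x r) (F (x r))) has_real_derivative
     (l2_inner a b v (F (x t)) + l2_inner a b (x t) (F v))) (at t within {0..})"
proof -
  let ?\<beta> = "\<lambda>x y. l2_inner a b x (F y)"
  define e where "e r = (\<lambda>s. x r s - x t s - (r - t) \<cdot>\<^sub>v v s)" for r
  define \<rho> where "\<rho> r = X_norm a b n0 n1 n2 (e r) / \<bar>r - t\<bar>" for r
  have v: "represented v" using d X_represented unfolding has_X_derivative_def by auto
  have lim: "(\<rho> \<longlongrightarrow> 0) (at t within {0..})" using d unfolding has_X_derivative_def \<rho>_def e_def by auto
  have xr: "represented (x r)" if "r \<ge> 0" for r using X[OF that] by (rule X_represented)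
  have L: "w \<in> L2 a b n" if "represented w" for w using that regular_L2 unfolding represented_def by auto
  have e: "represented (e r)" if "r \<ge> 0" for r
    unfolding e_def minus_smult_vec unfolding minus_vec_smult
    by (intro represented_lincomb xr that t v)
  obtain C where C: "C > 0" "\<And>x y. x \<in> L2 a b n \<Longrightarrow> y \<in> L2 a b n \<Longrightarrow> \<bar>?\<beta> x y\<bar> \<le> C * (l2_norm a b x * l2_norm a b y)"
    by (rule kop_form_bounded[OF F]) blast
  obtain E where E: "E > 0" "\<And>x. represented x \<Longrightarrow> l2_norm a b x \<le> E * X_norm a b n0 n1 n2 x"
    by (rule represented_norm) blast
  let ?N = "l2_norm a b"
  let ?D = "?\<beta> v (x t) + ?\<beta> (x t) v"
  \<comment> \<open>The error of the difference quotient: the two cross terms with the remainder e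
    are of order \<open>\<rho> r\<close>, and the form evaluated twice on the increment is quadratic
    in r - t, leaving one factor \<bar>r - t\<bar> after division.\<close>
  define G where "G r = C * (2 * ?N (x t) * (E * \<rho> r) + \<bar>r - t\<bar> * (?N v + E * \<rho> r)^2)" for r
  have bound: "norm ((?\<beta> (x r) (x r) - ?\<beta> (x t) (x t)) / (r - t) - ?D) \<le> G r" if r: "r \<ge> 0" "r \<noteq> t" for r
  proof -
    define h where "h = r - t"
    have h: "\<bar>h\<bar> > 0" using r unfolding h_def by simp
    \<comment> \<open>This is the increment x(r) - x(t), split into the linear part h v and the
      remainder. The scalar 1 in front of it below brings the sum into the form x + r y of the
      bilinearity rules.\<close>
    let ?d = "\<lambda>s. e r s + h \<cdot>\<^sub>v v s"
    note Lx = L[OF xr[OF t]] and Lv = L[OF v] and Le = L[OF e[OF r(1)]] and Lr = L[OF xr[OF r(1)]]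
    have Ld: "?d \<in> L2 a b n" by (rule lincomb_L2[OF Le Lv])
    have xd: "(\<lambda>s. x t s + 1 \<cdot>\<^sub>v ?d s) \<in> L2 a b n" by (rule lincomb_L2[OF Lx Ld])
    have "x r s = x t s + 1 \<cdot>\<^sub>v ?d s" if "s \<in> {a..b}" for s
      using L2_dim[OF Lx that] L2_dim[OF Lv that] L2_dim[OF Lr that]
      unfolding e_def h_def by (intro eq_vecI) auto
    then have ae: "ae_eq a b (x r) (\<lambda>s. x t s + 1 \<cdot>\<^sub>v ?d s)" unfolding ae_eq_def by (intro AE_I2) simp
    have "?\<beta> (x r) (x r) = ?\<beta> (\<lambda>s. x t s + 1 \<cdot>\<^sub>v ?d s) (\<lambda>s. x t s + 1 \<cdot>\<^sub>v ?d s)"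
      by (rule l2_inner_ae_cong[OF ae is_kop_ae_cong[OF F Lr xd ae] Lr xd is_kop_L2[OF F Lr] is_kop_L2[OF F xd]])
    also have "\<dots> = ?\<beta> (x t) (x t) + ?\<beta> (x t) ?d + ?\<beta> ?d (x t) + ?\<beta> ?d ?d"
      by (simp only: kop_form_left[OF F Lx Ld xd] kop_form_right[OF F Lx Ld Lx] kop_form_right[OF F Lx Ld Ld]) simp
    also have "?\<beta> (x t) ?d = ?\<beta> (x t) (e r) + h * ?\<beta> (x t) v" by (rule kop_form_right[OF F Le Lv Lx])
    also have "?\<beta> ?d (x t) = ?\<beta> (e r) (x t) + h * ?\<beta> v (x t)" by (rule kop_form_left[OF F Le Lv Lx])
    finally have eq: "(?\<beta> (x r) (x r) - ?\<beta> (x t) (x t)) / h - ?D = (?\<beta> (x t) (e r) + ?\<beta> (e r) (x t) + ?\<beta> ?d ?d) / h"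
      using h by (simp add: field_simps)
    have ne: "?N (e r) \<le> E * \<rho> r * \<bar>h\<bar>"
      using E(2)[OF e[OF r(1)]] h unfolding \<rho>_def h_def by simp
    have "?N ?d \<le> \<bar>h\<bar> * (?N v + E * \<rho> r)"
      using l2_norm_triangle[OF Le L2_smult[OF Lv, of h]] l2_norm_smult[OF Lv, of h] ne
      by (simp add: algebra_simps)
    then have "?N ?d * ?N ?d \<le> (\<bar>h\<bar> * (?N v + E * \<rho> r)) * (\<bar>h\<bar> * (?N v + E * \<rho> r))"
      using l2_norm_nonneg[OF Ld] by (intro mult_mono) auto
    then have dd: "\<bar>?\<beta> ?d ?d\<bar> \<le> C * ((\<bar>h\<bar> * (?N v + E * \<rho> r)) * (\<bar>h\<bar> * (?N v + E * \<rho> r)))"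
      using C(1) by (intro order_trans[OF C(2)[OF Ld Ld]] mult_left_mono) auto
    have "C * (?N (x t) * ?N (e r)) \<le> C * (?N (x t) * (E * \<rho> r * \<bar>h\<bar>))"
      using C(1) l2_norm_nonneg[OF Lx] ne by (intro mult_left_mono) auto
    then have "\<bar>?\<beta> (x t) (e r)\<bar> \<le> C * (?N (x t) * (E * \<rho> r * \<bar>h\<bar>))" "\<bar>?\<beta> (e r) (x t)\<bar> \<le> C * (?N (x t) * (E * \<rho> r * \<bar>h\<bar>))"
      using C(2)[OF Lx Le] C(2)[OF Le Lx] by (auto simp: mult.commute[of "?N (e r)"])
    with dd have "\<bar>?\<beta> (x t) (e r) + ?\<beta> (e r) (x t) + ?\<beta> ?d ?d\<bar> \<le> 2 * (C * (?N (x t) * (E * \<rho> r * \<bar>h\<bar>)))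
        + C * ((\<bar>h\<bar> * (?N v + E * \<rho> r)) * (\<bar>h\<bar> * (?N v + E * \<rho> r)))" by linarith
    also have "\<dots> = G r * \<bar>h\<bar>"
      unfolding G_def h_def[symmetric] by (simp add: algebra_simps power2_eq_square)
    finally show ?thesis unfolding h_def[symmetric] eq using h by (simp add: abs_divide divide_le_eq)
  qed
  have "(G \<longlongrightarrow> C * (2 * ?N (x t) * (E * 0) + \<bar>t - t\<bar> * (?N v + E * 0)^2)) (at t within {0..})"
    unfolding G_def by (intro tendsto_intros lim)
  then have G0: "(G \<longlongrightarrow> 0) (at t within {0..})" by simp
  have "((\<lambda>r. (?\<beta> (x r) (x r) - ?\<beta> (x t) (x t)) / (r - t) - ?D) \<longlongrightarrow> 0) (at t within {0..})"
    by (rule Lim_null_comparison[OF _ G0], unfold eventually_at_filter, rule always_eventually)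
       (intro allI impI bound; simp)
  then show ?thesis unfolding has_field_derivative_iff by (rule LIM_zero_cancel)
qed

end

theorem theorem18:
  fixes a b :: real and n0 n1 n2 d :: nat and B :: "real mat"
    and A0 A1 A2 :: "real \<Rightarrow> real mat"
  assumes ab: "a < b"
    and B_dim: "B \<in> carrier_mat (n1 + 2 * n2) (2 * n1 + 4 * n2)"
    and BT_inv: "invertible_mat (B * T_mat a b n1 n2)"
    and A0: "bounded_measurable_mat a b (n0 + n1 + n2) (n0 + n1 + n2) A0"
    and A1: "bounded_measurable_mat a b (n0 + n1 + n2) (n1 + n2) A1"
    and A2: "bounded_measurable_mat a b (n0 + n1 + n2) n2 A2"
    and LPI: "\<exists>\<epsilon> \<delta> N0 N1 N2. \<epsilon> > 0 \<and> \<delta> > 0 \<and>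
      poly_mat1 a b (n0 + n1 + n2) (n0 + n1 + n2) N0 \<and>
      poly_mat2 a b (n0 + n1 + n2) (n0 + n1 + n2) N1 \<and>
      poly_mat2 a b (n0 + n1 + n2) (n0 + n1 + n2) N2 \<and>
      (let n = n0 + n1 + n2;
           P = PI_op a b n N0 N1 N2;
           T = T_op a b n0 n1 n2 B;
           A = A_op a b n0 n1 n2 B A0 A1 A2
       in PI_op a b n (\<lambda>s. N0 s - \<epsilon> \<cdot>\<^sub>m 1\<^sub>m n) N1 N2 \<in> Omega a b n d \<and>
          (\<lambda>x s. - \<delta> \<cdot>\<^sub>v l2_adjoint a b n T (T x) s
                 - l2_adjoint a b n A (P (T x)) s
                 - l2_adjoint a b n T (P (A x)) s) \<in> Omega a b n d)"
  shows "\<exists>K>0. \<exists>\<gamma>>0. \<forall>x0 \<in> X_space a b n0 n1 n2 B. \<forall>x.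
    pde_solution a b n0 n1 n2 B A0 A1 A2 x0 x \<longrightarrow>
    (\<forall>t\<ge>0. l2_norm a b (x t) \<le> K * l2_norm a b x0 * exp (- \<gamma> * t))"
proof -
  interpret pde_space a b n0 n1 n2 B by unfold_locales fact+
  define T where "T = T_op a b n0 n1 n2 B"
  define A where "A = A_op a b n0 n1 n2 B A0 A1 A2"
  from LPI obtain \<epsilon> \<delta> N0 N1 N2 where \<epsilon>: "\<epsilon> > 0" and \<delta>: "\<delta> > 0"
    and N: "poly_mat1 a b n n N0" "poly_mat2 a b n n N1" "poly_mat2 a b n n N2"
    and Om1: "PI_op a b n (\<lambda>s. N0 s - \<epsilon> \<cdot>\<^sub>m 1\<^sub>m n) N1 N2 \<in> Omega a b n d"
    and Om2: "(\<lambda>x s. - \<delta> \<cdot>\<^sub>v l2_adjoint a b n T (T x) s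
                 - l2_adjoint a b n A (PI_op a b n N0 N1 N2 (T x)) s
                 - l2_adjoint a b n T (PI_op a b n N0 N1 N2 (A x)) s) \<in> Omega a b n d"
    unfolding Let_def T_def A_def by blast
  define P where "P = PI_op a b n N0 N1 N2"
  note Om2 = Om2[folded P_def]
  note mN0 = matb_poly1[OF N(1)]
  obtain cP kP where kP: "is_kop n n P cP kP"
    unfolding P_def using is_kop_PI_op[OF mN0 matb_poly2[OF N(2)] matb_poly2[OF N(3)]] by blast
  obtain cT kT where kT: "is_kop n n T cT kT" unfolding T_def using is_kop_T by blast
  obtain cA kA where kA: "is_kop n n A cA kA" unfolding A_def using is_kop_A[OF A0 A1 A2] by blast
  let ?ip = "l2_inner a b" and ?N = "l2_norm a b"
  \<comment> \<open>Positivity of the operator with multiplier shifted by -\<epsilon> is coercivity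
    of \<open>P\<close>, because the shift contributes -\<epsilon> times the identity.\<close>
  have coercive: "\<epsilon> * ?ip x x \<le> ?ip x (P x)" if x: "x \<in> L2 a b n" for x
  proof -
    let ?R = "PI_op a b n (\<lambda>s. N0 s - \<epsilon> \<cdot>\<^sub>m 1\<^sub>m n) N1 N2"
    have R: "?R x s = P x s + (- \<epsilon>) \<cdot>\<^sub>v x s" if s: "s \<in> {a..b}" for s
    proof -
      have "(N0 s - \<epsilon> \<cdot>\<^sub>m 1\<^sub>m n) *\<^sub>v x s = N0 s *\<^sub>v x s - (\<epsilon> \<cdot>\<^sub>m 1\<^sub>m n) *\<^sub>v x s"
        by (rule minus_mult_distrib_mat_vec[OF matbD(1)[OF mN0 s s] _ L2_carrier[OF x s]]) auto
      then show ?thesis unfolding P_def PI_op_def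
        using matbD(1)[OF mN0 s s] L2_dim[OF x s] by (intro eq_vecI) (auto simp: smult_one_mult_vec simp del: index_mult_mat_vec)
    qed
    note Px = is_kop_L2[OF kP x]
    have "(\<lambda>s. P x s + (- \<epsilon>) \<cdot>\<^sub>v x s) \<in> L2 a b n" by (rule lincomb_L2[OF Px x])
    then have "?R x \<in> L2 a b n" using L2_cong[OF R] by simp
    then have "0 \<le> ?ip x (?R x)" by (rule Omega_nonneg[OF Om1 x])
    also have "\<dots> = ?ip x (\<lambda>s. P x s + (- \<epsilon>) \<cdot>\<^sub>v x s)" by (rule l2_inner_cong) (auto simp: R)
    also have "\<dots> = ?ip x (P x) + (- \<epsilon>) * ?ip x x"
      using l2_inner_add_right[OF Px L2_smult[OF x] x] l2_inner_smult_right[OF x x] by simp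
    finally show ?thesis by simp
  qed
  \<comment> \<open>Pairing the second operator with \<open>u\<close> and moving each adjoint to the
    other side turns the three terms into forms in \<open>T u\<close> and
    \<open>A u\<close>.\<close>
  have dissipative: "?ip (A u) (P (T u)) + ?ip (T u) (P (A u)) \<le> - \<delta> * ?ip (T u) (T u)" if u: "u \<in> L2 a b n" for u
  proof -
    note Tu = is_kop_L2[OF kT u] and Au = is_kop_L2[OF kA u]
    note PT = is_kop_L2[OF kP Tu] and PA = is_kop_L2[OF kP Au]
    note 1 = l2_adjoint[OF kT Tu] and 2 = l2_adjoint[OF kA PT] and 3 = l2_adjoint[OF kT PA]
    note s1 = L2_smult[OF 1(1), of "- \<delta>"]
    note s2 = lincomb_L2[OF s1 2(1), of "-1"]
    note s3 = lincomb_L2[OF s2 3(1), of "-1"]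
    have "0 \<le> ?ip u (\<lambda>s. ((- \<delta>) \<cdot>\<^sub>v l2_adjoint a b n T (T u) s + (-1) \<cdot>\<^sub>v l2_adjoint a b n A (P (T u)) s) + (-1) \<cdot>\<^sub>v l2_adjoint a b n T (P (A u)) s)"
      using Omega_nonneg[OF Om2 u] s3 unfolding minus_vec_smult by simp
    also have "\<dots> = - \<delta> * ?ip (T u) (T u) - ?ip (A u) (P (T u)) - ?ip (T u) (P (A u))"
      unfolding l2_inner_add_right[OF s2 L2_smult[OF 3(1)] u] l2_inner_add_right[OF s1 L2_smult[OF 2(1)] u]
        l2_inner_smult_right[OF 1(1) u] l2_inner_smult_right[OF 2(1) u] l2_inner_smult_right[OF 3(1) u]
        1(2)[OF u] 2(2)[OF u] 3(2)[OF u] by simp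
    finally show ?thesis by simp
  qed
  obtain C where C: "C > 0" "\<And>x y. x \<in> L2 a b n \<Longrightarrow> y \<in> L2 a b n \<Longrightarrow> \<bar>?ip x (P y)\<bar> \<le> C * (?N x * ?N y)"
    by (rule kop_form_bounded[OF kP]) blast
  \<comment> \<open>Since V is at most C times the squared norm, the dissipation -\<delta> times the
    squared norm is at most -(\<delta>/C) V.\<close>
  define \<kappa> where "\<kappa> = \<delta> / C"
  have \<kappa>: "\<kappa> > 0" unfolding \<kappa>_def using \<delta> C by simp
  have decay: "?N (x t) \<le> sqrt (C / \<epsilon>) * ?N x0 * exp (- (\<kappa> / 2) * t)"
    if x0: "x0 \<in> X_space a b n0 n1 n2 B" and sol: "pde_solution a b n0 n1 n2 B A0 A1 A2 x0 x" and t: "t \<ge> 0" for x0 x t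
  proof -
    have init: "ae_eq a b (x 0) x0" and X: "\<And>t. t \<ge> 0 \<Longrightarrow> x t \<in> X_space a b n0 n1 n2 B"
      using sol unfolding pde_solution_def by auto
    obtain v where v: "\<And>t. t \<ge> 0 \<Longrightarrow> has_X_derivative a b n0 n1 n2 B x (v t) t"
      and eqn: "\<And>t. t \<ge> 0 \<Longrightarrow> ae_eq a b (v t) (\<lambda>s. A0 s *\<^sub>v x t s + A1 s *\<^sub>v (d1 (x t) s @\<^sub>v d2 (x t) s) + A2 s *\<^sub>v d22 (x t) s)"
      using sol unfolding pde_solution_def d1_def[symmetric] d2_def[symmetric] d22_def[symmetric] by blast
    have L: "x t \<in> L2 a b n" if "t \<ge> 0" for t using regular_L2[OF X_regular[OF X[OF that]]] .
    define V where "V t = ?ip (x t) (P (x t))" for t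
    define V' where "V' t = ?ip (v t) (P (x t)) + ?ip (x t) (P (v t))" for t
    have der: "(V has_real_derivative V' t) (at t within {0..})" if "t \<ge> 0" for t
      unfolding V_def V'_def by (rule quadratic_form_derivative[OF kP X that v[OF that]])
    have Vle: "V t \<le> C * ?ip (x t) (x t)" if "t \<ge> 0" for t
      using C(2)[OF L[OF that] L[OF that]] l2_norm_sq[OF L[OF that]] unfolding V_def by (simp add: power2_eq_square)
    have V': "V' t \<le> - \<kappa> * V t" if t: "t \<ge> 0" for t
    proof -
      note r = X_regular[OF X[OF t]]
      let ?u = "fund (x t)"
      note u = fund_L2[OF r]
      note Tu = is_kop_L2[OF kT u] and Au = is_kop_L2[OF kA u]
      have vX: "v t \<in> X_space a b n0 n1 n2 B" using v[OF t] unfolding has_X_derivative_def by simp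
      note Lv = regular_L2[OF X_regular[OF vX]]
      have eT: "ae_eq a b (x t) (T ?u)" unfolding T_def by (rule ae_eq_sym[OF T_op_fund[OF X[OF t]]])
      have eA: "ae_eq a b (v t) (A ?u)"
        unfolding A_def by (rule ae_eq_trans[OF eqn[OF t] ae_eq_sym[OF A_op_fund[OF A0 A1 A2 X[OF t]]]])
      note PeT = is_kop_ae_cong[OF kP L[OF t] Tu eT] and PeA = is_kop_ae_cong[OF kP Lv Au eA]
      note PL = is_kop_L2[OF kP L[OF t]] is_kop_L2[OF kP Tu] is_kop_L2[OF kP Lv] is_kop_L2[OF kP Au]
      \<comment> \<open>The equation gives the time derivative as A u and the representation gives
        the state as T u, both almost everywhere; \<open>P\<close> respects this, so the inner
        products can be rewritten.\<close>
      have "V' t = ?ip (A ?u) (P (T ?u)) + ?ip (T ?u) (P (A ?u))"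
        unfolding V'_def l2_inner_ae_cong[OF eA PeT Lv Au PL(1,2)] l2_inner_ae_cong[OF eT PeA L[OF t] Tu PL(3,4)] ..
      also have "\<dots> \<le> - \<delta> * ?ip (T ?u) (T ?u)" by (rule dissipative[OF u])
      also have "?ip (T ?u) (T ?u) = ?ip (x t) (x t)"
        by (rule l2_inner_ae_cong[OF eT eT L[OF t] Tu L[OF t] Tu, symmetric])
      also have "- \<delta> * ?ip (x t) (x t) \<le> - \<kappa> * V t"
      proof -
        have "\<kappa> * V t \<le> \<kappa> * (C * ?ip (x t) (x t))" using Vle[OF t] \<kappa> by (intro mult_left_mono) auto
        also have "\<dots> = \<delta> * ?ip (x t) (x t)" unfolding \<kappa>_def using C(1) by simp
        finally show ?thesis by simp
      qed
      finally show ?thesis .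
    qed
    have "\<epsilon> * (?N (x t))^2 \<le> V t" using coercive[OF L[OF t]] l2_norm_sq[OF L[OF t]] unfolding V_def by simp
    also have "\<dots> \<le> V 0 * exp (- \<kappa> * t)" by (rule exponential_decay[OF der V' t])
    also have "\<dots> \<le> C * (?N x0)^2 * exp (- \<kappa> * t)"
    proof -
      note L0 = regular_L2[OF X_regular[OF x0]]
      have "V 0 \<le> C * (?N x0)^2"
        using Vle[of 0] l2_norm_sq[OF L[of 0]] l2_norm_ae_cong[OF init L[of 0] L0] by simp
      then show ?thesis by (intro mult_right_mono) auto
    qed
    \<comment> \<open>Coercivity at time t and the upper bound at time 0 give the ratio
      C/\<epsilon>; the square root taken below halves the rate.\<close>
    finally have "(?N (x t))^2 \<le> C / \<epsilon> * (?N x0)^2 * exp (- \<kappa> * t)" using \<epsilon> by (simp add: field_simps)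
    also have "exp (- \<kappa> * t) = (exp (- (\<kappa> / 2) * t))^2"
      unfolding exp_double[symmetric] by (simp add: field_simps)
    also have "C / \<epsilon> * (?N x0)^2 * (exp (- (\<kappa> / 2) * t))^2 = (sqrt (C / \<epsilon>) * ?N x0 * exp (- (\<kappa> / 2) * t))^2"
      using C(1) \<epsilon> by (simp add: power_mult_distrib)
    finally show ?thesis
      by (rule power2_le_imp_le)
         (use l2_norm_nonneg[OF regular_L2[OF X_regular[OF x0]]] C(1) \<epsilon> in \<open>auto intro!: mult_nonneg_nonneg\<close>)
  qed
  show ?thesis
    by (rule exI[of _ "sqrt (C / \<epsilon>)"], rule conjI, use C(1) \<epsilon> in simp, rule exI[of _ "\<kappa> / 2"], rule conjI, use \<kappa> in simp)
       (use decay in blast)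
qed

end
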